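(* Assume (A1), (A2), $\varrho<-\mu/2$, $\varrho+L_f<0$, and that $f:\mathcal{L}\to\mathbb{X}$ is twice continuously differentiable. Let $\mathcal{A}_\Psi(\omega)$ be the $\mathcal{D}$-pullback random attractor of $\Psi$ and $\Psi(\omega):=\Psi(1,\omega,\cdot):H\to H$. Then $\Psi(\omega)$ is $P$-almost surely differentiable on $\mathcal{A}_\Psi(\omega)$ in the following sense: there exist a random variable $K$ with $K(\omega)\ge1$ for all $\omega\in\Omega$ and a number $\alpha>0$ such that, $P$-almost surely, for every $u\in\mathcal{A}_\Psi(\omega)$ there exists a continuous linear operator $D\Psi(\omega,u):H\to H$ such that if $u,u+h\in\mathcal{A}_\Psi(\omega)$, then $$\|\Psi(\omega)(u+h)-\Psi(\omega)u-D\Psi(\omega,u)h\|\le K(\omega)\|h\|^{1+\alpha}.$$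
   Context: Setting. $\mathbb{X}$ is a Hilbert space, $\tau>0$, $\mu>0$, $\mathcal{L}=L^2([-\tau,0],\mathbb{X})$ with its usual norm, and $H=\mathcal{L}\times\mathbb{X}$ is the product Hilbert space, with inner product $((\phi,h),(\psi,k))=\int_{-\tau}^0(\phi(s),\psi(s))_{\mathbb{X}}ds+(h,k)_{\mathbb{X}}$ and norm $\|\cdot\|$. For a function $v$ on $[-\tau,\infty)$, $v_t(\xi)=v(t+\xi)$, $\xi\in[-\tau,0]$. The underlying equation is the stochastic delay equation $\frac{du}{dt}=Au-\mu u-Lu_t+f(u_t)+\sum_{j=1}^m g_j\frac{dw_j}{dt}$, with $L:\mathcal{L}\to\mathbb{X}$ bounded linear, $f:\mathcal{L}\to\mathbb{X}$, $g_j\in D(A)$. Probability space. $\Omega=\{\omega=(\omega_1,\dots,\omega_m)\in C(\mathbb{R};\mathbb{R}^m):\omega(0)=0\}$ with the Borel $\sigma$-algebra $\mathcal{F}$ of the compact-open topology, $P$ is Wiener measure, $W(t)=\omega(t)$, and $\theta_t\omega(\cdot)=\omega(\cdot+t)-\omega(t)$. Put $z_j(\theta_t\omega_j)=-\mu\int_{-\infty}^0e^{\mu s}(\theta_t\omega_j)(s)\,ds$ (stationary solution of $dz_j+\mu z_j\,dt=dw_j$), $z(\theta_t\omega)=\sum_{j=1}^m g_jz_j(\theta_t\omega_j)$, and $Z(\omega)=(z(\theta_{\cdot}\omega)|_{[-\tau,0]},z(\omega))\in H$. Random dynamical systems. For $(\phi,h)\in H$ let $v$ be the mild solution of $$\frac{dv}{dt}=Av-\mu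 v-Lv_t-Lz(\theta_{t+\cdot}\omega)+f(v_t+z(\theta_{t+\cdot}\omega))+Az(\theta_t\omega),\quad v_0=\phi,\ v(0)=h,$$ where $z(\theta_{t+\cdot}\omega)\in\mathcal{L}$ is $\xi\mapsto z(\theta_{t+\xi}\omega)$. Set $\Phi(t,\omega,(\phi,h))=(v_t,v(t))$ and $\Psi(t,\omega,\chi)=\Phi(t,\omega,\chi-Z(\omega))+Z(\theta_t\omega)$ for $\chi\in H$, $t\ge0$. Both are random dynamical systems (cocycles) on $H$ over $(\Omega,\mathcal{F},P,(\theta_t))$. Hypotheses. (A1) $A:D(A)\subset\mathbb{X}\to\mathbb{X}$ is densely defined, linear, and generates a strongly continuous compact semigroup $S(t)$ on $\mathbb{X}$; $\|L\|\le\mu$; and $\varrho:=s(\tilde A)-\mu<0$, where $\tilde A(\phi,h)=(\dot\phi,Ah)$ on $D(\tilde A)=\{(\phi,h)\in H:\phi$ is differentiable on $[-\tau,0]$, $\dot\phi\in\mathcal{L}$, $h=\phi(0)\in D(A)\}$ and $s(\tilde A)=\sup\{\Re\lambda:\lambda\in\sigma(\tilde A)\}$. (A2) $f(0)=0$ and $\|f(\phi)-f(\varphi)\|_{\mathbb{X}}\le L_f\|\phi-\varphi\|_{\mathcal{L}}$ for all $\phi,\varphi\in\mathcal{L}$. Attractor. A random set is a map $\omega\mapsto D(\omega)$ into closed subsets of $H$ such that $\omega\mapsto\inf_{y\in D(\omega)}\|x-y\|$ is measurable for each $x\in H$. It is tempered if for $P$-a.e. $\omega$, $\lim_{t\to\infty}e^{-\beta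 t}\sup_{x\in D(\theta_{-t}\omega)}\|x\|=0$ for all $\beta>0$. $\mathcal{D}$ is the class of tempered random sets. A $\mathcal{D}$-pullback random attractor of $\Psi$ is a compact random set $\mathcal{A}(\omega)$ with $\Psi(t,\omega,\mathcal{A}(\omega))=\mathcal{A}(\theta_t\omega)$ for all $t\ge0$ and $\lim_{t\to\infty}\operatorname{dist}(\Psi(t,\theta_{-t}\omega,D(\theta_{-t}\omega)),\mathcal{A}(\omega))=0$ for all $D\in\mathcal{D}$ and $P$-a.e. $\omega$, where $\operatorname{dist}(A,B)=\sup_{x\in A}\inf_{y\in B}\|x-y\|$. Under (A1), (A2), $\varrho<-\mu/2$, $\varrho+L_f<0$ the paper establishes that $\Psi$ has a unique such attractor $\mathcal{A}_\Psi\in\mathcal{D}$. *)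

theory Defs
  imports "HOL-Probability.Probability"
begin

section \<open>The Hilbert spaces \<open>L\<^sup>2([-\<tau>,0], X)\<close> and \<open>H\<close>\<close>

text \<open>
  \<open>X\<close> is a real Hilbert space. Bochner integration in the library is set up for second countable
  spaces, so \<open>X\<close> carries the class \<open>second_countable_topology\<close>. Nothing is lost: a Hilbert space
  that carries a compact strongly continuous semigroup is separable, see
  \<open>compact_semigroup_separable\<close> below.

  The type \<open>'x L2\<close> is \<open>L\<^sup>2(\<real>, X)\<close>. Since \<open>\<tau>\<close> is a term variable, \<open>L\<^sup>2([-\<tau>,0], X)\<close> is the closed
  subspace \<open>hist_space \<tau>\<close> of those classes that vanish almost everywhere outside \<open>[-\<tau>,0]\<close>, with the
  inherited inner product.
\<close>

definition l2_fun :: "(real \<Rightarrow> 'x::{real_inner,banach,second_countable_topology}) \<Rightarrow> bool"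
  where "l2_fun f \<longleftrightarrow> f \<in> borel_measurable lborel \<and> integrable lborel (\<lambda>s. (norm (f s))\<^sup>2)"

definition l2_rel :: "(real \<Rightarrow> 'x::{real_inner,banach,second_countable_topology}) \<Rightarrow> (real \<Rightarrow> 'x) \<Rightarrow> bool"
  where "l2_rel f g \<longleftrightarrow> l2_fun f \<and> l2_fun g \<and> (AE s in lborel. f s = g s)"

lemma l2_fun_zero [simp]: "l2_fun (\<lambda>_. 0)"
  by (simp add: l2_fun_def)

lemma l2_fun_scaleR: "l2_fun f \<Longrightarrow> l2_fun (\<lambda>s. c *\<^sub>R f s)"
  by (auto simp: l2_fun_def power_mult_distrib)

lemma l2_fun_add:
  assumes "l2_fun f" "l2_fun g"
  shows "l2_fun (\<lambda>s. f s + g s)"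
proof -
  have [measurable]: "f \<in> borel_measurable lborel" "g \<in> borel_measurable lborel"
    and i: "integrable lborel (\<lambda>s. (norm (f s))\<^sup>2)" "integrable lborel (\<lambda>s. (norm (g s))\<^sup>2)"
    using assms by (auto simp: l2_fun_def)
  have le: "(norm (f s + g s))\<^sup>2 \<le> 2 * (norm (f s))\<^sup>2 + 2 * (norm (g s))\<^sup>2" for s
  proof -
    have "(norm (f s + g s))\<^sup>2 \<le> (norm (f s) + norm (g s))\<^sup>2"
      by (intro power_mono norm_triangle_ineq norm_ge_zero)
    also have "\<dots> \<le> 2 * (norm (f s))\<^sup>2 + 2 * (norm (g s))\<^sup>2"
      using zero_le_power2[of "norm (f s) - norm (g s)"]
      by (simp add: power2_sum power2_diff)
    finally show ?thesis .
  qed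
  have "integrable lborel (\<lambda>s. (norm (f s + g s))\<^sup>2)"
    by (rule Bochner_Integration.integrable_bound
          [where f = "\<lambda>s. 2 * (norm (f s))\<^sup>2 + 2 * (norm (g s))\<^sup>2"])
      (use i le in auto)
  then show ?thesis by (simp add: l2_fun_def)
qed

lemma l2_fun_uminus: "l2_fun f \<Longrightarrow> l2_fun (\<lambda>s. - f s)"
  using l2_fun_scaleR[of f "-1"] by simp

lemma l2_fun_diff: "l2_fun f \<Longrightarrow> l2_fun g \<Longrightarrow> l2_fun (\<lambda>s. f s - g s)"
  using l2_fun_add[OF _ l2_fun_uminus, of f g] by simp

lemma l2_fun_inner_integrable:
  assumes "l2_fun f" "l2_fun g"
  shows "integrable lborel (\<lambda>s. f s \<bullet> g s)"
proof -
  have [measurable]: "f \<in> borel_measurable lborel" "g \<in> borel_measurable lborel"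
    and i: "integrable lborel (\<lambda>s. (norm (f s))\<^sup>2)" "integrable lborel (\<lambda>s. (norm (g s))\<^sup>2)"
    using assms by (auto simp: l2_fun_def)
  have le: "\<bar>f s \<bullet> g s\<bar> \<le> (norm (f s))\<^sup>2 + (norm (g s))\<^sup>2" for s
  proof -
    have "\<bar>f s \<bullet> g s\<bar> \<le> norm (f s) * norm (g s)"
      by (rule Cauchy_Schwarz_ineq2)
    also have "\<dots> \<le> (norm (f s))\<^sup>2 + (norm (g s))\<^sup>2"
      using zero_le_power2[of "norm (f s) - norm (g s)"]
        mult_nonneg_nonneg[OF norm_ge_zero norm_ge_zero, of "f s" "g s"]
      unfolding power2_diff by linarith
    finally show ?thesis .
  qed
  show ?thesis
    by (rule Bochner_Integration.integrable_bound
          [where f = "\<lambda>s. (norm (f s))\<^sup>2 + (norm (g s))\<^sup>2"])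
      (use i le in auto)
qed

quotient_type (overloaded) 'x L2 =
  "real \<Rightarrow> 'x::{real_inner,banach,second_countable_topology}" / partial: l2_rel
proof (rule part_equivpI)
  show "\<exists>f. l2_rel f f"
    by (intro exI[of _ "\<lambda>_. 0"]) (simp add: l2_rel_def)
  show "symp l2_rel"
    by (auto simp: symp_def l2_rel_def)
  show "transp l2_rel"
    by (auto simp: transp_def l2_rel_def)
qed

instantiation L2 :: ("{real_inner,banach,second_countable_topology}") real_inner
begin

lift_definition zero_L2 :: "'a L2" is "\<lambda>_. 0"
  by (simp add: l2_rel_def)

lift_definition plus_L2 :: "'a L2 \<Rightarrow> 'a L2 \<Rightarrow> 'a L2" is "\<lambda>f g s. f s + g s"
  by (auto simp: l2_rel_def l2_fun_add)

lift_definition minus_L2 :: "'a L2 \<Rightarrow> 'a L2 \<Rightarrow> 'a L2" is "\<lambda>f g s. f s - g s"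
  by (auto simp: l2_rel_def l2_fun_diff)

lift_definition uminus_L2 :: "'a L2 \<Rightarrow> 'a L2" is "\<lambda>f s. - f s"
  by (auto simp: l2_rel_def l2_fun_uminus)

lift_definition scaleR_L2 :: "real \<Rightarrow> 'a L2 \<Rightarrow> 'a L2" is "\<lambda>c f s. c *\<^sub>R f s"
  by (auto simp: l2_rel_def l2_fun_scaleR)

lift_definition inner_L2 :: "'a L2 \<Rightarrow> 'a L2 \<Rightarrow> real" is "\<lambda>f g. \<integral>s. f s \<bullet> g s \<partial>lborel"
proof -
  fix f1 f2 g1 g2 :: "real \<Rightarrow> 'a"
  assume "l2_rel f1 f2" "l2_rel g1 g2"
  then have [measurable]: "f1 \<in> borel_measurable lborel" "f2 \<in> borel_measurable lborel"
      "g1 \<in> borel_measurable lborel" "g2 \<in> borel_measurable lborel"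
    and eq: "AE s in lborel. f1 s = f2 s" "AE s in lborel. g1 s = g2 s"
    by (auto simp: l2_rel_def l2_fun_def)
  show "(\<integral>s. f1 s \<bullet> g1 s \<partial>lborel) = (\<integral>s. f2 s \<bullet> g2 s \<partial>lborel)"
  proof (rule integral_cong_AE)
    show "AE s in lborel. f1 s \<bullet> g1 s = f2 s \<bullet> g2 s"
      using eq by eventually_elim simp
  qed measurable
qed

definition norm_L2 :: "'a L2 \<Rightarrow> real" where "norm_L2 x = sqrt (x \<bullet> x)"

definition dist_L2 :: "'a L2 \<Rightarrow> 'a L2 \<Rightarrow> real" where "dist_L2 x y = norm (x - y)"

definition sgn_L2 :: "'a L2 \<Rightarrow> 'a L2" where "sgn_L2 x = inverse (norm x) *\<^sub>R x"

definition uniformity_L2 :: "('a L2 \<times> 'a L2) filter"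
  where "uniformity_L2 = (INF e\<in>{0<..}. principal {(x, y). dist x y < e})"

definition open_L2 :: "'a L2 set \<Rightarrow> bool"
  where "open_L2 U \<longleftrightarrow> (\<forall>x\<in>U. \<forall>\<^sub>F (x', y) in uniformity. x' = x \<longrightarrow> y \<in> U)"

instance
proof
  fix a b c :: "'a L2" and r q :: real and U :: "'a L2 set"
  show "a + b + c = a + (b + c)"
    by transfer (auto simp: l2_rel_def l2_fun_add add.assoc)
  show "a + b = b + a"
    by transfer (auto simp: l2_rel_def l2_fun_add add.commute)
  show "0 + a = a"
    by transfer (auto simp: l2_rel_def)
  show "- a + a = 0"
    by transfer (auto simp: l2_rel_def)
  show "a - b = a + - b"
    by transfer (auto simp: l2_rel_def l2_fun_diff)
  show "r *\<^sub>R (a + b) = r *\<^sub>R a + r *\<^sub>R b"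
    by transfer (auto simp: l2_rel_def l2_fun_add l2_fun_scaleR scaleR_add_right)
  show "(r + q) *\<^sub>R a = r *\<^sub>R a + q *\<^sub>R a"
    by transfer (auto simp: l2_rel_def l2_fun_add l2_fun_scaleR scaleR_add_left)
  show "r *\<^sub>R q *\<^sub>R a = (r * q) *\<^sub>R a"
    by transfer (auto simp: l2_rel_def l2_fun_scaleR)
  show "1 *\<^sub>R a = a"
    by transfer (auto simp: l2_rel_def)
  show "dist a b = norm (a - b)" by (rule dist_L2_def)
  show "sgn a = inverse (norm a) *\<^sub>R a" by (rule sgn_L2_def)
  show "uniformity = (INF e\<in>{0<..}. principal {(x::'a L2, y). dist x y < e})"
    by (rule uniformity_L2_def)
  show "open U = (\<forall>x\<in>U. \<forall>\<^sub>F (x', y) in uniformity. x' = x \<longrightarrow> y \<in> U)"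
    by (rule open_L2_def)
  show "a \<bullet> b = b \<bullet> a"
    by transfer (simp add: inner_commute)
  show "(a + b) \<bullet> c = a \<bullet> c + b \<bullet> c"
    by transfer (simp add: l2_rel_def inner_add_left l2_fun_inner_integrable)
  show "(r *\<^sub>R a) \<bullet> b = r * (a \<bullet> b)"
    by transfer simp
  show "0 \<le> a \<bullet> a"
    by transfer simp
  show "a \<bullet> a = 0 \<longleftrightarrow> a = 0"
  proof transfer
    fix f :: "real \<Rightarrow> 'a" assume f: "l2_rel f f"
    then have "integrable lborel (\<lambda>s. f s \<bullet> f s)"
      by (simp add: l2_rel_def l2_fun_inner_integrable)
    then have "(\<integral>s. f s \<bullet> f s \<partial>lborel) = 0 \<longleftrightarrow> (AE s in lborel. f s \<bullet> f s = 0)"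
      by (intro integral_nonneg_eq_0_iff_AE) auto
    then show "(\<integral>s. f s \<bullet> f s \<partial>lborel) = 0 \<longleftrightarrow> l2_rel f (\<lambda>_. 0)"
      using f by (auto simp: l2_rel_def)
  qed
  show "norm a = sqrt (a \<bullet> a)" by (rule norm_L2_def)
qed

end

definition hist_space :: "real \<Rightarrow> 'x::{real_inner,banach,second_countable_topology} L2 set"
  where "hist_space \<tau> = {\<phi>. AE s in lborel. s \<notin> {-\<tau>..0} \<longrightarrow> rep_L2 \<phi> s = 0}"

text \<open>The norm and inner product on \<open>H\<close> are those of the product type \<open>'x L2 \<times> 'x\<close>.\<close>

definition state_space :: "real \<Rightarrow> ('x::{real_inner,banach,second_countable_topology} L2 \<times> 'x) set"
  where "state_space \<tau> = hist_space \<tau> \<times> UNIV"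

definition seg :: "real \<Rightarrow> (real \<Rightarrow> 'x::{real_inner,banach,second_countable_topology}) \<Rightarrow> real \<Rightarrow> 'x L2"
  where "seg \<tau> v t = abs_L2 (\<lambda>\<xi>. if \<xi> \<in> {-\<tau>..0} then v (t + \<xi>) else 0)"

text \<open>
  A bounded linear map on \<open>hist_space \<tau>\<close> or \<open>state_space \<tau>\<close> is represented by an element of
  \<open>\<Rightarrow>\<^sub>L\<close> on the ambient type. Composition with the orthogonal projection (multiplication by
  the indicator of \<open>[-\<tau>,0]\<close>) extends every such map with the same norm. The
  same extension turns derivatives on \<open>V\<close> into the derivatives \<open>f'\<close>, \<open>f''\<close> below.
\<close>

definition C2_on :: "'a::real_normed_vector set \<Rightarrow> ('a \<Rightarrow> 'b::real_normed_vector) \<Rightarrow> bool"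
  where "C2_on V f \<longleftrightarrow> (\<exists>(f' :: 'a \<Rightarrow> 'a \<Rightarrow>\<^sub>L 'b) (f'' :: 'a \<Rightarrow> 'a \<Rightarrow>\<^sub>L 'a \<Rightarrow>\<^sub>L 'b).
    (\<forall>x\<in>V. (f has_derivative blinfun_apply (f' x)) (at x within V)) \<and>
    (\<forall>x\<in>V. (f' has_derivative blinfun_apply (f'' x)) (at x within V)) \<and>
    continuous_on V f'')"


section \<open>Semigroups, generators and spectra\<close>

definition C0_semigroup :: "(real \<Rightarrow> 'x::real_normed_vector \<Rightarrow> 'x) \<Rightarrow> bool"
  where "C0_semigroup S \<longleftrightarrow>
    (\<forall>t\<ge>0. bounded_linear (S t)) \<and> S 0 = id \<and>
    (\<forall>s\<ge>0. \<forall>t\<ge>0. S (s + t) = S s \<circ> S t) \<and>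
    (\<forall>x. ((\<lambda>t. S t x) \<longlongrightarrow> x) (at_right 0))"

definition generates :: "'x::real_normed_vector set \<Rightarrow> ('x \<Rightarrow> 'x) \<Rightarrow> (real \<Rightarrow> 'x \<Rightarrow> 'x) \<Rightarrow> bool"
  where "generates DA A S \<longleftrightarrow>
    DA = {x. \<exists>y. ((\<lambda>t. (S t x - x) /\<^sub>R t) \<longlongrightarrow> y) (at_right 0)} \<and>
    (\<forall>x\<in>DA. ((\<lambda>t. (S t x - x) /\<^sub>R t) \<longlongrightarrow> A x) (at_right 0))"

definition compact_operator :: "('a::real_normed_vector \<Rightarrow> 'b::real_normed_vector) \<Rightarrow> bool"
  where "compact_operator T \<longleftrightarrow> (\<forall>B. bounded B \<longrightarrow> compact (closure (T ` B)))"

definition compact_semigroup :: "(real \<Rightarrow> 'x::real_normed_vector \<Rightarrow> 'x) \<Rightarrow> bool"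
  where "compact_semigroup S \<longleftrightarrow> (\<forall>t>0. compact_operator (S t))"

definition linear_operator :: "'x::real_vector set \<Rightarrow> ('x \<Rightarrow> 'x) \<Rightarrow> bool"
  where "linear_operator D T \<longleftrightarrow> subspace D \<and>
    (\<forall>x\<in>D. \<forall>y\<in>D. T (x + y) = T x + T y) \<and> (\<forall>c. \<forall>x\<in>D. T (c *\<^sub>R x) = c *\<^sub>R T x)"

lemma compact_semigroup_separable:
  fixes S :: "real \<Rightarrow> 'x::real_normed_vector \<Rightarrow> 'x"
  assumes "C0_semigroup S" "compact_semigroup S"
  shows "\<exists>B :: 'x set. countable B \<and> closure B = UNIV"
proof -
  define K where "K n k = closure (S (1 / Suc n) ` cball 0 (real k))" for n k :: nat
  have compact_K: "compact (K n k)" for n k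
    using assms(2) by (auto simp: K_def compact_semigroup_def compact_operator_def)
  have sep: "\<exists>C. countable C \<and> M \<subseteq> closure C" if "compact M" for M :: "'x set"
  proof -
    have "\<exists>F. finite F \<and> M \<subseteq> (\<Union>x\<in>F. ball x (1 / Suc i))" for i
    proof -
      have "\<forall>e>0. \<exists>k. finite k \<and> M \<subseteq> (\<Union>x\<in>k. ball x e)"
        using that by (simp add: compact_eq_totally_bounded)
      then show ?thesis by simp
    qed
    then have "\<forall>i. \<exists>F. finite F \<and> M \<subseteq> (\<Union>x\<in>F. ball x (1 / Suc i))" by blast
    from choice[OF this] obtain F
      where F: "\<And>i. finite (F i)" "\<And>i. M \<subseteq> (\<Union>x\<in>F i. ball x (1 / Suc i))"
      by blast
    have "x \<in> closure (\<Union>i. F i)" if xM: "x \<in> M" for x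
      unfolding closure_approachable
    proof (intro allI impI)
      fix e :: real assume "0 < e"
      then obtain i where i: "1 / Suc i < e" using nat_approx_posE by blast
      have "x \<in> (\<Union>y\<in>F i. ball y (1 / Suc i))" using F(2) xM by (rule subsetD)
      then obtain y where y: "y \<in> F i" "dist y x < 1 / Suc i"
        unfolding UN_iff mem_ball by blast
      have "dist y x < e" using y(2) i by linarith
      then show "\<exists>y\<in>\<Union>i. F i. dist y x < e" using y(1) by blast
    qed
    moreover have "countable (\<Union>i. F i)" by (intro countable_UN) (auto simp: F countable_finite)
    ultimately show ?thesis by blast
  qed
  define C where "C n k = (SOME c. countable c \<and> K n k \<subseteq> closure c)" for n k
  have "countable (C n k) \<and> K n k \<subseteq> closure (C n k)" for n k
    unfolding C_def using sep[OF compact_K] by (rule someI_ex)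
  then have C: "countable (C n k)" "K n k \<subseteq> closure (C n k)" for n k
    by simp_all
  define B where "B = (\<Union>n k. C n k)"
  have "x \<in> closure B" for x
  proof -
    obtain k where k: "norm x \<le> real k" using real_arch_simple by blast
    have "S (1 / Suc n) x \<in> closure B" for n
    proof -
      have "S (1 / Suc n) x \<in> K n k"
        unfolding K_def using k by (intro closure_subset[THEN subsetD] imageI) auto
      also have "K n k \<subseteq> closure (C n k)" by (rule C)
      also have "\<dots> \<subseteq> closure B" by (intro closure_mono) (auto simp: B_def)
      finally show ?thesis .
    qed
    moreover have "(\<lambda>n. S (1 / Suc n) x) \<longlonglongrightarrow> x"
    proof -
      have "filterlim (\<lambda>n. 1 / real (Suc n)) (at_right 0) sequentially"
        using LIMSEQ_Suc[OF lim_1_over_n[where 'a = real]] by (auto simp: filterlim_at)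
      moreover have "((\<lambda>t. S t x) \<longlongrightarrow> x) (at_right 0)"
        using assms(1) by (simp add: C0_semigroup_def)
      ultimately show ?thesis
        by (rule filterlim_compose[rotated])
    qed
    ultimately show ?thesis
      by (rule Lim_in_closed_set[OF closed_closure always_eventually[OF allI] sequentially_bot])
  qed
  then have "closure B = UNIV" by (simp add: set_eq_iff)
  moreover have "countable B" using C(1) by (auto simp: B_def)
  ultimately show ?thesis by (intro exI[of _ B] conjI)
qed

text \<open>
  The spectrum of a (partially defined) operator \<open>T\<close> with domain \<open>D\<close> in a real space with carrier
  \<open>V\<close> is that of its complexification: the pair \<open>(u, v)\<close> stands for \<open>u + i v\<close>, and
  \<open>shifted T z (u, v)\<close> is \<open>(z - T)(u + i v)\<close>. For \<open>z\<close> in the resolvent set, \<open>z - T\<close> is a bijection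
  from the domain onto the space with bounded inverse.
\<close>

definition shifted :: "('a::real_vector \<Rightarrow> 'a) \<Rightarrow> complex \<Rightarrow> 'a \<times> 'a \<Rightarrow> 'a \<times> 'a"
  where "shifted T z = (\<lambda>(u, v).
    (Re z *\<^sub>R u - Im z *\<^sub>R v - T u, Im z *\<^sub>R u + Re z *\<^sub>R v - T v))"

definition resolvent_set :: "'a::real_normed_vector set \<Rightarrow> 'a set \<Rightarrow> ('a \<Rightarrow> 'a) \<Rightarrow> complex set"
  where "resolvent_set V D T = {z. bij_betw (shifted T z) (D \<times> D) (V \<times> V) \<and>
    (\<exists>C. \<forall>w\<in>D \<times> D. norm w \<le> C * norm (shifted T z w))}"

definition spectrum :: "'a::real_normed_vector set \<Rightarrow> 'a set \<Rightarrow> ('a \<Rightarrow> 'a) \<Rightarrow> complex set"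
  where "spectrum V D T = - resolvent_set V D T"

text \<open>Extended-real valued, so that the supremum over an empty spectrum is \<open>-\<infinity>\<close>.\<close>

definition spectral_bound :: "'a::real_normed_vector set \<Rightarrow> 'a set \<Rightarrow> ('a \<Rightarrow> 'a) \<Rightarrow> ereal"
  where "spectral_bound V D T = (SUP z\<in>spectrum V D T. ereal (Re z))"

text \<open>
  \<open>hist_deriv \<tau> \<phi> h \<psi>\<close>: \<open>\<phi>\<close> has an absolutely continuous representative on \<open>[-\<tau>,0]\<close> whose
  value at \<open>0\<close> is \<open>h\<close> and whose almost everywhere derivative is \<open>\<psi>\<close>, an element of
  \<open>L\<^sup>2([-\<tau>,0], X)\<close>. This is how differentiability of \<open>\<phi>\<close> with derivative in \<open>L\<^sup>2\<close> has to be
  understood: if differentiability were required at every point of \<open>[-\<tau>,0]\<close>, no shift of the operator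
  would be onto and its spectrum would be all of the complex plane.
\<close>

definition hist_deriv ::
    "real \<Rightarrow> 'x::{real_inner,banach,second_countable_topology} L2 \<Rightarrow> 'x \<Rightarrow> 'x L2 \<Rightarrow> bool"
  where "hist_deriv \<tau> \<phi> h \<psi> \<longleftrightarrow> \<phi> \<in> hist_space \<tau> \<and> \<psi> \<in> hist_space \<tau> \<and>
    (AE \<xi> in lborel. \<xi> \<in> {-\<tau>..0} \<longrightarrow> rep_L2 \<phi> \<xi> = h - (LBINT s:{\<xi>..0}. rep_L2 \<psi> s))"

definition tilde_dom ::
    "real \<Rightarrow> 'x set \<Rightarrow> ('x::{real_inner,banach,second_countable_topology} L2 \<times> 'x) set"
  where "tilde_dom \<tau> DA = {(\<phi>, h). h \<in> DA \<and> (\<exists>\<psi>. hist_deriv \<tau> \<phi> h \<psi>)}"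

definition tilde_op ::
    "real \<Rightarrow> ('x \<Rightarrow> 'x) \<Rightarrow> 'x::{real_inner,banach,second_countable_topology} L2 \<times> 'x \<Rightarrow> 'x L2 \<times> 'x"
  where "tilde_op \<tau> A = (\<lambda>(\<phi>, h). (THE \<psi>. hist_deriv \<tau> \<phi> h \<psi>, A h))"

definition varrho ::
    "real \<Rightarrow> real \<Rightarrow> 'x::{real_inner,banach,second_countable_topology} set \<Rightarrow> ('x \<Rightarrow> 'x) \<Rightarrow> ereal"
  where "varrho \<tau> \<mu> DA A = spectral_bound (state_space \<tau>) (tilde_dom \<tau> DA) (tilde_op \<tau> A) - ereal \<mu>"


section \<open>Wiener space\<close>

definition path_space :: "(real \<Rightarrow> real ^ 'm) set"
  where "path_space = {\<omega>. continuous_on UNIV \<omega> \<and> \<omega> 0 = 0}"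

definition compact_open :: "(real \<Rightarrow> real ^ 'm) topology"
  where "compact_open = topology_generated_by
    {{\<omega> \<in> path_space. \<omega> ` K \<subseteq> U} |K U. compact K \<and> open U}"

definition path_algebra :: "(real \<Rightarrow> real ^ 'm) measure"
  where "path_algebra = sigma path_space {U. openin compact_open U}"

text \<open>Two-sided Wiener measure: the coordinate process has independent components and
  independent increments, and \<open>W\<^sub>j(t) - W\<^sub>j(s)\<close> is centred Gaussian with variance \<open>t - s\<close>, for
  all real \<open>s < t\<close>.\<close>

definition wiener_measure :: "(real \<Rightarrow> real ^ 'm) measure \<Rightarrow> bool"
  where "wiener_measure P \<longleftrightarrow>
    prob_space P \<and> space P = path_space \<and> sets P = sets path_algebra \<and>
    (\<forall>j s t. s < t \<longrightarrow>
      distributed P lborel (\<lambda>\<omega>. \<omega> t $ j - \<omega> s $ j) (\<lambda>x. ennreal (normal_density 0 (sqrt (t - s)) x))) \<and>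
    (\<forall>(r :: nat \<Rightarrow> real) n. strict_mono r \<longrightarrow>
      prob_space.indep_vars P (\<lambda>_. borel) (\<lambda>(k, j) \<omega>. \<omega> (r (Suc k)) $ j - \<omega> (r k) $ j)
        ({..<n} \<times> (UNIV :: 'm set)))"

definition wshift :: "real \<Rightarrow> (real \<Rightarrow> real ^ 'm) \<Rightarrow> real \<Rightarrow> real ^ 'm"
  where "wshift t \<omega> = (\<lambda>s. \<omega> (s + t) - \<omega> t)"

text \<open>The integral exists for almost every \<open>\<omega>\<close>. For the exceptional \<open>\<omega>\<close> the library's integral is \<open>0\<close>,
  and then it is \<open>0\<close> along the whole orbit \<open>wshift t \<omega>\<close>.\<close>

definition OU :: "real \<Rightarrow> 'm \<Rightarrow> (real \<Rightarrow> real ^ 'm) \<Rightarrow> real"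
  where "OU \<mu> j \<omega> = - \<mu> * (LBINT s:{..0}. exp (\<mu> * s) * \<omega> s $ j)"

definition noise :: "real \<Rightarrow> ('m::finite \<Rightarrow> 'x::real_vector) \<Rightarrow> (real \<Rightarrow> real ^ 'm) \<Rightarrow> 'x"
  where "noise \<mu> g \<omega> = (\<Sum>j\<in>UNIV. OU \<mu> j \<omega> *\<^sub>R g j)"

definition noise_path :: "real \<Rightarrow> ('m::finite \<Rightarrow> 'x::real_vector) \<Rightarrow> (real \<Rightarrow> real ^ 'm) \<Rightarrow> real \<Rightarrow> 'x"
  where "noise_path \<mu> g \<omega> = (\<lambda>t. noise \<mu> g (wshift t \<omega>))"

definition noise_state ::
    "real \<Rightarrow> real \<Rightarrow> ('m::finite \<Rightarrow> 'x::{real_inner,banach,second_countable_topology}) \<Rightarrow>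
     (real \<Rightarrow> real ^ 'm) \<Rightarrow> 'x L2 \<times> 'x"
  where "noise_state \<tau> \<mu> g \<omega> = (seg \<tau> (noise_path \<mu> g \<omega>) 0, noise \<mu> g \<omega>)"


section \<open>The random dynamical systems\<close>

text \<open>
  Variation of constants with respect to the semigroup \<open>S\<close> generated by \<open>A\<close>, with \<open>- \<mu> v\<close> as part of
  the inhomogeneity. The values of \<open>v\<close> on \<open>(-\<infinity>,-\<tau>)\<close> do not matter, those on \<open>[-\<tau>,0)\<close> only up to
  null sets. A mild solution is unique up to this, so \<open>Phi\<close> does not depend on the choice
  made by \<open>SOME\<close>.
\<close>

definition mild_solution ::
    "real \<Rightarrow> real \<Rightarrow> ('x \<Rightarrow> 'x) \<Rightarrow> (real \<Rightarrow> 'x \<Rightarrow> 'x) \<Rightarrow> ('x L2 \<Rightarrow>\<^sub>L 'x) \<Rightarrow> ('x L2 \<Rightarrow> 'x) \<Rightarrow>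
     ('m::finite \<Rightarrow> 'x::{real_inner,banach,second_countable_topology}) \<Rightarrow>
     (real \<Rightarrow> real ^ 'm) \<Rightarrow> 'x L2 \<times> 'x \<Rightarrow> (real \<Rightarrow> 'x) \<Rightarrow> bool"
  where "mild_solution \<tau> \<mu> A S L f g \<omega> p v \<longleftrightarrow>
    l2_fun (\<lambda>\<xi>. if \<xi> \<in> {-\<tau>..0} then v \<xi> else 0) \<and>
    seg \<tau> v 0 = fst p \<and> v 0 = snd p \<and> continuous_on {0..} v \<and>
    (\<forall>t\<ge>0. v t = S t (snd p) + (LBINT s:{0..t}. S (t - s)
      (- \<mu> *\<^sub>R v s - L (seg \<tau> v s) - L (seg \<tau> (noise_path \<mu> g \<omega>) s)
        + f (seg \<tau> v s + seg \<tau> (noise_path \<mu> g \<omega>) s) + A (noise_path \<mu> g \<omega> s))))"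

definition Phi ::
    "real \<Rightarrow> real \<Rightarrow> ('x \<Rightarrow> 'x) \<Rightarrow> (real \<Rightarrow> 'x \<Rightarrow> 'x) \<Rightarrow> ('x L2 \<Rightarrow>\<^sub>L 'x) \<Rightarrow> ('x L2 \<Rightarrow> 'x) \<Rightarrow>
     ('m::finite \<Rightarrow> 'x::{real_inner,banach,second_countable_topology}) \<Rightarrow>
     real \<Rightarrow> (real \<Rightarrow> real ^ 'm) \<Rightarrow> 'x L2 \<times> 'x \<Rightarrow> 'x L2 \<times> 'x"
  where "Phi \<tau> \<mu> A S L f g t \<omega> p =
    (let v = (SOME v. mild_solution \<tau> \<mu> A S L f g \<omega> p v) in (seg \<tau> v t, v t))"

definition Psi ::
    "real \<Rightarrow> real \<Rightarrow> ('x \<Rightarrow> 'x) \<Rightarrow> (real \<Rightarrow> 'x \<Rightarrow> 'x) \<Rightarrow> ('x L2 \<Rightarrow>\<^sub>L 'x) \<Rightarrow> ('x L2 \<Rightarrow> 'x) \<Rightarrow>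
     ('m::finite \<Rightarrow> 'x::{real_inner,banach,second_countable_topology}) \<Rightarrow>
     real \<Rightarrow> (real \<Rightarrow> real ^ 'm) \<Rightarrow> 'x L2 \<times> 'x \<Rightarrow> 'x L2 \<times> 'x"
  where "Psi \<tau> \<mu> A S L f g t \<omega> p =
    Phi \<tau> \<mu> A S L f g t \<omega> (p - noise_state \<tau> \<mu> g \<omega>) + noise_state \<tau> \<mu> g (wshift t \<omega>)"


section \<open>Random sets and pullback attractors\<close>

text \<open>Infima and suprema of distances and norms are taken in \<open>[0,\<infinity>]\<close>, so that
  unbounded and empty sets need no separate treatment.\<close>

definition set_dist :: "'h::metric_space \<Rightarrow> 'h set \<Rightarrow> ennreal"
  where "set_dist x B = (INF y\<in>B. ennreal (dist x y))"

definition semidist :: "'h::metric_space set \<Rightarrow> 'h set \<Rightarrow> ennreal"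
  where "semidist A B = (SUP x\<in>A. set_dist x B)"

definition random_set :: "'w measure \<Rightarrow> 'h::metric_space set \<Rightarrow> ('w \<Rightarrow> 'h set) \<Rightarrow> bool"
  where "random_set P H D \<longleftrightarrow>
    (\<forall>\<omega>\<in>space P. D \<omega> \<subseteq> H \<and> closed (D \<omega>)) \<and>
    (\<forall>x\<in>H. (\<lambda>\<omega>. set_dist x (D \<omega>)) \<in> borel_measurable P)"

definition tempered :: "'w measure \<Rightarrow> (real \<Rightarrow> 'w \<Rightarrow> 'w) \<Rightarrow> ('w \<Rightarrow> 'h::real_normed_vector set) \<Rightarrow> bool"
  where "tempered P \<theta> D \<longleftrightarrow> (AE \<omega> in P. \<forall>\<beta>>0.
    ((\<lambda>t. ennreal (exp (- \<beta> * t)) * (SUP x\<in>D (\<theta> (- t) \<omega>). ennreal (norm x))) \<longlongrightarrow> 0) at_top)"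

definition tempered_sets ::
    "'w measure \<Rightarrow> (real \<Rightarrow> 'w \<Rightarrow> 'w) \<Rightarrow> 'h::real_normed_vector set \<Rightarrow> ('w \<Rightarrow> 'h set) set"
  where "tempered_sets P \<theta> H = {D. random_set P H D \<and> tempered P \<theta> D}"

definition pullback_random_attractor ::
    "'w measure \<Rightarrow> (real \<Rightarrow> 'w \<Rightarrow> 'w) \<Rightarrow> 'h::real_normed_vector set \<Rightarrow> ('w \<Rightarrow> 'h set) set \<Rightarrow>
     (real \<Rightarrow> 'w \<Rightarrow> 'h \<Rightarrow> 'h) \<Rightarrow> ('w \<Rightarrow> 'h set) \<Rightarrow> bool"
  where "pullback_random_attractor P \<theta> H \<D> \<Psi> \<A> \<longleftrightarrow>
    random_set P H \<A> \<and> (\<forall>\<omega>\<in>space P. compact (\<A> \<omega>)) \<and>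
    (AE \<omega> in P. \<forall>t\<ge>0. \<Psi> t \<omega> ` \<A> \<omega> = \<A> (\<theta> t \<omega>)) \<and>
    (\<forall>D\<in>\<D>. AE \<omega> in P.
      ((\<lambda>t. semidist (\<Psi> t (\<theta> (- t) \<omega>) ` D (\<theta> (- t) \<omega>)) (\<A> \<omega>)) \<longlongrightarrow> 0) at_top)"

end

theory Submission
  imports Defs
begin

text \<open>
  On a path with noise segment \<open>N\<close>, the solution operator is \<open>C\<^sup>1\<close> because the mild solution solves a
  Volterra equation; its derivative along \<open>v\<close> is given by the linearised equation with coefficient
  \<open>Df(v\<^sub>t + N\<^sub>t)\<close>, and Gronwall bounds the error by the second order remainder of \<open>f\<close> along
  \<open>v\<^sub>t + N\<^sub>t\<close>. So \<open>\<alpha> = 1\<close> works, with a constant that depends on \<open>\<omega>\<close> only through the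
  largest radius on which \<open>D\<^sup>2f\<close> is bounded uniformly near the points \<open>v\<^sub>t + N\<^sub>t\<close>, \<open>t \<in> [0,1]\<close>
  (for increments longer than the radius, the Lipschitz bound on \<open>f\<close> suffices).

  For solutions in the attractor, \<open>v\<^sub>t + N\<^sub>t\<close> is the first component of a point of
  \<open>\<A>(\<theta>\<^sub>t \<omega>)\<close> by invariance. Compactness makes the infimum of the radius over all these points
  positive. The radius is a 1-Lipschitz function, so its infimum over \<open>\<A>(\<theta>\<^sub>t \<omega>)\<close> is an infimum of
  distances to \<open>\<A>(\<theta>\<^sub>t \<omega>)\<close> over a countable dense set, and rational \<open>t\<close> are enough. Hence the
  constant is measurable, and measurability of the solution operator in \<open>\<omega>\<close> is not needed.
\<close>

section \<open>The space \<open>L\<^sup>2\<close>\<close>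

text \<open>In infinite dimension a continuous second derivative may be unbounded on bounded sets,
  so a norm bound on the attractor yields no constant. Compactness gives a positive minimum of the
  radius for each path, but says nothing about measurability. The denominator of \<open>K\<close> is
  therefore a measurable quantity squeezed between two others: it is at least the minimum of the
  radius over all trajectories on [0,1] that start in the attractor, hence positive, and at most the
  radius at each rational time of each such trajectory. The two estimates use the two inclusions of
  the invariance identity. All other constants are deterministic, because the drift and its
  linearisation share one Lipschitz constant whatever the path. Histories form a subspace of an
  ambient type, and derivatives within this subspace are controlled only in its own directions;
  directions are therefore projected onto it before the linearised equation is solved.\<close>

lemma l2_fun_rep [simp]: "l2_fun (rep_L2 \<phi>)"
  using Quotient3_rep_reflp[OF Quotient3_L2] by (auto simp: l2_rel_def)

lemma abs_rep_L2 [simp]: "abs_L2 (rep_L2 \<phi>) = \<phi>"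
  by (rule Quotient3_abs_rep[OF Quotient3_L2])

lemma abs_L2_eqI: "l2_fun a \<Longrightarrow> l2_fun b \<Longrightarrow> AE s in lborel. a s = b s \<Longrightarrow> abs_L2 a = abs_L2 b"
  using Quotient3_rel_abs[OF Quotient3_L2] by (auto simp: l2_rel_def)

lemma rep_abs_L2: "l2_fun a \<Longrightarrow> AE s in lborel. rep_L2 (abs_L2 a) s = a s"
  using rep_abs_rsp_left[OF Quotient3_L2, of a a] by (auto simp: l2_rel_def)

lemma abs_L2_add: "l2_fun a \<Longrightarrow> l2_fun b \<Longrightarrow> abs_L2 a + abs_L2 b = abs_L2 (\<lambda>s. a s + b s)"
  by (rule plus_L2.abs_eq) (auto simp: l2_rel_def)

lemma abs_L2_diff: "l2_fun a \<Longrightarrow> l2_fun b \<Longrightarrow> abs_L2 a - abs_L2 b = abs_L2 (\<lambda>s. a s - b s)"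
  by (rule minus_L2.abs_eq) (auto simp: l2_rel_def)

lemma abs_L2_scaleR: "l2_fun a \<Longrightarrow> c *\<^sub>R abs_L2 a = abs_L2 (\<lambda>s. c *\<^sub>R a s)"
  by (rule scaleR_L2.abs_eq) (auto simp: l2_rel_def)

lemma zero_abs_L2: "0 = abs_L2 (\<lambda>_. 0)"
  by (rule zero_L2.abs_eq)

lemma norm_abs_L2: "l2_fun a \<Longrightarrow> norm (abs_L2 a) = sqrt (\<integral>s. (norm (a s))\<^sup>2 \<partial>lborel)"
  by (subst norm_eq_sqrt_inner, subst inner_L2.abs_eq)
     (auto simp: l2_rel_def power2_norm_eq_inner)

lemma norm_abs_L2_power2: "l2_fun a \<Longrightarrow> (norm (abs_L2 a))\<^sup>2 = (\<integral>s. (norm (a s))\<^sup>2 \<partial>lborel)"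
  by (simp add: norm_abs_L2)

lemma norm_abs_L2_mono:
  assumes "l2_fun a" "l2_fun b" "\<And>s. norm (a s) \<le> norm (b s)"
  shows "norm (abs_L2 a) \<le> norm (abs_L2 b)"
  using assms by (auto simp: norm_abs_L2 l2_fun_def intro!: integral_mono power_mono)

lemma l2_fun_if:
  assumes "l2_fun a" "A \<in> sets borel"
  shows "l2_fun (\<lambda>s. if s \<in> A then a s else 0)"
proof -
  have m: "a \<in> borel_measurable borel" and i: "integrable lborel (\<lambda>s. (norm (a s))\<^sup>2)"
    using assms by (auto simp: l2_fun_def)
  have [measurable]: "(\<lambda>s. if s \<in> A then a s else 0) \<in> borel_measurable borel"
    using m assms(2) by measurable
  show ?thesis
    unfolding l2_fun_def
    by (auto intro!: Bochner_Integration.integrable_bound[OF i])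
qed

section \<open>Density of indicators of open sets\<close>

lemma l2_fun_indicator:
  fixes c :: "'x::{real_inner,banach,second_countable_topology}"
  assumes "A \<in> sets borel" "emeasure lborel A < \<infinity>"
  shows "l2_fun (\<lambda>s. indicator A s *\<^sub>R c)"
proof -
  have eq: "(norm (indicator A s *\<^sub>R c))\<^sup>2 = indicator A s * (norm c)\<^sup>2" for s
    by (simp add: indicator_def)
  show ?thesis unfolding l2_fun_def eq using assms by auto
qed

lemma norm_indicator_L2:
  fixes c :: "'x::{real_inner,banach,second_countable_topology}"
  assumes "A \<in> sets borel" "emeasure lborel A < \<infinity>"
  shows "norm (abs_L2 (\<lambda>s. indicator A s *\<^sub>R c)) = sqrt (measure lborel A) * norm c"
proof -
  have eq: "(norm (indicator A s *\<^sub>R c))\<^sup>2 = indicator A s * (norm c)\<^sup>2" for s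
    by (simp add: indicator_def)
  show ?thesis
    unfolding norm_abs_L2[OF l2_fun_indicator[OF assms]] eq using assms by (simp add: real_sqrt_mult)
qed

text \<open>Simple functions dominated by a multiple of \<open>\<phi>\<close> converge to it in
  \<open>L\<^sup>2\<close>, and outer regularity replaces their level sets by open sets. Open sets
  are the useful class: a small translate of a point of \<open>U\<close> stays in \<open>U\<close>,
  and \<open>U\<close> is a countable union of basic sets.\<close>

lemma L2_density_induct:
  fixes Q :: "'x::{real_inner,banach,second_countable_topology} L2 set"
  assumes Q: "closed Q" and add: "\<And>x y. x \<in> Q \<Longrightarrow> y \<in> Q \<Longrightarrow> x + y \<in> Q"
    and ind: "\<And>U c. open U \<Longrightarrow> emeasure lborel U < \<infinity> \<Longrightarrow> abs_L2 (\<lambda>s. indicator U s *\<^sub>R c) \<in> Q"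
  shows "\<phi> \<in> Q"
proof -
  have zero: "0 \<in> Q"
    using ind[of "{}" 0] by (simp add: zero_abs_L2)
  have ind': "abs_L2 (\<lambda>s. indicator A s *\<^sub>R c) \<in> Q"
    if A: "A \<in> sets borel" "emeasure lborel A < \<infinity>" for A and c :: 'x
  proof -
    have "abs_L2 (\<lambda>s. indicator A s *\<^sub>R c) \<in> closure Q"
      unfolding closure_approachable
    proof (intro allI impI)
      fix e :: real assume e: "0 < e"
      \<comment> \<open>Makes \<open>sqrt d * norm c\<close> less than \<open>e\<close>; the added 1
        covers \<open>c = 0\<close>.\<close>
      define d where "d = (e / (norm c + 1))\<^sup>2"
      have d: "0 < d" using e by (simp add: d_def add_nonneg_eq_0_iff zero_less_power2)
      obtain U where U: "open U" "A \<subseteq> U" "emeasure lborel (U - A) < d"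
        using outer_regular_lborel[OF A(1) d] by blast
      have [measurable]: "U \<in> sets borel" "A \<in> sets borel" using U A by auto
      have "emeasure lborel U = emeasure lborel (A \<union> (U - A))"
        using U by (simp add: Un_absorb1)
      also have "\<dots> \<le> emeasure lborel A + emeasure lborel (U - A)"
        by (rule emeasure_subadditive) auto
      also have "\<dots> < \<infinity>" using A U by (auto simp: less_top[symmetric])
      finally have Uf: "emeasure lborel U < \<infinity>" .
      have UAf: "emeasure lborel (U - A) < \<infinity>"
        using U(3) by (auto simp: less_top[symmetric])
      have "abs_L2 (\<lambda>s. indicator U s *\<^sub>R c) - abs_L2 (\<lambda>s. indicator A s *\<^sub>R c)
          = abs_L2 (\<lambda>s. indicator U s *\<^sub>R c - indicator A s *\<^sub>R c)"
        using A Uf by (intro abs_L2_diff l2_fun_indicator) auto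
      also have "(\<lambda>s. indicator U s *\<^sub>R c - indicator A s *\<^sub>R c) = (\<lambda>s. indicator (U - A) s *\<^sub>R c)"
        using U(2) by (auto simp: fun_eq_iff indicator_def)
      finally have "dist (abs_L2 (\<lambda>s. indicator U s *\<^sub>R c)) (abs_L2 (\<lambda>s. indicator A s *\<^sub>R c))
          = sqrt (measure lborel (U - A)) * norm c"
        using norm_indicator_L2[of "U - A" c] UAf by (simp add: dist_norm)
      also have "\<dots> \<le> sqrt d * norm c"
      proof (intro mult_right_mono real_sqrt_le_mono)
        show "measure lborel (U - A) \<le> d"
          using U(3) UAf d by (simp add: emeasure_eq_ennreal_measure less_top ennreal_less_iff)
      qed auto
      also have "\<dots> = e * (norm c / (norm c + 1))"
        using e by (simp add: d_def abs_of_nonneg)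
      also have "\<dots> < e * 1"
        using e by (intro mult_strict_left_mono) (simp_all add: divide_less_eq add_nonneg_pos)
      finally show "\<exists>y\<in>Q. dist y (abs_L2 (\<lambda>s. indicator A s *\<^sub>R c)) < e"
        using ind[OF U(1) Uf, of c] by auto
    qed
    with Q show ?thesis by simp
  qed
  define a where "a = rep_L2 \<phi>"
  have l2a: "l2_fun a" by (simp add: a_def)
  then have a[measurable]: "a \<in> borel_measurable lborel"
    and ia: "integrable lborel (\<lambda>s. (norm (a s))\<^sup>2)" by (auto simp: l2_fun_def)
  from borel_measurable_implies_sequence_metric[OF a, of 0]
  obtain F where F: "\<And>i. simple_function lborel (F i)" "\<And>x. (\<lambda>i. F i x) \<longlonglongrightarrow> a x"
    "\<And>i x. norm (F i x) \<le> 2 * norm (a x)" by auto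
  have Fm[measurable]: "F i \<in> borel_measurable lborel" for i
    using F(1) by (rule borel_measurable_simple_function)
  \<comment> \<open>The factor 9 also serves the differences \<open>F i s - a s\<close>, whose norm
    is at most \<open>(2 + 1) * norm (a s)\<close>.\<close>
  have i4: "integrable lborel (\<lambda>s. 9 * (norm (a s))\<^sup>2)" using ia by simp
  have bd: "(norm (F i s))\<^sup>2 \<le> 9 * (norm (a s))\<^sup>2" for i s
  proof -
    have "(norm (F i s))\<^sup>2 \<le> 4 * (norm (a s))\<^sup>2"
      using power_mono[OF F(3)[of i s], of 2] by (simp add: power_mult_distrib)
    also have "\<dots> \<le> 9 * (norm (a s))\<^sup>2" by (intro mult_right_mono) auto
    finally show ?thesis .
  qed
  have l2F: "l2_fun (F i)" for i
    unfolding l2_fun_def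
    by (auto intro!: Bochner_Integration.integrable_bound[OF i4] bd)
  have FQ: "abs_L2 (F i) \<in> Q" for i
  proof -
    let ?R = "F i ` UNIV"
    have fin: "finite ?R" using simple_functionD(1)[OF F(1), of i] by simp
    define T where "T y = (\<lambda>s. indicator (F i -` {y}) s *\<^sub>R y)" for y
    \<comment> \<open>The value 0 is separated because its level set may have infinite measure; the
      other level sets have finite measure since \<open>F i\<close> is square integrable.\<close>
    have T: "l2_fun (T y) \<and> abs_L2 (T y) \<in> Q" for y
    proof (cases "y = 0")
      case True then show ?thesis by (simp add: T_def zero zero_abs_L2[symmetric])
    next
      case False
      have ms: "F i -` {y} \<in> sets borel" using measurable_sets[OF Fm, of "{y}" i] by simp
      have le: "norm ((norm y)\<^sup>2 * indicator (F i -` {y}) s :: real) \<le> norm ((norm (F i s))\<^sup>2)" for s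
        by (simp add: indicator_def)
      have "integrable lborel (\<lambda>s. (norm y)\<^sup>2 * indicator (F i -` {y}) s :: real)"
      proof (rule Bochner_Integration.integrable_bound)
        show "integrable lborel (\<lambda>s. (norm (F i s))\<^sup>2)" using l2F by (simp add: l2_fun_def)
        show "(\<lambda>s. (norm y)\<^sup>2 * indicator (F i -` {y}) s :: real) \<in> borel_measurable lborel"
          using ms by simp
      qed (rule AE_I2[OF le])
      then have "integrable lborel (indicator (F i -` {y}) :: real \<Rightarrow> real)"
        using False by simp
      then have "emeasure lborel (F i -` {y}) < \<infinity>"
        by (simp add: integrable_indicator_iff)
      then show ?thesis
        unfolding T_def using ms ind' l2_fun_indicator by blast
    qed
    have "l2_fun (\<lambda>s. \<Sum>y\<in>R. T y s) \<and> abs_L2 (\<lambda>s. \<Sum>y\<in>R. T y s) \<in> Q" if "finite R" for R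
      using that
    proof induction
      case empty
      then show ?case by (simp add: zero zero_abs_L2[symmetric])
    next
      case (insert y R)
      then show ?case using T[of y] add by (auto simp: l2_fun_add abs_L2_add[symmetric])
    qed
    moreover have "(\<lambda>s. \<Sum>y\<in>?R. T y s) = F i"
    proof
      fix s
      have "(\<Sum>y\<in>?R. T y s) = (\<Sum>y\<in>?R. if y = F i s then y else 0)"
        by (rule sum.cong) (auto simp: T_def indicator_def)
      also have "\<dots> = F i s" using fin by simp
      finally show "(\<Sum>y\<in>?R. T y s) = F i s" .
    qed
    ultimately show ?thesis using fin by metis
  qed
  have "(\<lambda>i. \<integral>s. (norm (F i s - a s))\<^sup>2 \<partial>lborel) \<longlonglongrightarrow> (\<integral>s. 0 \<partial>(lborel :: real measure))"
  proof (rule integral_dominated_convergence[where w = "\<lambda>s. 9 * (norm (a s))\<^sup>2"])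
    show "AE s in lborel. (\<lambda>i. (norm (F i s - a s))\<^sup>2) \<longlonglongrightarrow> 0"
    proof (rule AE_I2)
      fix s
      have "(\<lambda>i. (norm (F i s - a s))\<^sup>2) \<longlonglongrightarrow> (norm (a s - a s))\<^sup>2"
        by (intro tendsto_intros F(2))
      then show "(\<lambda>i. (norm (F i s - a s))\<^sup>2) \<longlonglongrightarrow> 0" by simp
    qed
    show "AE s in lborel. norm ((norm (F i s - a s))\<^sup>2) \<le> 9 * (norm (a s))\<^sup>2" for i
    proof (rule AE_I2)
      fix s
      have "norm (F i s - a s) \<le> 3 * norm (a s)"
        using norm_triangle_ineq4[of "F i s" "a s"] F(3)[of i s] by linarith
      from power_mono[OF this, of 2] show "norm ((norm (F i s - a s))\<^sup>2) \<le> 9 * (norm (a s))\<^sup>2"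
        by (simp add: power_mult_distrib)
    qed
  qed (use i4 in auto)
  then have "(\<lambda>i. (norm (abs_L2 (F i) - abs_L2 a))\<^sup>2) \<longlonglongrightarrow> 0"
    by (simp add: abs_L2_diff l2F l2a norm_abs_L2_power2 l2_fun_diff)
  then have "(\<lambda>i. sqrt ((norm (abs_L2 (F i) - abs_L2 a))\<^sup>2)) \<longlonglongrightarrow> sqrt 0"
    by (rule tendsto_real_sqrt)
  then have "(\<lambda>i. norm (abs_L2 (F i) - abs_L2 a)) \<longlonglongrightarrow> 0" by simp
  then have "(\<lambda>i. abs_L2 (F i)) \<longlonglongrightarrow> abs_L2 a"
    by (subst tendsto_dist_iff) (simp add: dist_norm)
  with Q FQ have "abs_L2 a \<in> Q"
    by (rule closed_sequentially)
  then show ?thesis by (simp add: a_def)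
qed

section \<open>Translations as a strongly continuous group of isometries\<close>

lemma l2_fun_translate:
  assumes "l2_fun a"
  shows "l2_fun (\<lambda>s. a (t + s))"
proof -
  have m[measurable]: "a \<in> borel_measurable borel" and i: "integrable lborel (\<lambda>s. (norm (a s))\<^sup>2)"
    using assms by (auto simp: l2_fun_def)
  have "integrable lborel (\<lambda>s. (norm (a (t + s)))\<^sup>2)"
    using lborel_integrable_real_affine[OF i, of 1 t] by simp
  then show ?thesis by (simp add: l2_fun_def)
qed

lemma AE_lborel_translate:
  assumes "AE s in lborel. (a :: real \<Rightarrow> 'x::{real_inner,banach,second_countable_topology}) s = b s"
    and "l2_fun a" "l2_fun b"
  shows "AE s in lborel. a (t + s) = b (t + s)"
proof -
  have [measurable]: "a \<in> borel_measurable borel" "b \<in> borel_measurable borel"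
    using assms by (auto simp: l2_fun_def)
  have "AE s in lborel. a (t + 1 * s) = b (t + 1 * s)"
    using assms(1) by (intro AE_borel_affine) auto
  then show ?thesis by simp
qed

text \<open>On the whole line translations are isometries, whereas shifting within
  \<open>[-\<tau>,0]\<close> alone would lose mass at the ends. Continuity of
  \<open>t \<mapsto> v_t\<close> thus reduces to strong continuity of this group.\<close>

definition translate :: "real \<Rightarrow> 'x::{real_inner,banach,second_countable_topology} L2 \<Rightarrow> 'x L2"
  where "translate t \<phi> = abs_L2 (\<lambda>s. rep_L2 \<phi> (t + s))"

lemma translate_abs:
  assumes "l2_fun a"
  shows "translate t (abs_L2 a) = abs_L2 (\<lambda>s. a (t + s))"
  unfolding translate_def using assms
  by (intro abs_L2_eqI l2_fun_translate AE_lborel_translate rep_abs_L2) auto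

lemma norm_translate [simp]: "norm (translate t \<phi>) = norm \<phi>"
proof -
  have "norm \<phi> = norm (abs_L2 (rep_L2 \<phi>))" by simp
  also have "\<dots> = norm (translate t \<phi>)"
    unfolding translate_def
    using lborel_integral_real_affine[of 1 "\<lambda>s. (norm (rep_L2 \<phi> s))\<^sup>2" t]
    by (simp add: norm_abs_L2 l2_fun_translate del: abs_rep_L2)
  finally show ?thesis by simp
qed

lemma translate_diff: "translate t (\<phi> - \<psi>) = translate t \<phi> - translate t \<psi>"
proof -
  have "\<phi> - \<psi> = abs_L2 (\<lambda>s. rep_L2 \<phi> s - rep_L2 \<psi> s)"
    using abs_L2_diff[of "rep_L2 \<phi>" "rep_L2 \<psi>"] by simp
  then have "translate t (\<phi> - \<psi>) = abs_L2 (\<lambda>s. rep_L2 \<phi> (t + s) - rep_L2 \<psi> (t + s))"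
    by (simp add: translate_abs l2_fun_diff)
  then show ?thesis
    by (simp add: translate_def[of t \<phi>] translate_def[of t \<psi>] abs_L2_diff l2_fun_translate)
qed

lemma translate_add: "translate t (\<phi> + \<psi>) = translate t \<phi> + translate t \<psi>"
  using translate_diff[of t "\<phi> + \<psi>" \<psi>] by (simp add: algebra_simps)

lemma translate_translate: "translate s (translate t \<phi>) = translate (t + s) \<phi>"
  unfolding translate_def[of t] translate_def[of "t + s"]
  by (simp add: translate_abs l2_fun_translate add.assoc)

text \<open>Translations are isometries, so the classes on which they are continuous at 0 form a
  closed set; density leaves only indicators of open sets.\<close>

lemma translate_tendsto_0: "((\<lambda>t. translate t \<phi>) \<longlongrightarrow> \<phi>) (at 0)"
proof -
  let ?Q = "{\<phi> :: 'a L2. ((\<lambda>t. translate t \<phi>) \<longlongrightarrow> \<phi>) (at 0)}"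
  have "\<phi> \<in> ?Q"
  proof (rule L2_density_induct[of ?Q])
    have "closure ?Q \<subseteq> ?Q"
    proof
      fix \<phi> :: "'a L2" assume cl: "\<phi> \<in> closure ?Q"
      have "((\<lambda>t. translate t \<phi>) \<longlongrightarrow> \<phi>) (at 0)"
      proof (rule tendstoI)
        fix e :: real assume "0 < e"
        then obtain \<psi> where \<psi>: "\<psi> \<in> ?Q" "dist \<psi> \<phi> < e / 3"
          using cl unfolding closure_approachable by (metis zero_less_divide_iff zero_less_numeral)
        from \<psi> \<open>0 < e\<close> have "\<forall>\<^sub>F t in at 0. dist (translate t \<psi>) \<psi> < e / 3"
          by (intro tendstoD) auto
        then show "\<forall>\<^sub>F t in at 0. dist (translate t \<phi>) \<phi> < e"
        proof eventually_elim
          case (elim t)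
          have "dist (translate t \<phi>) (translate t \<psi>) = dist \<phi> \<psi>"
            by (simp add: dist_norm translate_diff[symmetric])
          then show ?case
            using elim \<psi>(2) dist_triangle[of "translate t \<phi>" \<phi> "translate t \<psi>"]
              dist_triangle[of "translate t \<psi>" \<phi> \<psi>] by (simp add: dist_commute)
        qed
      qed
      then show "\<phi> \<in> ?Q" by simp
    qed
    then show "closed ?Q" using closure_subset_eq by blast
    show "x + y \<in> ?Q" if "x \<in> ?Q" "y \<in> ?Q" for x y
      using that by (auto simp: translate_add intro!: tendsto_add)
    fix U :: "real set" and c :: 'a assume U: "open U" "emeasure lborel U < \<infinity>"
    define a where "a = (\<lambda>s. indicator U s *\<^sub>R c)"
    have a: "l2_fun a" unfolding a_def using U by (intro l2_fun_indicator) auto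
    have [measurable]: "U \<in> sets borel" using U by simp
    \<comment> \<open>Norms are preserved, so convergence follows from convergence of the inner products; for an
      open set the indicators converge pointwise on the set itself.\<close>
    have inn: "((\<lambda>t. translate t (abs_L2 a) \<bullet> abs_L2 a) \<longlongrightarrow> abs_L2 a \<bullet> abs_L2 a) (at 0)"
      unfolding tendsto_at_iff_sequentially
    proof (intro allI impI)
      fix X :: "nat \<Rightarrow> real" assume X: "X \<longlonglongrightarrow> 0"
      have "(\<lambda>n. \<integral>s. a (X n + s) \<bullet> a s \<partial>lborel) \<longlonglongrightarrow> (\<integral>s. a s \<bullet> a s \<partial>lborel)"
      proof (rule integral_dominated_convergence[where w = "\<lambda>s. a s \<bullet> a s"])
        have [measurable]: "a \<in> borel_measurable borel" using a by (simp add: l2_fun_def)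
        show "(\<lambda>s. a s \<bullet> a s) \<in> borel_measurable lborel"
          "\<And>n. (\<lambda>s. a (X n + s) \<bullet> a s) \<in> borel_measurable lborel" by simp_all
        show "integrable lborel (\<lambda>s. a s \<bullet> a s)" using a by (intro l2_fun_inner_integrable)
        show "AE s in lborel. (\<lambda>n. a (X n + s) \<bullet> a s) \<longlonglongrightarrow> a s \<bullet> a s"
        proof (rule AE_I2)
          fix s
          show "(\<lambda>n. a (X n + s) \<bullet> a s) \<longlonglongrightarrow> a s \<bullet> a s"
          proof (cases "s \<in> U")
            case True
            have "(\<lambda>n. X n + s) \<longlonglongrightarrow> 0 + s" by (intro tendsto_intros X)
            then have "\<forall>\<^sub>F n in sequentially. X n + s \<in> U"
              using U(1) True by (intro topological_tendstoD) auto
            then have "\<forall>\<^sub>F n in sequentially. a (X n + s) \<bullet> a s = a s \<bullet> a s"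
              by eventually_elim (simp add: a_def True)
            then show ?thesis by (rule tendsto_eventually)
          qed (simp add: a_def)
        qed
        \<comment> \<open>\<open>a\<close> takes only the values 0 and \<open>c\<close>, so
          \<open>a s \<bullet> a s\<close> dominates whatever the shift.\<close>
        show "AE s in lborel. norm (a (X n + s) \<bullet> a s) \<le> a s \<bullet> a s" for n
          by (rule AE_I2) (simp add: a_def indicator_def)
      qed
      then show "((\<lambda>t. translate t (abs_L2 a) \<bullet> abs_L2 a) \<circ> X) \<longlonglongrightarrow> abs_L2 a \<bullet> abs_L2 a"
        using a by (simp add: translate_abs inner_L2.abs_eq l2_rel_def l2_fun_translate o_def)
    qed
    let ?\<phi> = "abs_L2 a"
    have "((\<lambda>t. 2 * (?\<phi> \<bullet> ?\<phi>) - 2 * (translate t ?\<phi> \<bullet> ?\<phi>)) \<longlongrightarrow> 2 * (?\<phi> \<bullet> ?\<phi>) - 2 * (?\<phi> \<bullet> ?\<phi>)) (at 0)"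
      by (intro tendsto_intros inn)
    moreover have "2 * (?\<phi> \<bullet> ?\<phi>) - 2 * (translate t ?\<phi> \<bullet> ?\<phi>) = (norm (translate t ?\<phi> - ?\<phi>))\<^sup>2" for t
    proof -
      have "(norm (translate t ?\<phi> - ?\<phi>))\<^sup>2
          = (norm (translate t ?\<phi>))\<^sup>2 - 2 * (translate t ?\<phi> \<bullet> ?\<phi>) + (norm ?\<phi>)\<^sup>2"
        unfolding power2_norm_eq_inner by (simp add: inner_diff inner_commute)
      then show ?thesis by (simp add: power2_norm_eq_inner)
    qed
    ultimately have "((\<lambda>t. (norm (translate t ?\<phi> - ?\<phi>))\<^sup>2) \<longlongrightarrow> 0) (at 0)" by simp
    from tendsto_real_sqrt[OF this] have "((\<lambda>t. norm (translate t ?\<phi> - ?\<phi>)) \<longlongrightarrow> 0) (at 0)" by simp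
    then have "((\<lambda>t. translate t ?\<phi>) \<longlongrightarrow> ?\<phi>) (at 0)"
      by (subst tendsto_dist_iff) (simp add: dist_norm)
    then show "abs_L2 (\<lambda>s. indicator U s *\<^sub>R c) \<in> ?Q" by (simp add: a_def)
  qed
  then show ?thesis by simp
qed

lemma translate_0 [simp]: "translate 0 \<phi> = \<phi>"
  by (simp add: translate_def)

lemma continuous_translate: "continuous_on UNIV (\<lambda>t. translate t \<phi>)"
  unfolding continuous_on_def
proof
  fix t :: real
  have "((\<lambda>h. dist (translate (t + h) \<phi>) (translate t \<phi>)) \<longlongrightarrow> 0) (at 0)"
  proof -
    have "dist (translate (t + h) \<phi>) (translate t \<phi>) = dist (translate h \<phi>) \<phi>" for h
    proof -
      have "translate (t + h) \<phi> - translate t \<phi> = translate t (translate h \<phi> - \<phi>)"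
        by (simp add: translate_diff translate_translate add.commute)
      then show ?thesis by (simp add: dist_norm)
    qed
    then show ?thesis
      using translate_tendsto_0[of \<phi>] by (subst (asm) tendsto_dist_iff) simp
  qed
  then have "((\<lambda>h. translate (t + h) \<phi>) \<longlongrightarrow> translate t \<phi>) (at 0)"
    by (subst tendsto_dist_iff)
  then show "((\<lambda>t. translate t \<phi>) \<longlongrightarrow> translate t \<phi>) (at t within UNIV)"
    using LIM_offset_zero_cancel[of "\<lambda>t. translate t \<phi>" t] by simp
qed

text \<open>The countable set consists of finite sums of indicators of finite unions of basic open
  sets, with coefficients from a countable dense set. It serves to write an infimum over a fibre of
  the attractor as a countable one.\<close>

lemma L2_separable:
  "\<exists>C :: 'x::{real_inner,banach,second_countable_topology} L2 set. countable C \<and> closure C = UNIV"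
proof -
  obtain D :: "'x set" where D: "countable D" "\<And>x e. 0 < e \<Longrightarrow> \<exists>d\<in>D. dist d x < e"
  proof -
    obtain D :: "'x set" where "countable D" and D: "\<And>X. open X \<Longrightarrow> X \<noteq> {} \<Longrightarrow> \<exists>d\<in>D. d \<in> X"
      by (erule countable_dense_setE)
    show ?thesis
    proof (rule that[OF \<open>countable D\<close>])
      fix x :: 'x and e :: real assume "0 < e"
      with D[of "ball x e"] obtain d where "d \<in> D" "d \<in> ball x e" by auto
      then show "\<exists>d\<in>D. dist d x < e" by (auto simp: dist_commute)
    qed
  qed
  obtain B :: "real set set" where B: "countable B" "topological_basis B"
    using ex_countable_basis by auto
  define W where "W = {F. finite F \<and> F \<subseteq> B}"
  have W: "countable W" unfolding W_def using B(1) by (intro countable_Collect_finite_subset)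
  define C0 :: "'x L2 set" where "C0 = (\<lambda>(F, d). abs_L2 (\<lambda>s. indicator (\<Union>F) s *\<^sub>R d)) ` (W \<times> D)"
  define C where "C = sum_list ` lists C0"
  have "countable C" unfolding C_def C0_def using W D by (intro countable_image countable_lists countable_SIGMA)
  moreover have "\<phi> \<in> closure C" for \<phi>
  proof (rule L2_density_induct)
    have C_add: "x + y \<in> C" if "x \<in> C" "y \<in> C" for x y
    proof -
      from that obtain xs ys where "xs \<in> lists C0" "x = sum_list xs" "ys \<in> lists C0" "y = sum_list ys"
        by (auto simp: C_def)
      then have "x + y = sum_list (xs @ ys)" "xs @ ys \<in> lists C0" by auto
      then show ?thesis unfolding C_def by blast
    qed
    show "x + y \<in> closure C" if xy: "x \<in> closure C" "y \<in> closure C" for x y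
    proof -
      from xy(1) obtain f where f: "\<forall>n. f n \<in> C" "f \<longlonglongrightarrow> x"
        unfolding closure_sequential by blast
      from xy(2) obtain g where g: "\<forall>n. g n \<in> C" "g \<longlonglongrightarrow> y"
        unfolding closure_sequential by blast
      have "\<forall>n. f n + g n \<in> C" "(\<lambda>n. f n + g n) \<longlonglongrightarrow> x + y"
        using f g C_add by (auto intro: tendsto_add)
      then show ?thesis unfolding closure_sequential by (intro exI[of _ "\<lambda>n. f n + g n"]) simp
    qed
    fix U :: "real set" and c :: 'x assume U: "open U" "emeasure lborel U < \<infinity>"
    have Um[measurable]: "U \<in> sets borel" using U by simp
    show "abs_L2 (\<lambda>s. indicator U s *\<^sub>R c) \<in> closure C"
      unfolding closure_approachable
    proof (intro allI impI)
      fix e :: real assume e: "0 < e"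
      \<comment> \<open>One half of \<open>e\<close> is spent on replacing \<open>c\<close> by
        \<open>d\<close>, the other on replacing \<open>U\<close> by a finite union of basic sets.
        Using \<open>m + 1\<close> instead of \<open>m\<close> includes null sets
        \<open>U\<close>.\<close>
      define m where "m = sqrt (measure lborel U)"
      have m0: "0 \<le> m" by (simp add: m_def)
      obtain d where d: "d \<in> D" "dist d c < e / 2 / (m + 1)"
        using D(2)[of "e / 2 / (m + 1)" c] e m0 by auto
      obtain B' where B': "B' \<subseteq> B" "\<Union>B' = U" using B(2) U(1) by (auto simp: topological_basis_def)
      have cB': "countable B'" using B' B(1) countable_subset by blast
      \<comment> \<open>Finite unions along an enumeration of \<open>B'\<close>. They increase to
        \<open>U\<close>, and the measures converge because that of \<open>U\<close> is
        finite.\<close>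
      define V where "V n = \<Union>{b \<in> B'. to_nat_on B' b < n}" for n
      have finV: "finite {b \<in> B'. to_nat_on B' b < n}" for n
      proof (rule inj_on_finite)
        show "inj_on (to_nat_on B') {b \<in> B'. to_nat_on B' b < n}"
          using inj_on_to_nat_on[OF cB'] by (rule inj_on_subset) auto
        show "to_nat_on B' ` {b \<in> B'. to_nat_on B' b < n} \<subseteq> {..<n}" by auto
      qed simp
      have VW: "{b \<in> B'. to_nat_on B' b < n} \<in> W" for n using finV B'(1) by (auto simp: W_def)
      have Vo: "open (V n)" for n
        unfolding V_def
      proof (intro open_Union ballI)
        fix S assume "S \<in> {b \<in> B'. to_nat_on B' b < n}"
        with B'(1) have "S \<in> B" by auto
        with B(2) show "open S" by (rule topological_basis_open)
      qed
      then have Vm[measurable]: "V n \<in> sets borel" for n by simp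
      have VU: "V n \<subseteq> U" for n using B' by (auto simp: V_def)
      have UV: "(\<Union>n. V n) = U"
      proof
        show "U \<subseteq> (\<Union>n. V n)"
        proof
          fix x assume "x \<in> U"
          then obtain b where "b \<in> B'" "x \<in> b" using B'(2) by blast
          then have "x \<in> V (Suc (to_nat_on B' b))" unfolding V_def by blast
          then show "x \<in> (\<Union>n. V n)" by blast
        qed
      qed (use VU in blast)
      have "(\<lambda>n. measure lborel (V n)) \<longlonglongrightarrow> measure lborel (\<Union>n. V n)"
      proof (rule Lim_measure_incseq)
        show "incseq V" by (auto simp: incseq_def V_def intro: less_le_trans)
      qed (use UV U in auto)
      then have lim: "(\<lambda>n. sqrt (measure lborel U - measure lborel (V n)) * norm d)
          \<longlonglongrightarrow> sqrt (measure lborel U - measure lborel U) * norm d"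
        unfolding UV by (intro tendsto_intros)
      have "0 < e / 2" using e by simp
      from order_tendstoD(2)[OF lim, of "e / 2"] this obtain n
        where n: "sqrt (measure lborel U - measure lborel (V n)) * norm d < e / 2"
        by (auto simp: eventually_sequentially)
      have Vf: "emeasure lborel (V n) < \<infinity>"
        using emeasure_mono[OF VU, of lborel n] U(2) by (simp add: order_le_less_trans)
      have UVf: "emeasure lborel (U - V n) < \<infinity>"
        using emeasure_mono[of "U - V n" U lborel] U(2) by (simp add: order_le_less_trans)
      let ?i = "\<lambda>A c. abs_L2 (\<lambda>s. indicator A s *\<^sub>R c) :: 'x L2"
      have "dist (?i (V n) d) (?i U c) \<le> dist (?i (V n) d) (?i U d) + dist (?i U d) (?i U c)"
        by (rule dist_triangle)
      also have "dist (?i (V n) d) (?i U d) = norm (?i (U - V n) d)"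
      proof -
        have "?i U d - ?i (V n) d = abs_L2 (\<lambda>s. indicator U s *\<^sub>R d - indicator (V n) s *\<^sub>R d)"
          using Vf U by (intro abs_L2_diff l2_fun_indicator) auto
        also have "(\<lambda>s. indicator U s *\<^sub>R d - indicator (V n) s *\<^sub>R d) = (\<lambda>s. indicator (U - V n) s *\<^sub>R d)"
          using VU[of n] by (auto simp: fun_eq_iff indicator_def)
        finally show ?thesis by (metis dist_commute dist_norm)
      qed
      also have "\<dots> = sqrt (measure lborel (U - V n)) * norm d"
        using UVf by (intro norm_indicator_L2) auto
      also have "measure lborel (U - V n) = measure lborel U - measure lborel (V n)"
        using U VU by (intro measure_Diff) auto
      also have "dist (?i U d) (?i U c) = norm (?i U (d - c))"
      proof -
        have "?i U d - ?i U c = abs_L2 (\<lambda>s. indicator U s *\<^sub>R d - indicator U s *\<^sub>R c)"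
          using U by (intro abs_L2_diff l2_fun_indicator) auto
        then show ?thesis by (simp add: dist_norm scaleR_diff_right)
      qed
      also have "\<dots> = m * dist d c"
        using U by (simp add: norm_indicator_L2 m_def dist_norm)
      also have "\<dots> \<le> m * (e / 2 / (m + 1))"
        using d(2) m0 by (intro mult_left_mono) auto
      also have "\<dots> \<le> e / 2" using m0 e by (simp add: field_simps)
      also note n
      finally have "dist (?i (V n) d) (?i U c) < e" by simp
      moreover have "?i (V n) d \<in> C"
      proof -
        have "?i (V n) d \<in> C0" unfolding C0_def V_def using VW d(1) by force
        then have "sum_list [?i (V n) d] \<in> C" unfolding C_def by (intro imageI) auto
        then show ?thesis by simp
      qed
      ultimately show "\<exists>y\<in>C. dist y (?i U c) < e" by blast
    qed
  qed simp
  ultimately show ?thesis by blast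
qed

section \<open>History segments\<close>

lemma rep_L2_add: "AE s in lborel. rep_L2 (\<phi> + \<psi>) s = rep_L2 \<phi> s + rep_L2 \<psi> s"
proof -
  have "\<phi> + \<psi> = abs_L2 (\<lambda>s. rep_L2 \<phi> s + rep_L2 \<psi> s)"
    using abs_L2_add[of "rep_L2 \<phi>" "rep_L2 \<psi>"] by simp
  then show ?thesis using rep_abs_L2[OF l2_fun_add[of "rep_L2 \<phi>" "rep_L2 \<psi>"]] by simp
qed

lemma rep_L2_scaleR: "AE s in lborel. rep_L2 (c *\<^sub>R \<phi>) s = c *\<^sub>R rep_L2 \<phi> s"
proof -
  have "c *\<^sub>R \<phi> = abs_L2 (\<lambda>s. c *\<^sub>R rep_L2 \<phi> s)"
    using abs_L2_scaleR[of "rep_L2 \<phi>" c] by simp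
  then show ?thesis using rep_abs_L2[OF l2_fun_scaleR[of "rep_L2 \<phi>" c]] by simp
qed

text \<open>The orthogonal projection onto \<open>hist_space \<tau>\<close>. Its fixed points are
  the histories, which yields the subspace properties, and composition with it extends maps to the
  ambient type.\<close>

definition cut_hist :: "real \<Rightarrow> 'x::{real_inner,banach,second_countable_topology} L2 \<Rightarrow> 'x L2"
  where "cut_hist \<tau> \<phi> = abs_L2 (\<lambda>s. if s \<in> {-\<tau>..0} then rep_L2 \<phi> s else 0)"

lemma cut_hist_abs:
  assumes "l2_fun a"
  shows "cut_hist \<tau> (abs_L2 a) = abs_L2 (\<lambda>s. if s \<in> {-\<tau>..0} then a s else 0)"
proof -
  have "AE s in lborel. (if s \<in> {-\<tau>..0} then rep_L2 (abs_L2 a) s else 0) = (if s \<in> {-\<tau>..0} then a s else 0)"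
    using rep_abs_L2[OF assms] by eventually_elim simp
  then show ?thesis
    unfolding cut_hist_def by (intro abs_L2_eqI l2_fun_if assms l2_fun_rep) auto
qed

lemma abs_L2_in_hist_space:
  assumes "l2_fun a" "\<And>s. s \<notin> {-\<tau>..0} \<Longrightarrow> a s = 0"
  shows "abs_L2 a \<in> hist_space \<tau>"
  unfolding hist_space_def mem_Collect_eq
  using rep_abs_L2[OF assms(1)] by eventually_elim (use assms(2) in auto)

lemma cut_hist_in [simp]: "cut_hist \<tau> \<phi> \<in> hist_space \<tau>"
  unfolding cut_hist_def by (intro abs_L2_in_hist_space l2_fun_if l2_fun_rep) auto

lemma cut_hist_id: "\<phi> \<in> hist_space \<tau> \<Longrightarrow> cut_hist \<tau> \<phi> = \<phi>"
proof -
  assume "\<phi> \<in> hist_space \<tau>"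
  then have "AE s in lborel. s \<notin> {-\<tau>..0} \<longrightarrow> rep_L2 \<phi> s = 0" by (simp add: hist_space_def)
  then have "AE s in lborel. (if s \<in> {-\<tau>..0} then rep_L2 \<phi> s else 0) = rep_L2 \<phi> s"
    by eventually_elim auto
  then have "cut_hist \<tau> \<phi> = abs_L2 (rep_L2 \<phi>)"
    unfolding cut_hist_def by (intro abs_L2_eqI l2_fun_if l2_fun_rep) auto
  then show ?thesis by simp
qed

lemma norm_cut_hist_le: "norm (cut_hist \<tau> \<phi>) \<le> norm \<phi>"
proof -
  have "norm (cut_hist \<tau> \<phi>) \<le> norm (abs_L2 (rep_L2 \<phi>))"
    unfolding cut_hist_def by (intro norm_abs_L2_mono l2_fun_if l2_fun_rep) auto
  then show ?thesis by simp
qed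

lemma cut_hist_add: "cut_hist \<tau> (\<phi> + \<psi>) = cut_hist \<tau> \<phi> + cut_hist \<tau> \<psi>"
proof -
  have "cut_hist \<tau> \<phi> + cut_hist \<tau> \<psi> = abs_L2 (\<lambda>s. (if s \<in> {-\<tau>..0} then rep_L2 \<phi> s else 0)
      + (if s \<in> {-\<tau>..0} then rep_L2 \<psi> s else 0))"
    unfolding cut_hist_def by (intro abs_L2_add l2_fun_if l2_fun_rep) auto
  also have "\<dots> = cut_hist \<tau> (\<phi> + \<psi>)"
    unfolding cut_hist_def
  proof (intro abs_L2_eqI l2_fun_add l2_fun_if l2_fun_rep)
    show "AE s in lborel. (if s \<in> {-\<tau>..0} then rep_L2 \<phi> s else 0)
      + (if s \<in> {-\<tau>..0} then rep_L2 \<psi> s else 0) = (if s \<in> {-\<tau>..0} then rep_L2 (\<phi> + \<psi>) s else 0)"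
      using rep_L2_add[of \<phi> \<psi>] by eventually_elim auto
  qed auto
  finally show ?thesis by simp
qed

lemma cut_hist_scaleR: "cut_hist \<tau> (c *\<^sub>R \<phi>) = c *\<^sub>R cut_hist \<tau> \<phi>"
proof -
  have "c *\<^sub>R cut_hist \<tau> \<phi> = abs_L2 (\<lambda>s. c *\<^sub>R (if s \<in> {-\<tau>..0} then rep_L2 \<phi> s else 0))"
    unfolding cut_hist_def by (intro abs_L2_scaleR l2_fun_if l2_fun_rep) auto
  also have "\<dots> = cut_hist \<tau> (c *\<^sub>R \<phi>)"
    unfolding cut_hist_def
  proof (intro abs_L2_eqI l2_fun_scaleR l2_fun_if l2_fun_rep)
    show "AE s in lborel. c *\<^sub>R (if s \<in> {-\<tau>..0} then rep_L2 \<phi> s else 0)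
      = (if s \<in> {-\<tau>..0} then rep_L2 (c *\<^sub>R \<phi>) s else 0)"
      using rep_L2_scaleR[of c \<phi>] by eventually_elim auto
  qed auto
  finally show ?thesis by simp
qed

lemma bounded_linear_cut_hist: "bounded_linear (cut_hist \<tau>)"
  by (rule bounded_linear_intro[where K = 1])
     (simp_all add: cut_hist_add cut_hist_scaleR norm_cut_hist_le)

lemma subspace_hist_space: "subspace (hist_space \<tau> :: 'x::{real_inner,banach,second_countable_topology} L2 set)"
proof (rule subspaceI)
  fix \<phi> \<psi> :: "'x L2" and c :: real
  assume "\<phi> \<in> hist_space \<tau>"
  then have \<phi>: "cut_hist \<tau> \<phi> = \<phi>" by (rule cut_hist_id)
  then show "c *\<^sub>R \<phi> \<in> hist_space \<tau>"
    by (metis cut_hist_in cut_hist_scaleR)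
  assume "\<psi> \<in> hist_space \<tau>"
  then have "cut_hist \<tau> \<psi> = \<psi>" by (rule cut_hist_id)
  with \<phi> show "\<phi> + \<psi> \<in> hist_space \<tau>"
    by (metis cut_hist_in cut_hist_add)
next
  show "(0 :: 'x L2) \<in> hist_space \<tau>"
    unfolding zero_abs_L2 by (rule abs_L2_in_hist_space) auto
qed

text \<open>Only the window \<open>[-\<tau>,T]\<close> matters. Square integrability there
  guarantees that each segment with \<open>t \<in> {0..T}\<close> is an actual class, as
  \<open>abs_L2\<close> is meaningful only on square integrable functions.\<close>

definition l2_upto :: "real \<Rightarrow> real \<Rightarrow> (real \<Rightarrow> 'x::{real_inner,banach,second_countable_topology}) \<Rightarrow> bool"
  where "l2_upto \<tau> T v \<longleftrightarrow> l2_fun (\<lambda>r. if r \<in> {-\<tau>..T} then v r else 0)"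

text \<open>All segments are windows into one fixed class, moved by translation. Hence
  \<open>seg \<tau> v\<close> is continuous in time even though the initial history is merely square
  integrable.\<close>

lemma seg_eq_cut_translate:
  assumes "l2_upto \<tau> T v" "t \<in> {0..T}"
  shows "seg \<tau> v t = cut_hist \<tau> (translate t (abs_L2 (\<lambda>r. if r \<in> {-\<tau>..T} then v r else 0)))"
proof -
  let ?a = "\<lambda>r. if r \<in> {-\<tau>..T} then v r else 0"
  have a: "l2_fun ?a" using assms(1) by (simp only: l2_upto_def)
  have "cut_hist \<tau> (translate t (abs_L2 ?a)) = abs_L2 (\<lambda>s. if s \<in> {-\<tau>..0} then ?a (t + s) else 0)"
    unfolding translate_abs[OF a] by (rule cut_hist_abs[OF l2_fun_translate[OF a]])
  also have "(\<lambda>s. if s \<in> {-\<tau>..0} then ?a (t + s) else 0) = (\<lambda>s. if s \<in> {-\<tau>..0} then v (t + s) else 0)"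
    using assms(2) by (auto simp: fun_eq_iff)
  finally show ?thesis by (simp only: seg_def)
qed

lemma seg_in_hist_space: "l2_upto \<tau> T v \<Longrightarrow> t \<in> {0..T} \<Longrightarrow> seg \<tau> v t \<in> hist_space \<tau>"
  by (simp add: seg_eq_cut_translate)

lemma seg_cong_AE:
  assumes "l2_upto \<tau> T v" "l2_upto \<tau> T w" "AE r in lborel. r \<in> {-\<tau>..T} \<longrightarrow> v r = w r" "t \<in> {0..T}"
  shows "seg \<tau> v t = seg \<tau> w t"
proof -
  have "AE r in lborel. (if r \<in> {-\<tau>..T} then v r else 0) = (if r \<in> {-\<tau>..T} then w r else 0)"
    using assms(3) by eventually_elim auto
  then have "abs_L2 (\<lambda>r. if r \<in> {-\<tau>..T} then v r else 0) = abs_L2 (\<lambda>r. if r \<in> {-\<tau>..T} then w r else 0)"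
    using assms(1,2) by (intro abs_L2_eqI) (simp_all only: l2_upto_def)
  then show ?thesis
    by (simp only: seg_eq_cut_translate[OF assms(1,4)] seg_eq_cut_translate[OF assms(2,4)])
qed

lemma continuous_on_seg:
  assumes "l2_upto \<tau> T v"
  shows "continuous_on {0..T} (seg \<tau> v)"
proof -
  let ?a = "abs_L2 (\<lambda>r. if r \<in> {-\<tau>..T} then v r else 0)"
  have "continuous_on {0..T} (\<lambda>t. cut_hist \<tau> (translate t ?a))"
    by (intro bounded_linear.continuous_on[OF bounded_linear_cut_hist]
        continuous_on_subset[OF continuous_translate]) auto
  then show ?thesis
    by (subst continuous_on_cong[OF refl seg_eq_cut_translate[OF assms]]) auto
qed

lemma l2_upto_add: "l2_upto \<tau> T v \<Longrightarrow> l2_upto \<tau> T w \<Longrightarrow> l2_upto \<tau> T (\<lambda>r. v r + w r)"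
proof -
  assume "l2_upto \<tau> T v" "l2_upto \<tau> T w"
  then have "l2_fun (\<lambda>r. (if r \<in> {-\<tau>..T} then v r else 0) + (if r \<in> {-\<tau>..T} then w r else 0))" (is "l2_fun ?a")
    unfolding l2_upto_def by (rule l2_fun_add)
  also have "?a = (\<lambda>r. if r \<in> {-\<tau>..T} then v r + w r else 0)" by (auto simp: fun_eq_iff)
  finally show ?thesis by (simp only: l2_upto_def)
qed

lemma l2_upto_scaleR: "l2_upto \<tau> T v \<Longrightarrow> l2_upto \<tau> T (\<lambda>r. c *\<^sub>R v r)"
proof -
  assume "l2_upto \<tau> T v"
  then have "l2_fun (\<lambda>r. c *\<^sub>R (if r \<in> {-\<tau>..T} then v r else 0))" (is "l2_fun ?a")
    unfolding l2_upto_def by (rule l2_fun_scaleR)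
  also have "?a = (\<lambda>r. if r \<in> {-\<tau>..T} then c *\<^sub>R v r else 0)"
    by (auto simp: fun_eq_iff)
  finally show ?thesis by (simp only: l2_upto_def)
qed

lemma l2_fun_seg: "l2_upto \<tau> T v \<Longrightarrow> t \<in> {0..T} \<Longrightarrow> l2_fun (\<lambda>\<xi>. if \<xi> \<in> {-\<tau>..0} then v (t + \<xi>) else 0)"
proof -
  let ?a = "\<lambda>r. if r \<in> {-\<tau>..T} then v r else 0"
  assume "l2_upto \<tau> T v" and t: "t \<in> {0..T}"
  then have a: "l2_fun ?a" by (simp only: l2_upto_def)
  have "l2_fun (\<lambda>s. if s \<in> {-\<tau>..0} then ?a (t + s) else 0)"
    by (intro l2_fun_if l2_fun_translate[OF a]) auto
  also have "(\<lambda>s. if s \<in> {-\<tau>..0} then ?a (t + s) else 0) = (\<lambda>s. if s \<in> {-\<tau>..0} then v (t + s) else 0)"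
    using t by (auto simp: fun_eq_iff)
  finally show ?thesis .
qed

lemma seg_add:
  assumes "l2_upto \<tau> T v" "l2_upto \<tau> T w" "t \<in> {0..T}"
  shows "seg \<tau> (\<lambda>r. v r + w r) t = seg \<tau> v t + seg \<tau> w t"
proof -
  have eq: "(\<lambda>\<xi>. if \<xi> \<in> {-\<tau>..0} then v (t + \<xi>) + w (t + \<xi>) else 0) =
     (\<lambda>\<xi>. (if \<xi> \<in> {-\<tau>..0} then v (t + \<xi>) else 0) + (if \<xi> \<in> {-\<tau>..0} then w (t + \<xi>) else 0))"
    by (auto simp: fun_eq_iff)
  show ?thesis
    unfolding seg_def eq by (rule abs_L2_add[symmetric]) (use assms l2_fun_seg in blast)+
qed

lemma seg_scaleR:
  assumes "l2_upto \<tau> T v" "t \<in> {0..T}"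
  shows "seg \<tau> (\<lambda>r. c *\<^sub>R v r) t = c *\<^sub>R seg \<tau> v t"
proof -
  have eq: "(\<lambda>\<xi>. if \<xi> \<in> {-\<tau>..0} then c *\<^sub>R v (t + \<xi>) else 0) =
     (\<lambda>\<xi>. c *\<^sub>R (if \<xi> \<in> {-\<tau>..0} then v (t + \<xi>) else 0))"
    by (auto simp: fun_eq_iff)
  show ?thesis
    unfolding seg_def eq by (rule abs_L2_scaleR[symmetric]) (use assms l2_fun_seg in blast)+
qed

lemma l2_upto_if:
  assumes "l2_upto \<tau> T v" "A \<in> sets borel"
  shows "l2_upto \<tau> T (\<lambda>r. if r \<in> A then v r else 0)"
proof -
  have "l2_fun (\<lambda>r. if r \<in> A then (if r \<in> {-\<tau>..T} then v r else 0) else 0)" (is "l2_fun ?a")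
    using assms unfolding l2_upto_def by (rule l2_fun_if)
  also have "?a = (\<lambda>r. if r \<in> {-\<tau>..T} then (if r \<in> A then v r else 0) else 0)" by (auto simp: fun_eq_iff)
  finally show ?thesis by (simp only: l2_upto_def)
qed

lemma l2_fun_continuous:
  fixes x :: "real \<Rightarrow> 'x::{real_inner,banach,second_countable_topology}"
  assumes "continuous_on {a..b} x"
  shows "l2_fun (\<lambda>r. if r \<in> {a..b} then x r else 0)"
proof -
  have i: "set_integrable lborel {a..b} x" "set_integrable lborel {a..b} (\<lambda>r. (norm (x r))\<^sup>2)"
    by (intro borel_integrable_atLeastAtMost' continuous_intros assms)+
  have "(\<lambda>r. if r \<in> {a..b} then x r else 0) = (\<lambda>r. indicator {a..b} r *\<^sub>R x r)"
       "(\<lambda>r. (norm (if r \<in> {a..b} then x r else 0))\<^sup>2) = (\<lambda>r. indicator {a..b} r *\<^sub>R (norm (x r))\<^sup>2)"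
    by (auto simp: fun_eq_iff)
  with i show ?thesis unfolding l2_fun_def set_integrable_def
    by (metis borel_measurable_integrable)
qed

text \<open>Split \<open>v\<close> at time 0. The old history only loses mass as it leaves the
  window, so its norm is at most that of \<open>seg \<tau> v 0\<close>; the new part is bounded by
  \<open>B\<close> on an interval of length at most \<open>\<tau>\<close>.\<close>

lemma norm_seg_le:
  fixes v :: "real \<Rightarrow> 'x::{real_inner,banach,second_countable_topology}"
  assumes v: "l2_upto \<tau> T v" and t: "t \<in> {0..T}" and B: "\<And>r. r \<in> {0..t} \<Longrightarrow> norm (v r) \<le> B" and \<tau>: "0 \<le> \<tau>"
  shows "norm (seg \<tau> v t) \<le> norm (seg \<tau> v 0) + sqrt \<tau> * B"
proof -
  have "0 \<le> norm (v 0)" by simp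
  also have "\<dots> \<le> B" using B[of 0] t by simp
  finally have B0: "0 \<le> B" .
  define v1 where "v1 = (\<lambda>r. if r \<in> {..<0} then v r else 0)"
  define v2 where "v2 = (\<lambda>r. if r \<in> {0..} then v r else 0)"
  have v12: "l2_upto \<tau> T v1" "l2_upto \<tau> T v2"
    unfolding v1_def v2_def by (intro l2_upto_if v; simp)+
  have "seg \<tau> v t = seg \<tau> (\<lambda>r. v1 r + v2 r) t"
    by (rule arg_cong[where f = "\<lambda>v. seg \<tau> v t"]) (auto simp: v1_def v2_def)
  also have "\<dots> = seg \<tau> v1 t + seg \<tau> v2 t"
    by (rule seg_add[OF v12 t])
  finally have "norm (seg \<tau> v t) \<le> norm (seg \<tau> v1 t) + norm (seg \<tau> v2 t)"
    by (simp add: norm_triangle_ineq)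
  also have "norm (seg \<tau> v1 t) \<le> norm (seg \<tau> v 0)"
  proof -
    let ?a = "\<lambda>r. if r \<in> {-\<tau>..T} then v1 r else 0"
    have a: "l2_fun ?a" using v12(1) by (simp only: l2_upto_def)
    have "norm (seg \<tau> v1 t) \<le> norm (translate t (abs_L2 ?a))"
      unfolding seg_eq_cut_translate[OF v12(1) t] by (rule norm_cut_hist_le)
    also have "\<dots> = norm (abs_L2 ?a)" by simp
    also have "\<dots> \<le> norm (seg \<tau> v 0)"
      unfolding seg_def
    proof (rule norm_abs_L2_mono[OF a])
      show "l2_fun (\<lambda>\<xi>. if \<xi> \<in> {-\<tau>..0} then v (0 + \<xi>) else 0)"
        using t by (intro l2_fun_seg[OF v]) auto
    qed (auto simp: v1_def)
    finally show ?thesis .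
  qed
  also have "norm (seg \<tau> v2 t) \<le> norm (abs_L2 (\<lambda>s. indicator {-\<tau>..0} s *\<^sub>R B) :: real L2)"
  proof -
    have l: "l2_fun (\<lambda>\<xi>. if \<xi> \<in> {-\<tau>..0} then v2 (t + \<xi>) else 0)"
      by (rule l2_fun_seg[OF v12(2) t])
    have l': "l2_fun (\<lambda>s. indicator {-\<tau>..0} s *\<^sub>R B)"
      by (intro l2_fun_indicator) (auto simp: emeasure_lborel_Icc_eq)
    have "norm (if s \<in> {-\<tau>..0} then v2 (t + s) else 0) \<le> norm (indicator {-\<tau>..0} s *\<^sub>R B :: real)" for s
      using B[of "t + s"] B0 by (auto simp: v2_def)
    then show ?thesis unfolding seg_def by (rule norm_abs_L2_mono[OF l l'])
  qed
  also have "norm (abs_L2 (\<lambda>s. indicator {-\<tau>..0} s *\<^sub>R B) :: real L2) = sqrt \<tau> * B"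
    using \<tau> B0 by (subst norm_indicator_L2) auto
  finally show ?thesis by simp
qed

text \<open>The value at \<open>0\<close> comes from \<open>x\<close>; the representative of \<open>\<phi>\<close> matters only up to null sets.\<close>

definition glue :: "'x::{real_inner,banach,second_countable_topology} L2 \<Rightarrow> (real \<Rightarrow> 'x) \<Rightarrow> real \<Rightarrow> 'x"
  where "glue \<phi> x = (\<lambda>r. if r < 0 then rep_L2 \<phi> r else x r)"

lemma l2_upto_glue:
  assumes "continuous_on {0..T} x" "0 \<le> T" "0 \<le> \<tau>"
  shows "l2_upto \<tau> T (glue \<phi> x)"
proof -
  have "l2_fun (\<lambda>r. (if r \<in> {-\<tau>..<0} then rep_L2 \<phi> r else 0) + (if r \<in> {0..T} then x r else 0))" (is "l2_fun ?a")
    by (intro l2_fun_add l2_fun_if l2_fun_continuous assms) auto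
  also have "?a = (\<lambda>r. if r \<in> {-\<tau>..T} then glue \<phi> x r else 0)"
    using assms(2,3) by (auto simp: fun_eq_iff glue_def)
  finally show ?thesis by (simp only: l2_upto_def)
qed

text \<open>History and forward path are kept apart so that the segment is jointly linear in both,
  with the history given only as a class.\<close>

definition Seg :: "real \<Rightarrow> 'x::{real_inner,banach,second_countable_topology} L2 \<Rightarrow> (real \<Rightarrow> 'x) \<Rightarrow> real \<Rightarrow> 'x L2"
  where "Seg \<tau> \<phi> x = seg \<tau> (glue \<phi> x)"

lemma Seg_0:
  assumes "\<phi> \<in> hist_space \<tau>" "0 \<le> \<tau>"
  shows "Seg \<tau> \<phi> x 0 = \<phi>"
proof -
  have l: "l2_upto \<tau> 0 (glue \<phi> x)" using assms(2) by (intro l2_upto_glue) auto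
  have "Seg \<tau> \<phi> x 0 = cut_hist \<tau> \<phi>"
    unfolding Seg_def seg_def cut_hist_def
  proof (rule abs_L2_eqI)
    show "l2_fun (\<lambda>\<xi>. if \<xi> \<in> {-\<tau>..0} then glue \<phi> x (0 + \<xi>) else 0)"
      by (rule l2_fun_seg[OF l]) simp
    show "AE s in lborel. (if s \<in> {-\<tau>..0} then glue \<phi> x (0 + s) else 0) = (if s \<in> {-\<tau>..0} then rep_L2 \<phi> s else 0)"
      using AE_lborel_singleton[of "0::real"] by eventually_elim (auto simp: glue_def)
  qed (intro l2_fun_if l2_fun_rep, simp)
  then show ?thesis using assms by (simp add: cut_hist_id)
qed

lemma l2_upto_history:
  assumes "l2_fun (\<lambda>\<xi>. if \<xi> \<in> {-\<tau>..0} then v \<xi> else 0)" "continuous_on {0..T} v" "0 \<le> T" "0 \<le> \<tau>"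
  shows "l2_upto \<tau> T v"
proof -
  have "l2_fun (\<lambda>r. (if r \<in> {..<0} then (if r \<in> {-\<tau>..0} then v r else 0) else 0) + (if r \<in> {0..T} then v r else 0))"
    (is "l2_fun ?a")
    by (intro l2_fun_add l2_fun_if[OF assms(1)] l2_fun_continuous assms) auto
  also have "?a = (\<lambda>r. if r \<in> {-\<tau>..T} then v r else 0)"
    using assms(3,4) by (auto simp: fun_eq_iff)
  finally show ?thesis by (simp only: l2_upto_def)
qed

text \<open>Passes from paths with pointwise values before time 0, as in
  \<open>mild_solution\<close>, to pairs of a class and a forward path.\<close>

lemma seg_eq_Seg:
  assumes "l2_fun (\<lambda>\<xi>. if \<xi> \<in> {-\<tau>..0} then v \<xi> else 0)" "continuous_on {0..T} v" "t \<in> {0..T}" "0 \<le> \<tau>"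
  shows "seg \<tau> v t = Seg \<tau> (seg \<tau> v 0) v t"
  unfolding Seg_def
proof (rule seg_cong_AE)
  have T: "0 \<le> T" using assms(3) by simp
  show "l2_upto \<tau> T v" "l2_upto \<tau> T (glue (seg \<tau> v 0) v)"
    using assms T by (auto intro: l2_upto_history l2_upto_glue)
  have "AE r in lborel. rep_L2 (seg \<tau> v 0) r = (if r \<in> {-\<tau>..0} then v (0 + r) else 0)"
    unfolding seg_def using assms(1) by (intro rep_abs_L2) (simp only: add_0)
  then show "AE r in lborel. r \<in> {-\<tau>..T} \<longrightarrow> v r = glue (seg \<tau> v 0) v r"
    by eventually_elim (auto simp: glue_def)
qed (use assms in auto)

context
  fixes \<tau> T :: real
  assumes \<tau>: "0 \<le> \<tau>"
begin

lemma Seg_in_hist_space: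
  assumes "continuous_on {0..T} x" "t \<in> {0..T}"
  shows "Seg \<tau> \<phi> x t \<in> hist_space \<tau>"
  unfolding Seg_def using assms \<tau> by (intro seg_in_hist_space[of _ T] l2_upto_glue) auto

lemma continuous_on_Seg:
  assumes "continuous_on {0..T} x"
  shows "continuous_on {0..T} (Seg \<tau> \<phi> x)"
proof (cases "0 \<le> T")
  case True
  then show ?thesis unfolding Seg_def using assms \<tau> by (intro continuous_on_seg l2_upto_glue) auto
qed auto

lemma Seg_add:
  assumes "continuous_on {0..T} x" "continuous_on {0..T} y" "t \<in> {0..T}"
  shows "Seg \<tau> (\<phi> + \<psi>) (\<lambda>r. x r + y r) t = Seg \<tau> \<phi> x t + Seg \<tau> \<psi> y t"
proof -
  have T: "0 \<le> T" using assms(3) by simp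
  have l: "l2_upto \<tau> T (glue \<phi> x)" "l2_upto \<tau> T (glue \<psi> y)"
    "l2_upto \<tau> T (glue (\<phi> + \<psi>) (\<lambda>r. x r + y r))"
    using assms T \<tau> by (auto intro!: l2_upto_glue continuous_intros)
  have "Seg \<tau> (\<phi> + \<psi>) (\<lambda>r. x r + y r) t = seg \<tau> (\<lambda>r. glue \<phi> x r + glue \<psi> y r) t"
    unfolding Seg_def
  proof (rule seg_cong_AE)
    show "AE r in lborel. r \<in> {-\<tau>..T} \<longrightarrow> glue (\<phi> + \<psi>) (\<lambda>r. x r + y r) r = glue \<phi> x r + glue \<psi> y r"
      using rep_L2_add[of \<phi> \<psi>] by eventually_elim (auto simp: glue_def)
  qed (use l assms(3) l2_upto_add in auto)
  also have "\<dots> = Seg \<tau> \<phi> x t + Seg \<tau> \<psi> y t"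
    unfolding Seg_def using l assms(3) by (intro seg_add) auto
  finally show ?thesis .
qed

lemma Seg_scaleR:
  assumes "continuous_on {0..T} x" "t \<in> {0..T}"
  shows "Seg \<tau> (c *\<^sub>R \<phi>) (\<lambda>r. c *\<^sub>R x r) t = c *\<^sub>R Seg \<tau> \<phi> x t"
proof -
  have T: "0 \<le> T" using assms(2) by simp
  have l: "l2_upto \<tau> T (glue \<phi> x)" "l2_upto \<tau> T (glue (c *\<^sub>R \<phi>) (\<lambda>r. c *\<^sub>R x r))"
    using assms T \<tau> by (auto intro!: l2_upto_glue continuous_intros)
  have "Seg \<tau> (c *\<^sub>R \<phi>) (\<lambda>r. c *\<^sub>R x r) t = seg \<tau> (\<lambda>r. c *\<^sub>R glue \<phi> x r) t"
    unfolding Seg_def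
  proof (rule seg_cong_AE)
    show "AE r in lborel. r \<in> {-\<tau>..T} \<longrightarrow> glue (c *\<^sub>R \<phi>) (\<lambda>r. c *\<^sub>R x r) r = c *\<^sub>R glue \<phi> x r"
      using rep_L2_scaleR[of c \<phi>] by eventually_elim (auto simp: glue_def)
  qed (use l assms(2) l2_upto_scaleR in auto)
  also have "\<dots> = c *\<^sub>R Seg \<tau> \<phi> x t"
    unfolding Seg_def using l assms(2) by (intro seg_scaleR) auto
  finally show ?thesis .
qed

lemma Seg_diff:
  assumes "continuous_on {0..T} x" "continuous_on {0..T} y" "t \<in> {0..T}"
  shows "Seg \<tau> (\<phi> - \<psi>) (\<lambda>r. x r - y r) t = Seg \<tau> \<phi> x t - Seg \<tau> \<psi> y t"
  using Seg_add[of x "\<lambda>r. (-1) *\<^sub>R y r" t \<phi> "(-1) *\<^sub>R \<psi>"] Seg_scaleR[of y t "-1" \<psi>] assms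
  by (simp add: continuous_on_minus)

lemma norm_Seg_le:
  assumes "continuous_on {0..T} x" "t \<in> {0..T}" "\<phi> \<in> hist_space \<tau>" "\<And>r. r \<in> {0..t} \<Longrightarrow> norm (x r) \<le> B"
  shows "norm (Seg \<tau> \<phi> x t) \<le> norm \<phi> + sqrt \<tau> * B"
proof -
  have "norm (Seg \<tau> \<phi> x t) \<le> norm (Seg \<tau> \<phi> x 0) + sqrt \<tau> * B"
    unfolding Seg_def
    using assms \<tau> by (intro norm_seg_le[of _ T] l2_upto_glue) (auto simp: glue_def)
  then show ?thesis using assms(3) \<tau> by (simp add: Seg_0)
qed

lemma Seg_cong:
  assumes "continuous_on {0..T} x" "t \<in> {0..T}" "\<And>r. r \<in> {0..T} \<Longrightarrow> x r = y r"
  shows "Seg \<tau> \<phi> x t = Seg \<tau> \<phi> y t"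
proof -
  have T: "0 \<le> T" using assms(2) by simp
  have "continuous_on {0..T} y"
    using assms(1) by (subst continuous_on_cong[OF refl assms(3)[symmetric]]) auto
  then show ?thesis
    unfolding Seg_def using assms \<tau> T
    by (intro seg_cong_AE[of _ T] l2_upto_glue AE_I2) (auto simp: glue_def)
qed

end

section \<open>Strongly continuous semigroups\<close>

lemma convergent_bounded_above:
  fixes u :: "nat \<Rightarrow> real"
  assumes "u \<longlonglongrightarrow> t"
  shows "\<exists>R. \<forall>n. u n \<le> R"
proof -
  have "Bseq u" using assms convergent_imp_Bseq convergent_def by blast
  then show ?thesis unfolding Bseq_def by (metis abs_ge_self order_trans real_norm_def)
qed

text \<open>Baire category: the closed sets \<open>B k\<close> cover the space, so one of them
  contains a ball.\<close>

lemma uniform_boundedness: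
  fixes T :: "nat \<Rightarrow> 'a::banach \<Rightarrow> 'b::real_normed_vector"
  assumes lin: "\<And>n. bounded_linear (T n)" and pw: "\<And>x. \<exists>k. \<forall>n. norm (T n x) \<le> k"
  shows "\<exists>M. \<forall>n x. norm (T n x) \<le> M * norm x"
proof -
  define B where "B k = {x. \<forall>n. norm (T n x) \<le> real k}" for k :: nat
  have cl: "closed (B k)" for k
  proof -
    have "B k = (\<Inter>n. {x. norm (T n x) \<le> real k})" by (auto simp: B_def)
    also have "closed \<dots>"
      by (intro closed_INT ballI closed_Collect_le continuous_intros
          linear_continuous_on[OF lin])
    finally show ?thesis .
  qed
  have "\<Union>(range B) = UNIV"
  proof -
    have "\<exists>k. x \<in> B k" for x
    proof -
      obtain c where c: "\<forall>n. norm (T n x) \<le> c" using pw by blast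
      obtain k where "c \<le> real k" using real_arch_simple by blast
      with c have "x \<in> B k" unfolding B_def by (auto intro: order_trans)
      then show ?thesis ..
    qed
    then show ?thesis by blast
  qed
  then have "interior (\<Union>(range B)) \<noteq> {}" by simp
  then have "\<exists>k. interior (B k) \<noteq> {}"
    using Met_TC.metric_Baire_category_alt[of "range B"] cl
    by (auto simp: mcomplete_iff_complete complete_UNIV)
  then obtain k z where "z \<in> interior (B k)" by blast
  then obtain e where e: "0 < e" "ball z e \<subseteq> B k"
    using mem_interior by blast
  \<comment> \<open>A vector of norm \<open>e / 2\<close> is a difference of two points of the ball,
    which costs \<open>2 * k\<close>; rescaling to \<open>x\<close> gives the factor 4.\<close>
  have "norm (T n x) \<le> (4 * real k / e) * norm x" for n x
  proof (cases "x = 0")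
    case True
    then show ?thesis using linear_simps(3)[OF lin] by simp
  next
    case False
    define y where "y = (e / (2 * norm x)) *\<^sub>R x"
    have "norm y = e / 2" using False e by (simp add: y_def)
    then have "z + y \<in> ball z e" "z \<in> ball z e" using e by (auto simp: dist_norm)
    then have "norm (T n (z + y)) \<le> k" "norm (T n z) \<le> k" using e unfolding B_def by blast+
    moreover have "T n y = T n (z + y) - T n z" by (simp add: linear_simps(1)[OF lin])
    ultimately have "norm (T n y) \<le> 2 * k" using norm_triangle_ineq4[of "T n (z + y)" "T n z"] by simp
    moreover have "T n y = (e / (2 * norm x)) *\<^sub>R T n x"
      unfolding y_def by (rule linear_simps(5)[OF lin])
    ultimately have "e / (2 * norm x) * norm (T n x) \<le> 2 * k" using e by simp
    then show ?thesis using False e by (simp add: field_simps)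
  qed
  then show ?thesis by blast
qed

context
  fixes S :: "real \<Rightarrow> 'x::{banach,second_countable_topology} \<Rightarrow> 'x"
  assumes S: "C0_semigroup S"
begin

lemma semigroup_linear: "0 \<le> t \<Longrightarrow> bounded_linear (S t)"
  and semigroup_0: "S 0 x = x"
  and semigroup_add: "0 \<le> s \<Longrightarrow> 0 \<le> t \<Longrightarrow> S (s + t) x = S s (S t x)"
  using S by (auto simp: C0_semigroup_def fun_eq_iff)

lemma semigroup_tendsto_0:
  assumes "\<And>n. 0 \<le> u n" "u \<longlonglongrightarrow> 0"
  shows "(\<lambda>n. S (u n) x) \<longlonglongrightarrow> x"
proof -
  have "((\<lambda>t. S t x) \<longlongrightarrow> S 0 x) (at 0 within {0..})"
    using S by (simp add: C0_semigroup_def at_within_Ici_at_right)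
  then have "continuous (at 0 within {0..}) (\<lambda>t. S t x)"
    by (simp add: continuous_within)
  then have "(\<lambda>n. S (u n) x) \<longlonglongrightarrow> S 0 x"
    using assms by (auto simp: continuous_within_sequentially o_def)
  then show ?thesis by (simp add: semigroup_0)
qed

text \<open>If no bound held near 0, it would fail along times tending to 0, where the operators
  converge pointwise; this contradicts uniform boundedness. The semigroup law then carries a bound
  on \<open>[0,d]\<close> to any bounded interval.\<close>

lemma semigroup_locally_bounded: "\<exists>M\<ge>1. \<forall>t\<in>{0..T}. \<forall>x. norm (S t x) \<le> M * norm x"
proof -
  have "\<exists>n::nat. \<forall>t\<in>{0..1 / Suc n}. \<forall>x. norm (S t x) \<le> n * norm x"
  proof (rule ccontr)
    assume neg: "\<not> (\<exists>n::nat. \<forall>t\<in>{0..1 / Suc n}. \<forall>x. norm (S t x) \<le> n * norm x)"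
    have "\<forall>n::nat. \<exists>p. fst p \<in> {0..1 / Suc n} \<and> n * norm (snd p) < norm (S (fst p) (snd p))"
    proof
      fix n :: nat
      from neg have "\<not> (\<forall>t\<in>{0..1 / Suc n}. \<forall>x. norm (S t x) \<le> n * norm x)" by blast
      then obtain t x where "t \<in> {0..1 / Suc n}" "n * norm x < norm (S t x)" by (meson not_le)
      then show "\<exists>p. fst p \<in> {0..1 / Suc n} \<and> n * norm (snd p) < norm (S (fst p) (snd p))"
        by (intro exI[of _ "(t, x)"]) simp
    qed
    from choice[OF this] obtain p where
      p: "\<forall>n::nat. fst (p n) \<in> {0..1 / Suc n} \<and> n * norm (snd (p n)) < norm (S (fst (p n)) (snd (p n)))" ..
    define u y where "u n = fst (p n)" and "y n = snd (p n)" for n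
    have u: "u n \<in> {0..1 / Suc n}" and y: "real n * norm (y n) < norm (S (u n) (y n))" for n
      using p by (simp_all only: u_def y_def)
    have "u \<longlonglongrightarrow> 0"
      using u by (intro tendsto_sandwich[OF _ _ tendsto_const LIMSEQ_Suc[OF lim_1_over_n]] always_eventually) auto
    then have "(\<lambda>n. S (u n) x) \<longlonglongrightarrow> x" for x
      using u by (intro semigroup_tendsto_0) auto
    then have "Bseq (\<lambda>n. S (u n) x)" for x using convergent_imp_Bseq convergent_def by blast
    then have "\<exists>k. \<forall>n. norm (S (u n) x) \<le> k" for x unfolding Bseq_def by blast
    moreover have "bounded_linear (S (u n))" for n by (rule semigroup_linear) (use u[of n] in simp)
    ultimately obtain M where M: "\<And>n x. norm (S (u n) x) \<le> M * norm x"
      using uniform_boundedness[of "\<lambda>n. S (u n)"] by blast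
    obtain n :: nat where "M \<le> n" using real_arch_simple by blast
    then have "M * norm (y n) \<le> n * norm (y n)" by (rule mult_right_mono) simp
    with y[of n] M[of n "y n"] show False by linarith
  qed
  then obtain n :: nat where n: "\<And>t x. t \<in> {0..1 / Suc n} \<Longrightarrow> norm (S t x) \<le> n * norm x" by blast
  define d where "d = 1 / real (Suc n)"
  define m where "m = max 1 (real n)"
  have d: "0 < d" by (simp add: d_def)
  have m: "1 \<le> m" by (simp add: m_def)
  have nd: "norm (S t x) \<le> m * norm x" if "t \<in> {0..d}" for t x
  proof -
    have "norm (S t x) \<le> n * norm x" using n that by (simp only: d_def)
    also have "\<dots> \<le> m * norm x" by (rule mult_right_mono) (auto simp: m_def)
    finally show ?thesis .
  qed
  have *: "\<forall>t\<in>{0..real k * d}. \<forall>x. norm (S t x) \<le> m ^ k * norm x" for k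
  proof (induction k)
    case 0
    then show ?case by (simp add: semigroup_0)
  next
    case (Suc k)
    show ?case
    proof (intro ballI allI)
      fix t x assume t: "t \<in> {0..real (Suc k) * d}"
      show "norm (S t x) \<le> m ^ Suc k * norm x"
      proof (cases "t \<le> d")
        case True
        have "norm (S t x) \<le> m * norm x" using nd t True by simp
        also have "\<dots> \<le> m ^ Suc k * norm x"
          using m power_increasing[of 1 "Suc k" m] by (intro mult_right_mono) auto
        finally show ?thesis .
      next
        case False
        then have "S t x = S d (S (t - d) x)" using semigroup_add[of d "t - d" x] d by simp
        then have "norm (S t x) \<le> m * norm (S (t - d) x)" using nd[of d] d by simp
        also have "\<dots> \<le> m * (m ^ k * norm x)"
          using Suc.IH t False m by (intro mult_left_mono) (auto simp: algebra_simps)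
        finally show ?thesis by simp
      qed
    qed
  qed
  obtain k :: nat where "T / d \<le> k" using real_arch_simple by blast
  then have k: "T \<le> k * d" using d by (simp add: field_simps)
  show ?thesis
  proof (intro exI conjI)
    show "1 \<le> m ^ k" using m by (rule one_le_power)
    show "\<forall>t\<in>{0..T}. \<forall>x. norm (S t x) \<le> m ^ k * norm x" using * k by auto
  qed
qed

text \<open>Factoring out the smaller of the two times reduces the difference in time to
  \<open>S \<bar>r - t\<bar> y - y\<close>, so right continuity at 0 and local boundedness suffice,
  also for times that approach from the left.\<close>

lemma continuous_on_semigroup_joint: "continuous_on ({0..} \<times> UNIV) (\<lambda>(t, x). S t x)"
proof (rule continuous_on_sequentiallyI)
  fix u :: "nat \<Rightarrow> real \<times> 'x" and a
  assume u: "\<forall>n. u n \<in> {0..} \<times> UNIV" and a: "a \<in> {0..} \<times> UNIV" and lim: "u \<longlonglongrightarrow> a"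
  define r x where "r n = fst (u n)" and "x n = snd (u n)" for n
  define t y where "t = fst a" and "y = snd a"
  have r: "0 \<le> r n" and t: "0 \<le> t" for n using u a by (auto simp: r_def t_def mem_Times_iff)
  have rt: "r \<longlonglongrightarrow> t" and xy: "x \<longlonglongrightarrow> y"
    unfolding r_def x_def t_def y_def by (intro tendsto_fst tendsto_snd lim)+
  obtain R where R: "\<And>n. r n \<le> R" using rt convergent_bounded_above by blast
  obtain M where M: "1 \<le> M" "\<And>s x. s \<in> {0..max R t} \<Longrightarrow> norm (S s x) \<le> M * norm x"
    using semigroup_locally_bounded[of "max R t"] by blast
  have bound: "norm (S (r n) (x n) - S t y) \<le> M * norm (x n - y) + M * norm (S \<bar>r n - t\<bar> y - y)" for n
  proof -
    have A: "norm (S (r n) (x n) - S (r n) y) \<le> M * norm (x n - y)"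
      using M(2)[of "r n" "x n - y"] r R linear_simps(2)[OF semigroup_linear[OF r]]
      by (simp add: le_max_iff_disj)
    have B: "norm (S (r n) y - S t y) \<le> M * norm (S \<bar>r n - t\<bar> y - y)"
    proof (cases "t \<le> r n")
      case True
      then have "S (r n) y = S t (S \<bar>r n - t\<bar> y)" using semigroup_add[of t "r n - t" y] t by simp
      then have "S (r n) y - S t y = S t (S \<bar>r n - t\<bar> y - y)"
        by (simp add: linear_simps(2)[OF semigroup_linear[OF t]])
      then show ?thesis using M(2) t by simp
    next
      case False
      then have "S t y = S (r n) (S \<bar>r n - t\<bar> y)" using semigroup_add[of "r n" "t - r n" y] r[of n] by simp
      then have "S t y - S (r n) y = S (r n) (S \<bar>r n - t\<bar> y - y)"
        by (simp add: linear_simps(2)[OF semigroup_linear[OF r]])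
      then have "norm (S t y - S (r n) y) \<le> M * norm (S \<bar>r n - t\<bar> y - y)"
        using M(2)[of "r n"] r R by (simp add: le_max_iff_disj)
      then show ?thesis by (simp add: norm_minus_commute)
    qed
    show ?thesis using A B norm_triangle_ineq[of "S (r n) (x n) - S (r n) y" "S (r n) y - S t y"] by simp
  qed
  have "(\<lambda>n. \<bar>r n - t\<bar>) \<longlonglongrightarrow> \<bar>t - t\<bar>" by (intro tendsto_intros rt)
  then have "(\<lambda>n. S \<bar>r n - t\<bar> y) \<longlonglongrightarrow> y" by (intro semigroup_tendsto_0) auto
  then have "(\<lambda>n. M * norm (x n - y) + M * norm (S \<bar>r n - t\<bar> y - y)) \<longlonglongrightarrow> M * norm (y - y) + M * norm (y - y)"
    by (intro tendsto_intros xy)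
  then have "(\<lambda>n. M * norm (x n - y) + M * norm (S \<bar>r n - t\<bar> y - y)) \<longlonglongrightarrow> 0" by simp
  then have "(\<lambda>n. S (r n) (x n) - S t y) \<longlonglongrightarrow> 0"
    by (rule Lim_null_comparison[OF always_eventually[OF allI[OF bound]]])
  then have "(\<lambda>n. S (r n) (x n)) \<longlonglongrightarrow> S t y" by (rule LIM_zero_cancel)
  then show "(\<lambda>n. (\<lambda>(t, x). S t x) (u n)) \<longlonglongrightarrow> (\<lambda>(t, x). S t x) a"
    by (simp add: r_def x_def t_def y_def case_prod_beta)
qed

lemma continuous_on_semigroup:
  assumes "continuous_on A a" "continuous_on A b" "\<And>s. s \<in> A \<Longrightarrow> 0 \<le> a s"
  shows "continuous_on A (\<lambda>s. S (a s) (b s))"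
proof -
  have "continuous_on A (\<lambda>s. (\<lambda>(t, x). S t x) (a s, b s))"
    by (rule continuous_on_compose2[OF continuous_on_semigroup_joint])
       (use assms in \<open>auto intro!: continuous_intros\<close>)
  then show ?thesis by simp
qed

section \<open>Convolution with the semigroup\<close>

lemma set_integrable_convolution:
  assumes "continuous_on {0..T} q" "t \<le> T"
  shows "set_integrable lborel {0..t} (\<lambda>s. S (t - s) (q s))"
proof (rule borel_integrable_atLeastAtMost')
  have "continuous_on {0..t} q" by (rule continuous_on_subset[OF assms(1)]) (use assms(2) in auto)
  then show "continuous_on {0..t} (\<lambda>s. S (t - s) (q s))"
    by (rule continuous_on_semigroup[rotated]) (auto intro!: continuous_intros)
qed

text \<open>The integrand depends on \<open>t\<close> through the semigroup and through the domain
  of integration; off the null set \<open>s = t\<close> it converges pointwise, so dominated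
  convergence applies.\<close>

lemma continuous_on_convolution:
  assumes q: "continuous_on {0..T} q"
  shows "continuous_on {0..T} (\<lambda>t. LBINT s:{0..t}. S (t - s) (q s))"
proof (rule continuous_on_sequentiallyI)
  fix u t assume u: "\<forall>n. u n \<in> {0..T}" and t: "t \<in> {0..T}" and lim: "u \<longlonglongrightarrow> t"
  obtain M where M: "1 \<le> M" "\<And>s x. s \<in> {0..T} \<Longrightarrow> norm (S s x) \<le> M * norm x"
    using semigroup_locally_bounded[of T] by blast
  have "compact (q ` {0..T})" using q by (intro compact_continuous_image) auto
  then have "bounded (q ` {0..T})" by (rule compact_imp_bounded)
  then obtain Q where "0 < Q" "\<forall>y\<in>q ` {0..T}. norm y \<le> Q" unfolding bounded_pos by blast
  then have Q: "0 < Q" "\<And>s. s \<in> {0..T} \<Longrightarrow> norm (q s) \<le> Q" by auto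
  show "(\<lambda>n. LBINT s:{0..u n}. S (u n - s) (q s)) \<longlonglongrightarrow> (LBINT s:{0..t}. S (t - s) (q s))"
    unfolding set_lebesgue_integral_def
  proof (rule integral_dominated_convergence[where w = "\<lambda>s. indicator {0..T} s *\<^sub>R (M * Q)"])
    have meas: "(\<lambda>s. indicator {0..t} s *\<^sub>R S (t - s) (q s)) \<in> borel_measurable lborel" if "t \<le> T" for t
      using set_integrable_convolution[OF q that] unfolding set_integrable_def by (rule borel_measurable_integrable)
    show "(\<lambda>s. indicator {0..t} s *\<^sub>R S (t - s) (q s)) \<in> borel_measurable lborel"
      "(\<lambda>s. indicator {0..u n} s *\<^sub>R S (u n - s) (q s)) \<in> borel_measurable lborel" for n
      using meas t u by auto
    show "integrable lborel (\<lambda>s. indicator {0..T} s *\<^sub>R (M * Q))"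
      by (simp add: integrable_indicator_iff emeasure_lborel_Icc_eq)
    show "AE s in lborel. (\<lambda>n. indicator {0..u n} s *\<^sub>R S (u n - s) (q s)) \<longlonglongrightarrow> indicator {0..t} s *\<^sub>R S (t - s) (q s)"
      using AE_lborel_singleton[of t]
    proof eventually_elim
      case (elim s)
      show ?case
      proof (cases "0 \<le> s \<and> s < t")
        case True
        then have ev: "\<forall>\<^sub>F n in sequentially. s < u n" using lim by (intro order_tendstoD(1)) auto
        \<comment> \<open>Truncation at 0 keeps the time argument where \<open>S\<close> is
          continuous, so that the function of \<open>r\<close> is continuous on the whole
          line.\<close>
        have "(\<lambda>n. S (max 0 (u n - s)) (q s)) \<longlonglongrightarrow> S (max 0 (t - s)) (q s)"
        proof -
          have "continuous_on UNIV (\<lambda>r. S (max 0 (r - s)) (q s))"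
            by (rule continuous_on_semigroup) (auto intro!: continuous_intros)
          then have "isCont (\<lambda>r. S (max 0 (r - s)) (q s)) t"
            by (simp add: continuous_on_eq_continuous_at)
          then show ?thesis using lim by (rule isCont_tendsto_compose)
        qed
        moreover have "\<forall>\<^sub>F n in sequentially. S (max 0 (u n - s)) (q s) = indicator {0..u n} s *\<^sub>R S (u n - s) (q s)"
          using ev by eventually_elim (use True in \<open>simp add: indicator_def\<close>)
        ultimately have "(\<lambda>n. indicator {0..u n} s *\<^sub>R S (u n - s) (q s)) \<longlonglongrightarrow> S (max 0 (t - s)) (q s)"
          by (rule Lim_transform_eventually)
        then show ?thesis using True by (simp add: indicator_def)
      next
        case False
        then consider "s < 0" | "t < s" using elim by fastforce
        then show ?thesis
        proof cases
          case 1 then show ?thesis by simp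
        next
          case 2
          then have "\<forall>\<^sub>F n in sequentially. u n < s" using lim by (intro order_tendstoD(2)) auto
          then have "\<forall>\<^sub>F n in sequentially. indicator {0..u n} s *\<^sub>R S (u n - s) (q s) = indicator {0..t} s *\<^sub>R S (t - s) (q s)"
            by eventually_elim (use 2 in simp)
          then show ?thesis by (rule tendsto_eventually)
        qed
      qed
    qed
    show "AE s in lborel. norm (indicator {0..u n} s *\<^sub>R S (u n - s) (q s)) \<le> indicator {0..T} s *\<^sub>R (M * Q)" for n
    proof (rule AE_I2)
      fix s
      have un: "u n \<le> T" using u by auto
      show "norm (indicator {0..u n} s *\<^sub>R S (u n - s) (q s)) \<le> indicator {0..T} s *\<^sub>R (M * Q)"
      proof (cases "s \<in> {0..u n}")
        case True
        have "norm (S (u n - s) (q s)) \<le> M * norm (q s)" using True un by (intro M) auto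
        also have "\<dots> \<le> M * Q" using True un M(1) by (intro mult_left_mono Q) auto
        finally show ?thesis using True un by simp
      qed (use M Q in simp)
    qed
  qed
qed

lemma norm_convolution_le:
  assumes q: "continuous_on {0..T} q" and t: "t \<in> {0..T}" and b: "continuous_on {0..T} b"
    and M: "\<And>s x. s \<in> {0..T} \<Longrightarrow> norm (S s x) \<le> M * norm x" "0 \<le> M"
    and qb: "\<And>s. s \<in> {0..T} \<Longrightarrow> norm (q s) \<le> b s"
  shows "norm (LBINT s:{0..t}. S (t - s) (q s)) \<le> M * (LBINT s:{0..t}. b s)"
proof -
  have i: "set_integrable lborel {0..t} (\<lambda>s. S (t - s) (q s))"
    using q t by (intro set_integrable_convolution[of T]) auto
  have j: "set_integrable lborel {0..t} (\<lambda>s. M * b s)"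
    using t by (intro borel_integrable_atLeastAtMost' continuous_intros continuous_on_subset[OF b]) auto
  have "norm (LBINT s:{0..t}. S (t - s) (q s)) \<le> (LBINT s:{0..t}. norm (S (t - s) (q s)))"
    by (rule set_integral_norm_bound[OF i])
  also have "\<dots> \<le> (LBINT s:{0..t}. M * b s)"
  proof (rule set_integral_mono[OF set_integrable_norm[OF i] j])
    fix s assume s: "s \<in> {0..t}"
    have "norm (S (t - s) (q s)) \<le> M * norm (q s)" using s t by (intro M) auto
    also have "\<dots> \<le> M * b s" using s t M(2) by (intro mult_left_mono qb) auto
    finally show "norm (S (t - s) (q s)) \<le> M * b s" .
  qed
  finally show ?thesis by simp
qed

end

section \<open>Delay Volterra equations\<close>

lemma integral_exp_linear_le:
  fixes a c d t :: real
  assumes "0 \<le> a" "0 < c" "0 \<le> t"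
  shows "(LBINT s:{0..t}. a * exp (c * s) + d) \<le> a / c * exp (c * t) + d * t"
proof -
  have "(LBINT s:{0..t}. a * exp (c * s) + d) = (a / c * exp (c * t) + d * t) - (a / c * exp (c * 0) + d * 0)"
    unfolding set_lebesgue_integral_def
  proof (rule integral_FTC_atLeastAtMost)
    fix s assume "0 \<le> s" "s \<le> t"
    show "((\<lambda>s. a / c * exp (c * s) + d * s) has_vector_derivative a * exp (c * s) + d) (at s within {0..t})"
      unfolding has_real_derivative_iff_has_vector_derivative[symmetric]
      using assms(2) by (auto intro!: derivative_eq_intros)
  qed (use assms in \<open>auto intro!: continuous_intros\<close>)
  also have "\<dots> \<le> a / c * exp (c * t) + d * t" using assms by simp
  finally show ?thesis .
qed

text \<open>The mild equation on \<open>[0,T]\<close> with an arbitrary right side, so that the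
  nonlinear equation and its linearisation share one theory. Only the forward path is unknown; the
  history enters through \<open>fst p\<close>.\<close>

definition volterra_solution ::
    "(real \<Rightarrow> 'x \<Rightarrow> 'x) \<Rightarrow> real \<Rightarrow> (real \<Rightarrow> 'x L2 \<Rightarrow> 'x \<Rightarrow> 'x) \<Rightarrow> real \<Rightarrow> 'x L2 \<times> 'x \<Rightarrow>
      (real \<Rightarrow> 'x::{real_inner,banach,second_countable_topology}) \<Rightarrow> bool"
  where "volterra_solution S \<tau> G T p x \<longleftrightarrow> continuous_on {0..T} x \<and>
    (\<forall>t\<in>{0..T}. x t = S t (snd p) + (LBINT s:{0..t}. S (t - s) (G s (Seg \<tau> (fst p) x s) (x s))))"

text \<open>The last clause asks for continuity only along continuous curves of histories, which is
  what the convolution integrals require.\<close>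

definition lipschitz_rhs ::
    "real \<Rightarrow> real \<Rightarrow> real \<Rightarrow> (real \<Rightarrow> 'x L2 \<Rightarrow> 'x \<Rightarrow> 'x::{real_inner,banach,second_countable_topology}) \<Rightarrow> bool"
  where "lipschitz_rhs \<tau> T k G \<longleftrightarrow> 0 \<le> k \<and>
    (\<forall>s\<in>{0..T}. \<forall>\<phi>\<in>hist_space \<tau>. \<forall>\<psi>\<in>hist_space \<tau>. \<forall>x y.
      norm (G s \<phi> x - G s \<psi> y) \<le> k * (norm (\<phi> - \<psi>) + norm (x - y))) \<and>
    (\<forall>a b. continuous_on {0..T} a \<longrightarrow> continuous_on {0..T} b \<longrightarrow> a ` {0..T} \<subseteq> hist_space \<tau> \<longrightarrow>
      continuous_on {0..T} (\<lambda>s. G s (a s) (b s)))"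

text \<open>A Gronwall constant, stated for any path driven by a forcing \<open>q\<close> of linear
  growth rather than for solutions. It thus applies to differences of solutions, to the linearised
  solution and to the linearisation error, with \<open>Q\<close> as the inhomogeneous part.\<close>

definition apriori_const ::
    "(real \<Rightarrow> 'x \<Rightarrow> 'x::{real_inner,banach,second_countable_topology}) \<Rightarrow> real \<Rightarrow> real \<Rightarrow> real \<Rightarrow> real \<Rightarrow> bool"
  where "apriori_const S \<tau> T k C \<longleftrightarrow> 1 \<le> C \<and>
    (\<forall>x q \<phi> h Q. continuous_on {0..T} x \<longrightarrow> continuous_on {0..T} q \<longrightarrow> \<phi> \<in> hist_space \<tau> \<longrightarrow> 0 \<le> Q \<longrightarrow>
      (\<forall>t\<in>{0..T}. x t = S t h + (LBINT s:{0..t}. S (t - s) (q s))) \<longrightarrow>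
      (\<forall>s\<in>{0..T}. norm (q s) \<le> k * (norm (Seg \<tau> \<phi> x s) + norm (x s)) + Q) \<longrightarrow>
      (\<forall>t\<in>{0..T}. norm (x t) \<le> C * (norm \<phi> + norm h + Q)))"

lemma apriori_constD:
  assumes "apriori_const S \<tau> T k C" "continuous_on {0..T} x" "continuous_on {0..T} q" "\<phi> \<in> hist_space \<tau>" "0 \<le> Q"
    "\<And>t. t \<in> {0..T} \<Longrightarrow> x t = S t h + (LBINT s:{0..t}. S (t - s) (q s))"
    "\<And>s. s \<in> {0..T} \<Longrightarrow> norm (q s) \<le> k * (norm (Seg \<tau> \<phi> x s) + norm (x s)) + Q" "t \<in> {0..T}"
  shows "norm (x t) \<le> C * (norm \<phi> + norm h + Q)"
  using assms unfolding apriori_const_def by blast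

lemma lipschitz_rhsD:
  "lipschitz_rhs \<tau> T k G \<Longrightarrow> s \<in> {0..T} \<Longrightarrow> \<phi> \<in> hist_space \<tau> \<Longrightarrow> \<psi> \<in> hist_space \<tau> \<Longrightarrow>
    norm (G s \<phi> x - G s \<psi> y) \<le> k * (norm (\<phi> - \<psi>) + norm (x - y))"
  by (simp add: lipschitz_rhs_def)

lemma volterra_solution_continuous: "volterra_solution S \<tau> G T p x \<Longrightarrow> continuous_on {0..T} x"
  by (simp add: volterra_solution_def)

lemma volterra_solution_eq:
  "volterra_solution S \<tau> G T p x \<Longrightarrow> t \<in> {0..T} \<Longrightarrow>
    x t = S t (snd p) + (LBINT s:{0..t}. S (t - s) (G s (Seg \<tau> (fst p) x s) (x s)))"
  by (simp add: volterra_solution_def)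

lemma volterra_solution_mono: "volterra_solution S \<tau> G T p x \<Longrightarrow> T' \<le> T \<Longrightarrow> volterra_solution S \<tau> G T' p x"
  by (auto simp: volterra_solution_def intro: continuous_on_subset)

context
  fixes S :: "real \<Rightarrow> 'x::{real_inner,banach,second_countable_topology} \<Rightarrow> 'x" and \<tau> :: real
  assumes S: "C0_semigroup S" and \<tau>: "0 \<le> \<tau>"
begin

lemma volterra_solution_cong:
  assumes "volterra_solution S \<tau> G T p x" "\<And>r. r \<in> {0..T} \<Longrightarrow> x r = y r"
  shows "volterra_solution S \<tau> G T p y"
proof -
  have cx: "continuous_on {0..T} x" using assms(1) by (rule volterra_solution_continuous)
  have "continuous_on {0..T} y"
    using cx by (subst continuous_on_cong[OF refl assms(2)[symmetric]]) auto
  moreover have "y t = S t (snd p) + (LBINT s:{0..t}. S (t - s) (G s (Seg \<tau> (fst p) y s) (y s)))"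
    if t: "t \<in> {0..T}" for t
  proof -
    have "y t = S t (snd p) + (LBINT s:{0..t}. S (t - s) (G s (Seg \<tau> (fst p) x s) (x s)))"
      using volterra_solution_eq[OF assms(1) t] assms(2)[OF t] by simp
    also have "(LBINT s:{0..t}. S (t - s) (G s (Seg \<tau> (fst p) x s) (x s)))
        = (LBINT s:{0..t}. S (t - s) (G s (Seg \<tau> (fst p) y s) (y s)))"
    proof (rule set_lebesgue_integral_cong, simp, intro allI impI)
      fix s assume "s \<in> {0..t}"
      then have s: "s \<in> {0..T}" using t by auto
      show "S (t - s) (G s (Seg \<tau> (fst p) x s) (x s)) = S (t - s) (G s (Seg \<tau> (fst p) y s) (y s))"
        using assms(2)[OF s] Seg_cong[OF \<tau> cx s, of y "fst p"] assms(2) by simp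
    qed
    finally show ?thesis .
  qed
  ultimately show ?thesis unfolding volterra_solution_def by blast
qed

lemma continuous_on_rhs:
  assumes G: "lipschitz_rhs \<tau> T k G" and x: "continuous_on {0..T} x"
  shows "continuous_on {0..T} (\<lambda>s. G s (Seg \<tau> \<phi> x s) (x s))"
proof -
  have "Seg \<tau> \<phi> x ` {0..T} \<subseteq> hist_space \<tau>"
    using Seg_in_hist_space[OF \<tau> x] by blast
  then show ?thesis
    using G x continuous_on_Seg[OF \<tau> x, of \<phi>] unfolding lipschitz_rhs_def by blast
qed

lemma convolution_diff:
  assumes "continuous_on {0..T} q1" "continuous_on {0..T} q2" "t \<in> {0..T}"
  shows "(LBINT s:{0..t}. S (t - s) (q1 s)) - (LBINT s:{0..t}. S (t - s) (q2 s))
    = (LBINT s:{0..t}. S (t - s) (q1 s - q2 s))"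
proof -
  have "(LBINT s:{0..t}. S (t - s) (q1 s)) - (LBINT s:{0..t}. S (t - s) (q2 s))
    = (LBINT s:{0..t}. S (t - s) (q1 s) - S (t - s) (q2 s))"
    using assms by (intro set_integral_diff(2)[symmetric] set_integrable_convolution[OF S, of T]) auto
  also have "\<dots> = (LBINT s:{0..t}. S (t - s) (q1 s - q2 s))"
    by (rule set_lebesgue_integral_cong)
       (auto simp: linear_simps(2)[OF semigroup_linear[OF S]])
  finally show ?thesis .
qed

text \<open>The delay term at time \<open>s\<close> is bounded by the history and by the maximum of
  \<open>norm (x r)\<close> over \<open>r \<le> s\<close>. An increasing exponential weight is
  compatible with that maximum, so a weighted maximum does the work of Gronwall's
  inequality.\<close>

lemma apriori_bound:
  assumes T: "0 \<le> T" and k: "0 \<le> k"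
  shows "\<exists>C. apriori_const S \<tau> T k C"
proof -
  obtain M where M: "1 \<le> M" "\<And>s x. s \<in> {0..T} \<Longrightarrow> norm (S s x) \<le> M * norm x"
    using semigroup_locally_bounded[OF S, of T] by blast
  \<comment> \<open>By \<open>norm_Seg_le\<close>, \<open>norm (q s)\<close> is at most
    \<open>k * norm \<phi> + Q\<close> plus \<open>a\<close> times the maximum of
    \<open>norm (x r)\<close> over \<open>r \<le> s\<close>.\<close>
  define a where "a = k * (1 + sqrt \<tau>)"
  have a: "0 \<le> a" using k \<tau> by (simp add: a_def)
  define c where "c = 2 * M * a + 1"
  have c: "0 < c" using a M by (simp add: c_def add_nonneg_pos)
  have ac: "M * (a / c) \<le> 1 / 2" using c by (simp add: c_def field_simps)
  \<comment> \<open>The 2 comes from absorbing half of the weighted maximum,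
    \<open>1 + T * (1 + k)\<close> from the initial data and the inhomogeneous part, the exponential
    from undoing the weight.\<close>
  define C where "C = 2 * M * (1 + T * (1 + k)) * exp (c * T)"
  show ?thesis
    unfolding apriori_const_def
  proof (intro exI[of _ C] conjI allI impI ballI)
    have "1 * 1 * 1 \<le> 2 * M * (1 + T * (1 + k)) * exp (c * T)"
      using M T k c by (intro mult_mono) auto
    then show "1 \<le> C" by (simp add: C_def)
    fix x q \<phi> h Q t
    assume x: "continuous_on {0..T} x" and q: "continuous_on {0..T} q" and \<phi>: "\<phi> \<in> hist_space \<tau>" and Q: "0 \<le> Q"
      and eq: "\<forall>t\<in>{0..T}. x t = S t h + (LBINT s:{0..t}. S (t - s) (q s))"
      and qb: "\<forall>s\<in>{0..T}. norm (q s) \<le> k * (norm (Seg \<tau> \<phi> x s) + norm (x s)) + Q"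
      and t: "t \<in> {0..T}"
    have "continuous_on {0..T} (\<lambda>t. exp (- c * t) * norm (x t))"
      by (intro continuous_intros x)
    then obtain t0 where t0: "t0 \<in> {0..T}"
      and max: "\<And>t. t \<in> {0..T} \<Longrightarrow> exp (- c * t) * norm (x t) \<le> exp (- c * t0) * norm (x t0)"
      using continuous_attains_sup[of "{0..T}" "\<lambda>t. exp (- c * t) * norm (x t)"] T by auto
    \<comment> \<open>For this \<open>c\<close> the convolution contributes at most half of the weighted maximum \<open>B\<close>.\<close>
    define B where "B = exp (- c * t0) * norm (x t0)"
    have B: "0 \<le> B" by (simp add: B_def)
    have xB: "norm (x t) \<le> B * exp (c * t)" if "t \<in> {0..T}" for t
    proof -
      have "exp (- c * t) * norm (x t) \<le> B" using max[OF that] by (simp only: B_def)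
      then have "exp (- c * t) * norm (x t) * exp (c * t) \<le> B * exp (c * t)"
        by (intro mult_right_mono) auto
      also have "exp (- c * t) * norm (x t) * exp (c * t) = (exp (- c * t) * exp (c * t)) * norm (x t)"
        by (simp only: ac_simps)
      also have "exp (- c * t) * exp (c * t) = 1" by (simp add: mult_exp_exp)
      finally show ?thesis by simp
    qed
    define d where "d = k * norm \<phi> + Q"
    have d: "0 \<le> d" using k Q by (simp add: d_def)
    have "norm (q s) \<le> (a * B) * exp (c * s) + d" if s: "s \<in> {0..T}" for s
    proof -
      have "norm (x r) \<le> B * exp (c * s)" if "r \<in> {0..s}" for r
      proof -
        have "norm (x r) \<le> B * exp (c * r)" using xB that s by auto
        also have "\<dots> \<le> B * exp (c * s)" using that c B by (intro mult_left_mono) auto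
        finally show ?thesis .
      qed
      then have "norm (Seg \<tau> \<phi> x s) \<le> norm \<phi> + sqrt \<tau> * (B * exp (c * s))"
        by (intro norm_Seg_le[OF \<tau> x s \<phi>])
      moreover have "norm (x s) \<le> B * exp (c * s)" by (rule xB[OF s])
      ultimately have "k * (norm (Seg \<tau> \<phi> x s) + norm (x s))
          \<le> k * (norm \<phi> + sqrt \<tau> * (B * exp (c * s)) + B * exp (c * s))"
        using k by (intro mult_left_mono) auto
      then show ?thesis using qb s unfolding a_def d_def by (fastforce simp: algebra_simps)
    qed
    then have conv: "norm (LBINT s:{0..t}. S (t - s) (q s)) \<le> M * ((a * B) / c * exp (c * t) + d * t)"
      if t: "t \<in> {0..T}" for t
    proof -
      assume qs: "\<And>s. s \<in> {0..T} \<Longrightarrow> norm (q s) \<le> (a * B) * exp (c * s) + d"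
      have "norm (LBINT s:{0..t}. S (t - s) (q s)) \<le> M * (LBINT s:{0..t}. (a * B) * exp (c * s) + d)"
        using M qs by (intro norm_convolution_le[OF S q t]) (auto intro!: continuous_intros)
      also have "\<dots> \<le> M * ((a * B) / c * exp (c * t) + d * t)"
        using M a B c t by (intro mult_left_mono integral_exp_linear_le) auto
      finally show ?thesis .
    qed
    have e1: "1 \<le> exp (c * t0)" using c t0 by simp
    have "B * exp (c * t0) = norm (x t0)" by (simp add: B_def exp_minus field_simps)
    also have "\<dots> \<le> norm (S t0 h) + norm (LBINT s:{0..t0}. S (t0 - s) (q s))"
      using eq t0 by (simp add: norm_triangle_ineq)
    also have "\<dots> \<le> M * norm h + M * ((a * B) / c * exp (c * t0) + d * t0)"
      by (intro add_mono M(2) conv t0)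
    also have "\<dots> \<le> M * norm h + (B * exp (c * t0) / 2 + M * (d * T))"
    proof -
      have "M * (a / c) * (B * exp (c * t0)) \<le> 1 / 2 * (B * exp (c * t0))"
        using B by (intro mult_right_mono ac) auto
      moreover have "M * (d * t0) \<le> M * (d * T)"
        using M(1) d t0 by (intro mult_left_mono) auto
      moreover have "M * ((a * B) / c * exp (c * t0) + d * t0) = M * (a / c) * (B * exp (c * t0)) + M * (d * t0)"
        by (simp add: algebra_simps)
      ultimately show ?thesis by linarith
    qed
    finally have "B * exp (c * t0) \<le> 2 * M * (norm h + d * T)" by (simp add: algebra_simps)
    moreover have "B * 1 \<le> B * exp (c * t0)" using B e1 by (intro mult_left_mono)
    ultimately have B2: "B \<le> 2 * M * (norm h + d * T)" by simp
    have "norm (x t) \<le> B * exp (c * t)" by (rule xB[OF t])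
    also have "\<dots> \<le> B * exp (c * T)" using B c t by (intro mult_left_mono) auto
    also have "\<dots> \<le> (2 * M * (norm h + d * T)) * exp (c * T)" using B2 by (intro mult_right_mono) auto
    also have "\<dots> \<le> (2 * M * ((1 + T * (1 + k)) * (norm \<phi> + norm h + Q))) * exp (c * T)"
    proof (intro mult_right_mono mult_left_mono)
      have "norm h + d * T = norm h + T * k * norm \<phi> + T * Q" by (simp add: d_def algebra_simps)
      also have "\<dots> \<le> (1 + T * (1 + k)) * (norm \<phi> + norm h + Q)"
      proof -
        have "0 \<le> norm \<phi> + Q + T * norm \<phi> + T * norm h + T * k * norm h + T * k * Q"
          using T k Q by simp
        then show ?thesis by (simp add: algebra_simps)
      qed
      finally show "norm h + d * T \<le> (1 + T * (1 + k)) * (norm \<phi> + norm h + Q)" .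
    qed (use M in auto)
    finally show "norm (x t) \<le> C * (norm \<phi> + norm h + Q)" by (simp add: C_def algebra_simps)
  qed
qed

text \<open>The difference of two solutions has zero initial data and no inhomogeneous part, so the
  a priori bound makes it vanish.\<close>

lemma volterra_solution_unique:
  assumes G: "lipschitz_rhs \<tau> T k G" and p: "fst p \<in> hist_space \<tau>"
    and x: "volterra_solution S \<tau> G T p x" and y: "volterra_solution S \<tau> G T p y" and t: "t \<in> {0..T}"
  shows "x t = y t"
proof -
  have T: "0 \<le> T" and k: "0 \<le> k" using t G by (auto simp: lipschitz_rhs_def)
  have cx: "continuous_on {0..T} x" and cy: "continuous_on {0..T} y"
    using x y by (auto intro: volterra_solution_continuous)
  obtain C where C: "apriori_const S \<tau> T k C"
    using apriori_bound[OF T k] by blast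
  let ?q = "\<lambda>s. G s (Seg \<tau> (fst p) x s) (x s) - G s (Seg \<tau> (fst p) y s) (y s)"
  have "norm (x t - y t) \<le> C * (norm (0 :: 'x L2) + norm (0 :: 'x) + 0)"
  proof (rule apriori_constD[OF C _ _ _ _ _ _ t])
    show "continuous_on {0..T} (\<lambda>t. x t - y t)" by (intro continuous_intros cx cy)
    show "continuous_on {0..T} ?q"
      by (intro continuous_on_diff continuous_on_rhs[OF G] cx cy)
    show "(0 :: 'x L2) \<in> hist_space \<tau>" by (rule subspace_0[OF subspace_hist_space])
  next
    fix t assume t: "t \<in> {0..T}"
    have "S t 0 = 0" using t linear_simps(3)[OF semigroup_linear[OF S, of t]] by simp
    then show "x t - y t = S t 0 + (LBINT s:{0..t}. S (t - s) (?q s))"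
      using convolution_diff[OF continuous_on_rhs[OF G cx, of "fst p"] continuous_on_rhs[OF G cy, of "fst p"] t]
        volterra_solution_eq[OF x t] volterra_solution_eq[OF y t]
      by simp
  next
    fix s assume s: "s \<in> {0..T}"
    have "Seg \<tau> 0 (\<lambda>t. x t - y t) s = Seg \<tau> (fst p) x s - Seg \<tau> (fst p) y s"
      using Seg_diff[OF \<tau> cx cy s, of "fst p" "fst p"] by simp
    then show "norm (?q s) \<le> k * (norm (Seg \<tau> 0 (\<lambda>t. x t - y t) s) + norm (x s - y s)) + 0"
      using lipschitz_rhsD[OF G s Seg_in_hist_space[OF \<tau> cx s] Seg_in_hist_space[OF \<tau> cy s]] by simp
  qed simp
  then show ?thesis by simp
qed

text \<open>In an exponentially weighted norm the Picard map contracts by 1/2 on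
  \<open>[0,T]\<close> for any \<open>T\<close>, so no short intervals have to be patched
  together.\<close>

lemma volterra_solution_exists:
  assumes G: "lipschitz_rhs \<tau> T k G" and p: "fst p \<in> hist_space \<tau>" and T: "0 \<le> T"
  shows "\<exists>x. volterra_solution S \<tau> G T p x"
proof -
  have k: "0 \<le> k" using G by (simp add: lipschitz_rhs_def)
  obtain M where M: "1 \<le> M" "\<And>s x. s \<in> {0..T} \<Longrightarrow> norm (S s x) \<le> M * norm x"
    using semigroup_locally_bounded[OF S, of T] by blast
  define a where "a = k * (1 + sqrt \<tau>)"
  have a: "0 \<le> a" using k \<tau> by (simp add: a_def)
  define c where "c = 2 * M * a + 1"
  have c: "0 < c" using a M by (simp add: c_def add_nonneg_pos)
  have ac: "M * (a / c) \<le> 1 / 2" using c by (simp add: c_def field_simps)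
  \<comment> \<open>\<open>y\<close> is the weighted path and \<open>X y\<close> the path itself, so
    the distance of bounded continuous functions is the weighted distance.\<close>
  define X where "X y = (\<lambda>t. exp (c * t) *\<^sub>R apply_bcontfun y t)" for y :: "real \<Rightarrow>\<^sub>C 'x"
  define q where "q y = (\<lambda>s. G s (Seg \<tau> (fst p) (X y) s) (X y s))" for y
  define N where "N y = (\<lambda>t. exp (- c * t) *\<^sub>R (S t (snd p) + (LBINT s:{0..t}. S (t - s) (q y s))))" for y
  have X: "continuous_on A (X y)" for y A
    unfolding X_def by (intro continuous_intros continuous_on_apply_bcontfun)
  have q: "continuous_on {0..T} (q y)" for y
    unfolding q_def by (rule continuous_on_rhs[OF G X])
  have N: "continuous_on {0..T} (N y)" for y
    unfolding N_def
  proof (intro continuous_intros)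
    show "continuous_on {0..T} (\<lambda>t. S t (snd p))"
      by (rule continuous_on_semigroup[OF S]) (auto intro!: continuous_intros)
    show "continuous_on {0..T} (\<lambda>t. LBINT s:{0..t}. S (t - s) (q y s))"
      by (rule continuous_on_convolution[OF S q])
  qed
  \<comment> \<open>Bounded continuous functions live on the whole line: \<open>N y\<close> is
    extended from \<open>[0,T]\<close> by clamping time, which preserves the contraction
    estimate.\<close>
  have cl: "clamp 0 T t \<in> {0..T}" for t
    using clamp_in_interval[of 0 T t] T by simp
  have "\<exists>g. (\<forall>t\<in>{0..T}. apply_bcontfun g t = N y t) \<and> (\<forall>t. apply_bcontfun g t = N y (clamp 0 T t))" for y
  proof -
    have "continuous_on (cbox 0 T) (N y)" using N by simp
    then obtain g where "\<And>x. x \<in> cbox 0 T \<Longrightarrow> apply_bcontfun g x = N y x"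
      "\<And>x. apply_bcontfun g x = N y (clamp 0 T x)"
      using continuous_on_cbox_bcontfunE by blast
    then show ?thesis by (metis cbox_interval)
  qed
  then obtain \<Gamma> where \<Gamma>: "\<And>y t. t \<in> {0..T} \<Longrightarrow> apply_bcontfun (\<Gamma> y) t = N y t"
    and \<Gamma>': "\<And>y t. apply_bcontfun (\<Gamma> y) t = N y (clamp 0 T t)" by metis
  have "dist (N y r) (N z r) \<le> 1 / 2 * dist y z" if r: "r \<in> {0..T}" for y z r
  proof -
    let ?D = "dist y z"
    have "norm (q y s - q z s) \<le> (a * ?D) * exp (c * s) + 0" if s: "s \<in> {0..T}" for s
    proof -
      have Xd: "norm (X y u - X z u) \<le> ?D * exp (c * s)" if "u \<in> {0..s}" for u
      proof -
        have "norm (X y u - X z u) = exp (c * u) * dist (apply_bcontfun y u) (apply_bcontfun z u)"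
          by (simp add: X_def scaleR_diff_right[symmetric] dist_norm)
        also have "\<dots> \<le> exp (c * s) * ?D"
          using that c by (intro mult_mono dist_bounded) auto
        finally show ?thesis by (simp add: mult.commute)
      qed
      have "norm (Seg \<tau> 0 (\<lambda>u. X y u - X z u) s) \<le> norm (0 :: 'x L2) + sqrt \<tau> * (?D * exp (c * s))"
        using Xd by (intro norm_Seg_le[OF \<tau> _ s] continuous_intros X subspace_0[OF subspace_hist_space])
      moreover have "Seg \<tau> 0 (\<lambda>u. X y u - X z u) s = Seg \<tau> (fst p) (X y) s - Seg \<tau> (fst p) (X z) s"
        using Seg_diff[OF \<tau> X[where A = "{0..T}"] X[where A = "{0..T}"] s, of "fst p" "fst p" y z] by simp
      moreover have "norm (q y s - q z s)
          \<le> k * (norm (Seg \<tau> (fst p) (X y) s - Seg \<tau> (fst p) (X z) s) + norm (X y s - X z s))"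
        using G s Seg_in_hist_space[OF \<tau> X s] unfolding lipschitz_rhs_def q_def by simp
      ultimately have "norm (q y s - q z s) \<le> k * (norm (Seg \<tau> 0 (\<lambda>u. X y u - X z u) s) + norm (X y s - X z s))"
        by simp
      also have "\<dots> \<le> k * (sqrt \<tau> * (?D * exp (c * s)) + ?D * exp (c * s))"
        using k Xd[of s] s \<open>norm (Seg \<tau> 0 (\<lambda>u. X y u - X z u) s) \<le> _\<close>
        by (intro mult_left_mono add_mono) auto
      finally show ?thesis by (simp add: a_def algebra_simps)
    qed
    then have "norm (LBINT s:{0..r}. S (r - s) (q y s - q z s)) \<le> M * (LBINT s:{0..r}. (a * ?D) * exp (c * s) + 0)"
      using M by (intro norm_convolution_le[OF S _ r] continuous_intros q) auto
    also have "\<dots> \<le> M * ((a * ?D) / c * exp (c * r) + 0 * r)"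
      using M a c r by (intro mult_left_mono integral_exp_linear_le) auto
    also have "\<dots> = M * (a / c) * (?D * exp (c * r))" by simp
    also have "\<dots> \<le> 1 / 2 * (?D * exp (c * r))" by (intro mult_right_mono ac) auto
    finally have le: "norm (LBINT s:{0..r}. S (r - s) (q y s - q z s)) \<le> 1 / 2 * ?D * exp (c * r)" by simp
    have "N y r - N z r = exp (- c * r) *\<^sub>R (LBINT s:{0..r}. S (r - s) (q y s - q z s))"
      unfolding N_def using convolution_diff[OF q q r, of y z] by (simp add: scaleR_diff_right[symmetric])
    then have "dist (N y r) (N z r) = exp (- c * r) * norm (LBINT s:{0..r}. S (r - s) (q y s - q z s))"
      by (simp add: dist_norm)
    also have "\<dots> \<le> exp (- c * r) * (1 / 2 * ?D * exp (c * r))"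
      using le by (intro mult_left_mono) auto
    also have "\<dots> = 1 / 2 * ?D" by (simp add: exp_minus field_simps)
    finally show ?thesis .
  qed
  note contr = this
  have "dist (\<Gamma> y) (\<Gamma> z) \<le> 1 / 2 * dist y z" for y z
  proof (rule dist_bound)
    fix t
    show "dist (apply_bcontfun (\<Gamma> y) t) (apply_bcontfun (\<Gamma> z) t) \<le> 1 / 2 * dist y z"
      unfolding \<Gamma>' by (rule contr[OF cl])
  qed
  then have "\<exists>!y. \<Gamma> y = y" by (intro banach_fix_type[of "1/2"]) auto
  then obtain y where y: "\<Gamma> y = y" by blast
  have "volterra_solution S \<tau> G T p (X y)"
    unfolding volterra_solution_def
  proof (intro conjI ballI X)
    fix t assume t: "t \<in> {0..T}"
    have "apply_bcontfun y t = N y t" using \<Gamma>[OF t, of y] y by simp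
    then have "X y t = exp (c * t) *\<^sub>R N y t" by (simp add: X_def)
    also have "\<dots> = S t (snd p) + (LBINT s:{0..t}. S (t - s) (q y s))"
      unfolding N_def by (simp add: exp_minus)
    finally show "X y t = S t (snd p) + (LBINT s:{0..t}. S (t - s) (G s (Seg \<tau> (fst p) (X y) s) (X y s)))"
      by (simp only: q_def)
  qed
  then show ?thesis by blast
qed

text \<open>Uniqueness makes solutions on different intervals agree, so the value at
  \<open>t\<close> may be read off from the solution on \<open>[0,t]\<close>.\<close>

lemma volterra_solution_global:
  assumes G: "\<And>T. 0 \<le> T \<Longrightarrow> lipschitz_rhs \<tau> T k G" and p: "fst p \<in> hist_space \<tau>"
  shows "\<exists>x. \<forall>T\<ge>0. volterra_solution S \<tau> G T p x"
proof -
  have "\<forall>T. \<exists>x. 0 \<le> T \<longrightarrow> volterra_solution S \<tau> G T p x"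
    using volterra_solution_exists[OF G p] by blast
  from choice[OF this] obtain X where X: "\<And>T. 0 \<le> T \<Longrightarrow> volterra_solution S \<tau> G T p (X T)" by blast
  have "volterra_solution S \<tau> G T p (\<lambda>t. X t t)" if T: "0 \<le> T" for T
  proof (rule volterra_solution_cong[OF X[OF T]])
    fix r assume r: "r \<in> {0..T}"
    have a: "volterra_solution S \<tau> G r p (X T)" by (rule volterra_solution_mono[OF X[OF T]]) (use r in auto)
    show "X T r = X r r"
      by (rule volterra_solution_unique[OF G p a X]) (use r in auto)
  qed
  then show ?thesis by blast
qed

end

section \<open>Shifts and the noise path\<close>

lemma wshift_wshift: "wshift s (wshift t \<omega>) = wshift (t + s) \<omega>"
  by (simp add: wshift_def fun_eq_iff add.commute add.left_commute)

lemma wshift_in_path_space: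
  assumes "\<omega> \<in> path_space"
  shows "wshift t \<omega> \<in> path_space"
proof -
  have c: "continuous_on UNIV \<omega>" using assms by (simp add: path_space_def)
  have "continuous_on UNIV (\<lambda>s. \<omega> (s + t))"
    by (rule continuous_on_compose2[OF c]) (auto intro!: continuous_intros)
  then show ?thesis by (auto simp: path_space_def wshift_def intro!: continuous_intros)
qed

section \<open>The compact-open topology and measurability of the shift\<close>

lemma topspace_compact_open: "topspace (compact_open :: (real \<Rightarrow> real ^ 'm) topology) = path_space"
proof -
  have "path_space \<in> {{\<omega> \<in> path_space. \<omega> ` K \<subseteq> U} |K (U :: (real ^ 'm) set). compact K \<and> open U}"
    by (intro CollectI exI[of _ "{}"] exI[of _ "UNIV"]) auto
  then show ?thesis unfolding compact_open_def topology_generated_by_topspace by blast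
qed

lemma openin_compact_open_basic:
  "compact K \<Longrightarrow> open U \<Longrightarrow> openin compact_open {\<omega> \<in> path_space. \<omega> ` K \<subseteq> U}"
  unfolding compact_open_def by (intro topology_generated_by_Basis) blast

text \<open>Uniform continuity on \<open>K\<close> lets finitely many subbasic conditions, one on
  each small piece of \<open>K\<close>, control the distance on all of \<open>K\<close>.\<close>

lemma compact_open_nhd:
  fixes \<omega>\<^sub>0 :: "real \<Rightarrow> real ^ 'm"
  assumes \<omega>\<^sub>0: "\<omega>\<^sub>0 \<in> path_space" and K: "compact K" and e: "0 < e"
  shows "\<exists>T. openin compact_open T \<and> \<omega>\<^sub>0 \<in> T \<and> (\<forall>\<omega>\<in>T. \<forall>r\<in>K. dist (\<omega> r) (\<omega>\<^sub>0 r) < e)"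
proof -
  have "continuous_on K \<omega>\<^sub>0" using \<omega>\<^sub>0 by (auto simp: path_space_def intro: continuous_on_subset)
  then have "uniformly_continuous_on K \<omega>\<^sub>0" using K by (rule compact_uniformly_continuous)
  then obtain d where d: "0 < d" "\<And>r s. r \<in> K \<Longrightarrow> s \<in> K \<Longrightarrow> dist s r < d \<Longrightarrow> dist (\<omega>\<^sub>0 s) (\<omega>\<^sub>0 r) < e / 2"
    unfolding uniformly_continuous_on_def using e by (metis half_gt_zero)
  obtain k where k: "k \<subseteq> K" "finite k" "K \<subseteq> (\<Union>x\<in>k. ball x (d / 2))"
  proof (rule compactE_image[OF K, of K "\<lambda>x. ball x (d / 2)"])
    show "K \<subseteq> (\<Union>x\<in>K. ball x (d / 2))" using d(1) by force
  qed auto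
  define N where "N x = {\<omega> \<in> path_space. \<omega> ` (K \<inter> cball x (d / 2)) \<subseteq> ball (\<omega>\<^sub>0 x) (e / 2)}" for x
  have N: "openin compact_open (N x)" for x
    unfolding N_def using K by (intro openin_compact_open_basic compact_Int_closed) auto
  \<comment> \<open>\<open>path_space\<close> keeps the family nonempty when \<open>K\<close> is
    empty.\<close>
  define T where "T = \<Inter>(insert path_space (N ` k))"
  have "openin compact_open T"
    unfolding T_def
  proof (rule openin_Inter)
    fix V assume "V \<in> insert path_space (N ` k)"
    then show "openin compact_open V"
      using N openin_topspace[of compact_open] by (auto simp: topspace_compact_open)
  qed (use k in auto)
  moreover have "\<omega>\<^sub>0 \<in> N x" if "x \<in> k" for x
  proof -
    have "dist (\<omega>\<^sub>0 x) (\<omega>\<^sub>0 r) < e / 2" if "r \<in> K" "dist x r \<le> d / 2" for r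
      using d that k(1) \<open>x \<in> k\<close> by (intro d(2)) auto
    then show ?thesis using \<omega>\<^sub>0 by (auto simp: N_def)
  qed
  then have "\<omega>\<^sub>0 \<in> T" using \<omega>\<^sub>0 by (simp add: T_def)
  moreover have "dist (\<omega> r) (\<omega>\<^sub>0 r) < e" if \<omega>: "\<omega> \<in> T" and r: "r \<in> K" for \<omega> r
  proof -
    obtain x where x: "x \<in> k" "dist x r < d / 2" using k(3) r by auto
    have "\<omega> \<in> N x" using \<omega> x(1) by (simp add: T_def)
    moreover have "r \<in> K \<inter> cball x (d / 2)" using r x(2) by simp
    ultimately have "\<omega> r \<in> ball (\<omega>\<^sub>0 x) (e / 2)" unfolding N_def by blast
    moreover have "dist (\<omega>\<^sub>0 x) (\<omega>\<^sub>0 r) < e / 2" using d(1) x r k(1) by (intro d(2)) auto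
    ultimately show ?thesis
      using dist_triangle[of "\<omega> r" "\<omega>\<^sub>0 r" "\<omega>\<^sub>0 x"] by (simp add: dist_commute)
  qed
  ultimately show ?thesis by blast
qed

text \<open>The shifted path at \<open>s\<close> uses the values at \<open>s + t\<close> and at
  \<open>t\<close>, so closeness on a shifted copy of \<open>K\<close> together with the point
  \<open>t\<close> is enough.\<close>

lemma continuous_map_wshift:
  "continuous_map compact_open (compact_open :: (real \<Rightarrow> real ^ 'm) topology) (wshift t)"
proof -
  let ?S = "{{\<omega> \<in> path_space. \<omega> ` K \<subseteq> U} |K (U :: (real ^ 'm) set). compact K \<and> open U}"
  have "continuous_map compact_open (topology_generated_by ?S) (wshift t :: (real \<Rightarrow> real ^ 'm) \<Rightarrow> _)"
  proof (rule continuous_on_generated_topo)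
    have "\<Union>?S = path_space"
      using topspace_compact_open unfolding compact_open_def topology_generated_by_topspace .
    then show "wshift t ` topspace compact_open \<subseteq> \<Union>?S"
      using wshift_in_path_space unfolding topspace_compact_open by blast
    fix V assume "V \<in> ?S"
    then obtain K and U :: "(real ^ 'm) set" where KU: "compact K" "open U" and V: "V = {\<omega> \<in> path_space. \<omega> ` K \<subseteq> U}"
      by blast
    show "openin compact_open (wshift t -` V \<inter> topspace compact_open)"
      unfolding openin_subopen[of _ "wshift t -` V \<inter> topspace compact_open"]
    proof
      fix \<omega>\<^sub>0 assume "\<omega>\<^sub>0 \<in> wshift t -` V \<inter> topspace compact_open"
      then have \<omega>\<^sub>0: "\<omega>\<^sub>0 \<in> path_space" and im: "wshift t \<omega>\<^sub>0 ` K \<subseteq> U"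
        by (auto simp: V topspace_compact_open)
      have "continuous_on UNIV (wshift t \<omega>\<^sub>0)"
        using wshift_in_path_space[OF \<omega>\<^sub>0] by (simp add: path_space_def)
      then have "compact (wshift t \<omega>\<^sub>0 ` K)"
        using KU(1) by (intro compact_continuous_image) (auto intro: continuous_on_subset)
      then obtain e where e: "0 < e" "\<forall>x\<in>wshift t \<omega>\<^sub>0 ` K. \<forall>y\<in>- U. e \<le> dist x y"
        using separate_compact_closed[of "wshift t \<omega>\<^sub>0 ` K" "- U"] KU(2) im by auto
      define K' where "K' = insert t ((\<lambda>s. s + t) ` K)"
      have "compact K'"
        unfolding K'_def using KU(1) by (intro compact_insert compact_continuous_image continuous_intros)
      then obtain T where T: "openin compact_open T" "\<omega>\<^sub>0 \<in> T" "\<forall>\<omega>\<in>T. \<forall>r\<in>K'. dist (\<omega> r) (\<omega>\<^sub>0 r) < e / 2"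
        using compact_open_nhd[OF \<omega>\<^sub>0, of K' "e / 2"] e by auto
      have "T \<subseteq> wshift t -` V \<inter> topspace compact_open"
      proof
        fix \<omega> assume \<omega>: "\<omega> \<in> T"
        then have p: "\<omega> \<in> path_space" using openin_subset[OF T(1)] by (auto simp: topspace_compact_open)
        have "wshift t \<omega> s \<in> U" if s: "s \<in> K" for s
        proof (rule ccontr)
          assume "wshift t \<omega> s \<notin> U"
          then have "e \<le> dist (wshift t \<omega>\<^sub>0 s) (wshift t \<omega> s)" using e(2) s by auto
          also have "\<dots> = norm ((\<omega>\<^sub>0 (s + t) - \<omega> (s + t)) - (\<omega>\<^sub>0 t - \<omega> t))"
            by (simp add: wshift_def dist_norm algebra_simps)
          also have "\<dots> \<le> dist (\<omega> (s + t)) (\<omega>\<^sub>0 (s + t)) + dist (\<omega> t) (\<omega>\<^sub>0 t)"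
            unfolding dist_norm by (metis norm_triangle_ineq4 norm_minus_commute)
          also have "\<dots> < e / 2 + e / 2"
            using T(3) \<omega> s by (intro add_strict_mono) (auto simp: K'_def)
          finally show False by simp
        qed
        then show "\<omega> \<in> wshift t -` V \<inter> topspace compact_open"
          using p wshift_in_path_space[OF p] by (auto simp: V topspace_compact_open)
      qed
      with T show "\<exists>T. openin compact_open T \<and> \<omega>\<^sub>0 \<in> T \<and> T \<subseteq> wshift t -` V \<inter> topspace compact_open"
        by blast
    qed
  qed
  then show ?thesis by (simp only: compact_open_def)
qed

lemma measurable_wshift: "wshift t \<in> measurable path_algebra (path_algebra :: (real \<Rightarrow> real ^ 'm) measure)"
proof -
  have sub: "{U. openin compact_open U} \<subseteq> Pow (path_space :: (real \<Rightarrow> real ^ 'm) set)"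
    using openin_subset topspace_compact_open by blast
  show ?thesis
    unfolding path_algebra_def
  proof (rule measurable_measure_of)
    show "wshift t \<in> space (sigma path_space {U. openin compact_open U}) \<rightarrow> (path_space :: (real \<Rightarrow> real ^ 'm) set)"
      using sub wshift_in_path_space by (auto simp: space_measure_of)
    fix V :: "(real \<Rightarrow> real ^ 'm) set" assume "V \<in> {U. openin compact_open U}"
    then have "openin compact_open (wshift t -` V \<inter> path_space)"
      using continuous_map_wshift[of t] unfolding continuous_map_alt topspace_compact_open by auto
    then show "wshift t -` V \<inter> space (sigma path_space {U. openin compact_open U})
        \<in> sets (sigma path_space {U. openin compact_open U})"
      using sub by (auto simp: space_measure_of)
  qed (rule sub)
qed

section \<open>Continuity of the noise along every path\<close>

lemma set_integrable_exp_atMost: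
  fixes \<mu> :: real
  assumes "0 < \<mu>"
  shows "set_integrable lborel {..0} (\<lambda>s. exp (\<mu> * s))"
proof -
  have lim: "((\<lambda>x. - (1 / \<mu>) * exp (- \<mu> * x)) \<longlongrightarrow> - (1 / \<mu>) * 0) at_top"
  proof (intro tendsto_intros)
    have "filterlim (\<lambda>x. \<mu> * x) at_top at_top"
      using assms by (intro filterlim_tendsto_pos_mult_at_top[OF tendsto_const]) (auto intro: filterlim_ident)
    then have "filterlim (\<lambda>x. - \<mu> * x) at_bot at_top" by (simp add: filterlim_uminus_at_top)
    then show "((\<lambda>x. exp (- \<mu> * x)) \<longlongrightarrow> 0) at_top"
      by (rule filterlim_compose[OF exp_at_bot])
  qed
  have "(\<integral>\<^sup>+x. ennreal (exp (- \<mu> * x)) * indicator {0..} x \<partial>lborel) = ennreal (0 - (- (1 / \<mu>) * exp (- \<mu> * 0)))"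
  proof (rule nn_integral_FTC_atLeast)
    show "DERIV (\<lambda>x. - (1 / \<mu>) * exp (- \<mu> * x)) x :> exp (- \<mu> * x)" for x
      using assms by (auto intro!: derivative_eq_intros)
  qed (use lim in auto)
  then have fin: "(\<integral>\<^sup>+x. ennreal (exp (- \<mu> * x)) * indicator {0..} x \<partial>lborel) < \<infinity>" by simp
  have "integrable lborel (\<lambda>x. indicator {0..} x *\<^sub>R exp (- \<mu> * x))"
  proof (rule integrableI_bounded)
    have "(\<integral>\<^sup>+x. ennreal (norm (indicator {0..} x *\<^sub>R exp (- \<mu> * x))) \<partial>lborel)
        = (\<integral>\<^sup>+x. ennreal (exp (- \<mu> * x)) * indicator {0..} x \<partial>lborel)"
      by (intro nn_integral_cong) (auto simp: indicator_def)
    then show "(\<integral>\<^sup>+x. ennreal (norm (indicator {0..} x *\<^sub>R exp (- \<mu> * x))) \<partial>lborel) < \<infinity>" using fin by simp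
  qed auto
  from lborel_integrable_real_affine[OF this, of "-1" 0]
  have "integrable lborel (\<lambda>x. indicator {0..} (- x) *\<^sub>R exp (\<mu> * x))" by simp
  also have "(\<lambda>x. indicator {0..} (- x) *\<^sub>R exp (\<mu> * x)) = (\<lambda>x. indicator {..0} x *\<^sub>R exp (\<mu> * x))"
    by (auto simp: fun_eq_iff indicator_def)
  finally show ?thesis by (simp add: set_integrable_def)
qed

lemma continuous_on_integral_atMost:
  fixes a :: "real \<Rightarrow> 'b::{banach,second_countable_topology}"
  assumes i: "\<And>t. set_integrable lborel {..t} a"
  shows "continuous_on UNIV (\<lambda>t. LBINT s:{..t}. a s)"
proof (rule continuous_on_sequentiallyI)
  fix u :: "nat \<Rightarrow> real" and t assume lim: "u \<longlonglongrightarrow> t"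
  obtain R where R: "\<And>n. u n \<le> R" using lim convergent_bounded_above by blast
  show "(\<lambda>n. LBINT s:{..u n}. a s) \<longlonglongrightarrow> (LBINT s:{..t}. a s)"
    unfolding set_lebesgue_integral_def
  proof (rule integral_dominated_convergence[where w = "\<lambda>s. norm (indicator {..R} s *\<^sub>R a s)"])
    show "(\<lambda>s. indicator {..t} s *\<^sub>R a s) \<in> borel_measurable lborel"
      "(\<lambda>s. indicator {..u n} s *\<^sub>R a s) \<in> borel_measurable lborel" for n
      using i unfolding set_integrable_def by (blast intro: borel_measurable_integrable)+
    show "integrable lborel (\<lambda>s. norm (indicator {..R} s *\<^sub>R a s))"
      using i unfolding set_integrable_def by (rule integrable_norm)
    show "AE s in lborel. (\<lambda>n. indicator {..u n} s *\<^sub>R a s) \<longlonglongrightarrow> indicator {..t} s *\<^sub>R a s"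
      using AE_lborel_singleton[of t]
    proof eventually_elim
      case (elim s)
      then consider "s < t" | "t < s" by fastforce
      then have "\<forall>\<^sub>F n in sequentially. indicator {..u n} s *\<^sub>R a s = indicator {..t} s *\<^sub>R a s"
      proof cases
        case 1
        with lim have "\<forall>\<^sub>F n in sequentially. s < u n" by (intro order_tendstoD(1)) auto
        then show ?thesis by eventually_elim (use 1 in auto)
      next
        case 2
        with lim have "\<forall>\<^sub>F n in sequentially. u n < s" by (intro order_tendstoD(2)) auto
        then show ?thesis by eventually_elim (use 2 in auto)
      qed
      then show ?case by (rule tendsto_eventually)
    qed
    show "AE s in lborel. norm (indicator {..u n} s *\<^sub>R a s) \<le> norm (indicator {..R} s *\<^sub>R a s)" for n
      using R[of n] by (intro AE_I2) (auto simp: indicator_def)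
  qed
qed

text \<open>Up to the factor \<open>- \<mu>\<close>, substitution gives
  \<open>exp (- \<mu> * t)\<close> times the integral of
  \<open>exp (\<mu> * s) * \<omega> s $ j\<close> over \<open>{..t}\<close>, minus a multiple of
  \<open>\<omega> t $ j\<close>; time enters through the upper limit. Continuity holds for each
  single path, so that the equation can be solved for each
  \<open>\<omega> \<in> path_space\<close>.\<close>

lemma continuous_OU_path:
  assumes \<omega>: "\<omega> \<in> path_space" and \<mu>: "0 < \<mu>"
  shows "continuous_on UNIV (\<lambda>t. OU \<mu> j (wshift t \<omega>))"
proof -
  define w where "w = (\<lambda>s. \<omega> s $ j)"
  have w: "continuous_on A w" for A
    unfolding w_def using \<omega> by (auto simp: path_space_def intro!: continuous_intros intro: continuous_on_subset)
  define a where "a = (\<lambda>s. exp (\<mu> * s) * w s)"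
  have a: "continuous_on A a" for A unfolding a_def by (intro continuous_intros w)
  have ie: "set_integrable lborel {..0} (\<lambda>s. exp (\<mu> * s))"
    by (rule set_integrable_exp_atMost[OF \<mu>])
  have tr: "(\<lambda>s. indicator {..0} s *\<^sub>R (exp (\<mu> * s) * w (s + t))) =
      (\<lambda>s. exp (- \<mu> * t) * (indicator {..t} (t + 1 * s) *\<^sub>R a (t + 1 * s)))" for t
  proof
    fix s
    have "exp (\<mu> * s) = exp (- \<mu> * t) * exp (\<mu> * (t + s))"
      by (simp add: mult_exp_exp algebra_simps)
    then show "indicator {..0} s *\<^sub>R (exp (\<mu> * s) * w (s + t)) =
      exp (- \<mu> * t) * (indicator {..t} (t + 1 * s) *\<^sub>R a (t + 1 * s))"
      by (auto simp: a_def indicator_def add.commute)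
  qed
  have iff: "set_integrable lborel {..0} (\<lambda>s. exp (\<mu> * s) * w (s + t)) \<longleftrightarrow> set_integrable lborel {..t} a" for t
    unfolding set_integrable_def tr
    using lborel_integrable_real_affine_iff[of 1 "\<lambda>s. indicator {..t} s *\<^sub>R a s" t] by simp
  have val: "(LBINT s:{..0}. exp (\<mu> * s) * w (s + t)) = exp (- \<mu> * t) * (LBINT s:{..t}. a s)" for t
    unfolding set_lebesgue_integral_def tr
    using lborel_integral_real_affine[of 1 "\<lambda>s. indicator {..t} s *\<^sub>R a s" t] by simp
  have ex: "set_integrable lborel {..t'} a" if "set_integrable lborel {..t} a" for t t'
  proof -
    have "set_integrable lborel ({..t} \<union> {t..max t t'}) a"
      by (intro set_integrable_Un that borel_integrable_atLeastAtMost' a) auto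
    then show ?thesis by (rule set_integrable_subset) auto
  qed
  have OU: "OU \<mu> j (wshift t \<omega>) = - \<mu> * (LBINT s:{..0}. exp (\<mu> * s) * (w (s + t) - w t))" for t
    by (simp add: OU_def wshift_def w_def)
  \<comment> \<open>If the integral diverges for one shift of the path, it diverges for all of them, and the
    value is \<open>0\<close> throughout.\<close>
  show ?thesis
  proof (cases "set_integrable lborel {..0} a")
    case True
    have "OU \<mu> j (wshift t \<omega>)
        = - \<mu> * (exp (- \<mu> * t) * (LBINT s:{..t}. a s) - w t * (LBINT s:{..0}. exp (\<mu> * s)))" for t
    proof -
      have i: "set_integrable lborel {..0} (\<lambda>s. exp (\<mu> * s) * w (s + t))"
        using iff ex[OF True] by blast
      have "(LBINT s:{..0}. exp (\<mu> * s) * (w (s + t) - w t))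
          = (LBINT s:{..0}. exp (\<mu> * s) * w (s + t) - w t * exp (\<mu> * s))"
        by (simp add: algebra_simps)
      also have "\<dots> = (LBINT s:{..0}. exp (\<mu> * s) * w (s + t)) - (LBINT s:{..0}. w t * exp (\<mu> * s))"
        by (intro set_integral_diff i set_integrable_mult_right ie)
      finally show ?thesis unfolding OU by (simp add: val)
    qed
    moreover have "continuous_on UNIV (\<lambda>t. - \<mu> * (exp (- \<mu> * t) * (LBINT s:{..t}. a s) - w t * (LBINT s:{..0}. exp (\<mu> * s))))"
      by (intro continuous_intros w continuous_on_integral_atMost ex[OF True])
    ultimately show ?thesis by simp
  next
    case False
    have "OU \<mu> j (wshift t \<omega>) = 0" for t
    proof -
      have "\<not> set_integrable lborel {..0} (\<lambda>s. exp (\<mu> * s) * (w (s + t) - w t))"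
      proof
        assume "set_integrable lborel {..0} (\<lambda>s. exp (\<mu> * s) * (w (s + t) - w t))"
        then have "set_integrable lborel {..0} (\<lambda>s. exp (\<mu> * s) * (w (s + t) - w t) + w t * exp (\<mu> * s))"
          by (intro set_integral_add set_integrable_mult_right ie)
        then have "set_integrable lborel {..0} (\<lambda>s. exp (\<mu> * s) * w (s + t))"
          by (simp add: algebra_simps)
        then have "set_integrable lborel {..t} a" using iff by blast
        then show False using ex False by blast
      qed
      then show ?thesis
        unfolding OU set_integrable_def set_lebesgue_integral_def by (simp add: not_integrable_integral_eq)
    qed
    then show ?thesis by simp
  qed
qed

lemma continuous_noise_path:
  fixes g :: "'m::finite \<Rightarrow> 'x::real_normed_vector"
  assumes "\<omega> \<in> path_space" "0 < \<mu>"
  shows "continuous_on UNIV (noise_path \<mu> g \<omega>)"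
  unfolding noise_path_def noise_def
  by (intro continuous_on_sum continuous_on_scaleR continuous_OU_path[OF assms] continuous_on_const)

lemma linear_operator_sum:
  assumes "linear_operator D T" "finite I" "\<And>i. i \<in> I \<Longrightarrow> g i \<in> D"
  shows "(\<Sum>i\<in>I. c i *\<^sub>R g i) \<in> D \<and> T (\<Sum>i\<in>I. c i *\<^sub>R g i) = (\<Sum>i\<in>I. c i *\<^sub>R T (g i))"
  using assms(2,3)
proof induction
  case empty
  have "subspace D" using assms(1) by (simp add: linear_operator_def)
  then have "0 \<in> D" by (rule subspace_0)
  moreover have "T (0 *\<^sub>R 0) = 0 *\<^sub>R T 0" using assms(1) \<open>0 \<in> D\<close> unfolding linear_operator_def by blast
  ultimately show ?case by simp
next
  case (insert i I)
  have D: "subspace D" using assms(1) by (simp add: linear_operator_def)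
  have "c i *\<^sub>R g i \<in> D" using insert D by (simp add: subspace_scale)
  then show ?case using insert assms(1) D unfolding linear_operator_def
    by (simp add: subspace_add)
qed

lemma continuous_operator_noise_path:
  fixes g :: "'m::finite \<Rightarrow> 'x::real_normed_vector"
  assumes "\<omega> \<in> path_space" "0 < \<mu>" "linear_operator D A" "\<And>j. g j \<in> D"
  shows "continuous_on UNIV (\<lambda>t. A (noise_path \<mu> g \<omega> t))"
proof -
  have "A (noise_path \<mu> g \<omega> t) = (\<Sum>j\<in>UNIV. OU \<mu> j (wshift t \<omega>) *\<^sub>R A (g j))" for t
    unfolding noise_path_def noise_def using linear_operator_sum[OF assms(3), of UNIV g] assms(4) by simp
  then show ?thesis
    by (simp only:) (intro continuous_on_sum continuous_on_scaleR continuous_OU_path[OF assms(1,2)] continuous_on_const)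
qed

text \<open>The history part of the noise state at \<open>wshift t \<omega>\<close> is the noise
  segment in the equation at time \<open>t\<close>. Hence the first component of \<open>Psi\<close>
  at time \<open>t\<close> is the argument of \<open>f\<close> at that time.\<close>

lemma seg_noise_path_wshift:
  "seg \<tau> (noise_path \<mu> g (wshift t \<omega>)) 0 = seg \<tau> (noise_path \<mu> g \<omega>) t"
  unfolding seg_def noise_path_def wshift_wshift by (simp only: add_0)

lemma l2_upto_continuous:
  assumes "continuous_on UNIV v"
  shows "l2_upto \<tau> T v"
  unfolding l2_upto_def by (rule l2_fun_continuous[OF continuous_on_subset[OF assms]]) simp

section \<open>Quadratic remainders and measurable lower bounds\<close>

text \<open>Taking \<open>1 / r\<close> as the bound on the ball of radius \<open>r\<close> controls radius and bound by a single
  number and makes the supremum 1-Lipschitz in the centre.\<close>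

definition reg_radii :: "'a::real_normed_vector set \<Rightarrow> ('a \<Rightarrow> 'c::real_normed_vector) \<Rightarrow> 'a \<Rightarrow> real set"
  where "reg_radii V F x = {r. 0 < r \<and> r \<le> 1 \<and> (\<forall>y\<in>V. dist x y < r \<longrightarrow> norm (F y) \<le> 1 / r)}"

definition reg_radius :: "'a::real_normed_vector set \<Rightarrow> ('a \<Rightarrow> 'c::real_normed_vector) \<Rightarrow> 'a \<Rightarrow> real"
  where "reg_radius V F x = Sup (reg_radii V F x)"

context
  fixes V :: "'a::real_normed_vector set" and F :: "'a \<Rightarrow> 'c::real_normed_vector"
  assumes F: "continuous_on V F"
begin

text \<open>Continuity keeps the norm below \<open>norm (F x) + 1\<close> on a small ball; shrinking
  the radius below the reciprocal of this number makes \<open>1 / r\<close> an upper bound.\<close>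

lemma reg_radii_nonempty:
  assumes "x \<in> V"
  shows "reg_radii V F x \<noteq> {}"
proof -
  obtain d where d: "0 < d" "\<And>y. y \<in> V \<Longrightarrow> dist y x < d \<Longrightarrow> dist (F y) (F x) < 1"
    using F assms unfolding continuous_on_iff by (metis zero_less_one)
  define r where "r = min d (1 / (norm (F x) + 1))"
  have r: "0 < r" "r \<le> d" "r \<le> 1 / (norm (F x) + 1)"
    using d(1) by (auto simp: r_def add_nonneg_pos)
  have "r \<le> 1" by (rule order_trans[OF r(3)]) (simp add: divide_le_eq add_nonneg_pos)
  moreover have "norm (F y) \<le> 1 / r" if y: "y \<in> V" "dist x y < r" for y
  proof -
    have "dist (F y) (F x) < 1" using y r(2) by (intro d(2)) (auto simp: dist_commute)
    then have "norm (F y) \<le> norm (F x) + 1"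
      using norm_triangle_ineq2[of "F y" "F x"] by (simp add: dist_norm)
    also have "\<dots> = 1 / (1 / (norm (F x) + 1))" by simp
    also have "\<dots> \<le> 1 / r" using r by (intro divide_left_mono) (auto simp: add_nonneg_pos)
    finally show ?thesis .
  qed
  ultimately have "r \<in> reg_radii V F x" using r(1) by (auto simp: reg_radii_def)
  then show ?thesis by blast
qed

lemma bdd_above_reg_radii: "bdd_above (reg_radii V F x)"
  by (rule bdd_aboveI[of _ 1]) (auto simp: reg_radii_def)

lemma reg_radius_pos: "x \<in> V \<Longrightarrow> 0 < reg_radius V F x"
proof -
  assume "x \<in> V"
  then obtain r where r: "r \<in> reg_radii V F x" using reg_radii_nonempty by blast
  then have "0 < r" by (simp add: reg_radii_def)
  also have "r \<le> reg_radius V F x"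
    unfolding reg_radius_def by (rule cSup_upper[OF r bdd_above_reg_radii])
  finally show ?thesis .
qed

lemma reg_radius_le_1: "x \<in> V \<Longrightarrow> reg_radius V F x \<le> 1"
  unfolding reg_radius_def by (rule cSup_least[OF reg_radii_nonempty]) (auto simp: reg_radii_def)

text \<open>The supremum inherits the bound: were \<open>norm (F y)\<close> larger, some admissible
  \<open>r\<close> would exceed both \<open>dist x y\<close> and \<open>1 / norm (F y)\<close>,
  contradicting \<open>norm (F y) \<le> 1 / r\<close>.\<close>

lemma norm_le_reg_radius:
  assumes x: "x \<in> V" and y: "y \<in> V" and d: "dist x y < reg_radius V F x"
  shows "norm (F y) \<le> 1 / reg_radius V F x"
proof (rule ccontr)
  assume neg: "\<not> norm (F y) \<le> 1 / reg_radius V F x"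
  have pos: "0 < reg_radius V F x" by (rule reg_radius_pos[OF x])
  then have "0 < 1 / reg_radius V F x" by simp
  with neg have n: "0 < norm (F y)" "1 / reg_radius V F x < norm (F y)" by linarith+
  then have "1 / norm (F y) < reg_radius V F x" using pos by (simp add: field_simps)
  with d have "max (dist x y) (1 / norm (F y)) < reg_radius V F x" by simp
  then obtain r where r: "r \<in> reg_radii V F x" "max (dist x y) (1 / norm (F y)) < r"
    unfolding reg_radius_def using less_cSup_iff[OF reg_radii_nonempty[OF x] bdd_above_reg_radii] by blast
  then have "norm (F y) \<le> 1 / r" "0 < r" using y by (auto simp: reg_radii_def)
  moreover have "1 / norm (F y) < r" using r(2) by simp
  ultimately show False using n(1) by (simp add: field_simps)
qed

text \<open>An admissible ball around \<open>x\<close> contains the ball around \<open>y\<close>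
  whose radius is smaller by \<open>dist x y\<close>, and for the smaller radius the required bound
  is weaker.\<close>

lemma reg_radius_lipschitz:
  assumes x: "x \<in> V" and y: "y \<in> V"
  shows "reg_radius V F x \<le> reg_radius V F y + dist x y"
  unfolding reg_radius_def[of V F x]
proof (rule cSup_least[OF reg_radii_nonempty[OF x]])
  fix r assume r: "r \<in> reg_radii V F x"
  show "r \<le> reg_radius V F y + dist x y"
  proof (cases "r \<le> dist x y")
    case True
    then show ?thesis using reg_radius_pos[OF y] by simp
  next
    case False
    have "r - dist x y \<in> reg_radii V F y"
      unfolding reg_radii_def
    proof (intro CollectI conjI ballI impI)
      show "0 < r - dist x y" using False by simp
      have "r \<le> 1" using r by (simp add: reg_radii_def)
      then show "r - dist x y \<le> 1" using zero_le_dist[of x y] by linarith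
      fix z assume z: "z \<in> V" "dist y z < r - dist x y"
      then have "dist x z < r" using dist_triangle[of x z y] by simp
      then have "norm (F z) \<le> 1 / r" using r z by (simp add: reg_radii_def)
      also have "\<dots> \<le> 1 / (r - dist x y)" using False r by (intro divide_left_mono) (auto simp: reg_radii_def intro!: mult_pos_pos)
      finally show "norm (F z) \<le> 1 / (r - dist x y)" .
    qed
    then have "r - dist x y \<le> reg_radius V F y"
      unfolding reg_radius_def by (rule cSup_upper[OF _ bdd_above_reg_radii])
    then show ?thesis by simp
  qed
qed

lemma continuous_on_reg_radius: "continuous_on V (reg_radius V F)"
  unfolding continuous_on_iff
proof (intro ballI allI impI)
  fix x and e :: real assume x: "x \<in> V" and e: "0 < e"
  have "dist (reg_radius V F y) (reg_radius V F x) < e" if "y \<in> V" "dist y x < e" for y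
    using reg_radius_lipschitz[OF x that(1)] reg_radius_lipschitz[OF that(1) x] that(2)
    by (simp add: dist_real_def dist_commute)
  then show "\<exists>d>0. \<forall>y\<in>V. dist y x < d \<longrightarrow> dist (reg_radius V F y) (reg_radius V F x) < e"
    using e by blast
qed

end

text \<open>Difference quotients along a ray from \<open>a\<close> inside \<open>V\<close>. A
  derivative within \<open>V\<close> is determined only on \<open>V\<close>, hence the condition on
  \<open>d\<close>.\<close>

lemma norm_derivative_le_lipschitz:
  assumes V: "subspace V" and f': "(f has_derivative f') (at a within V)"
    and lip: "\<And>x y. x \<in> V \<Longrightarrow> y \<in> V \<Longrightarrow> norm (f x - f y) \<le> l * norm (x - y)"
    and a: "a \<in> V" and d: "d \<in> V"
  shows "norm (f' d) \<le> l * norm d"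
proof (cases "d = 0")
  case True
  then show ?thesis using has_derivative_bounded_linear[OF f'] by (simp add: linear_simps(3))
next
  case False
  note lin = has_derivative_bounded_linear[OF f']
  have "norm (f' d) \<le> (l + e) * norm d" if e: "0 < e" for e
  proof -
    obtain r where r: "0 < r" "\<And>y. y \<in> V \<Longrightarrow> norm (y - a) < r \<Longrightarrow> norm (f y - f a - f' (y - a)) \<le> e * norm (y - a)"
      using f' e unfolding has_derivative_within_alt by blast
    define t where "t = r / (2 * norm d)"
    have t: "0 < t" "t * norm d < r" using r(1) False by (auto simp: t_def)
    have y: "a + t *\<^sub>R d \<in> V" using V a d by (simp add: subspace_add subspace_scale)
    have "norm (f (a + t *\<^sub>R d) - f a - f' (t *\<^sub>R d)) \<le> e * (t * norm d)"
      using r(2)[OF y] t by simp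
    moreover have "norm (f (a + t *\<^sub>R d) - f a) \<le> l * (t * norm d)"
      using lip[OF y a] t by simp
    ultimately have "norm (f' (t *\<^sub>R d)) \<le> l * (t * norm d) + e * (t * norm d)"
      using norm_triangle_sub[of "f' (t *\<^sub>R d)" "f (a + t *\<^sub>R d) - f a"]
      by (simp add: norm_minus_commute)
    moreover have "norm (f' (t *\<^sub>R d)) = t * norm (f' d)"
      using t linear_simps(5)[OF lin] by simp
    ultimately have "t * norm (f' d) \<le> t * ((l + e) * norm d)" by (simp add: algebra_simps)
    then show ?thesis using t(1) by simp
  qed
  note le = this
  show ?thesis
  proof (rule field_le_epsilon)
    fix e :: real assume "0 < e"
    then have "norm (f' d) \<le> (l + e / norm d) * norm d" using False by (intro le) simp
    also have "\<dots> = l * norm d + e" using False by (simp add: field_simps)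
    finally show "norm (f' d) \<le> l * norm d + e" .
  qed
qed

text \<open>With \<open>\<rho>\<close> the radius at \<open>a\<close>: for
  \<open>norm d < \<rho>\<close> the mean value inequality is applied to \<open>f'\<close>, with the
  bound \<open>1 / \<rho>\<close> on \<open>f''\<close>, and then to \<open>f - f' a\<close>.
  Otherwise the linear bound \<open>2 * l * norm d\<close> becomes quadratic because
  \<open>norm d \<ge> \<rho>\<close>. The factor \<open>1 + 2 * l\<close> covers both cases.\<close>

lemma taylor_remainder_le:
  fixes f :: "'a::real_normed_vector \<Rightarrow> 'b::real_normed_vector"
    and f' :: "'a \<Rightarrow> 'a \<Rightarrow>\<^sub>L 'b" and f'' :: "'a \<Rightarrow> 'a \<Rightarrow>\<^sub>L 'a \<Rightarrow>\<^sub>L 'b"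
  assumes V: "subspace V"
    and f': "\<And>x. x \<in> V \<Longrightarrow> (f has_derivative blinfun_apply (f' x)) (at x within V)"
    and f'': "\<And>x. x \<in> V \<Longrightarrow> (f' has_derivative blinfun_apply (f'' x)) (at x within V)"
    and cont: "continuous_on V f''"
    and lip: "\<And>x y. x \<in> V \<Longrightarrow> y \<in> V \<Longrightarrow> norm (f x - f y) \<le> l * norm (x - y)"
    and l: "0 \<le> l" and a: "a \<in> V" and d: "d \<in> V"
  shows "norm (f (a + d) - f a - f' a d) \<le> (1 + 2 * l) / reg_radius V f'' a * (norm d)\<^sup>2"
proof -
  define \<rho> where "\<rho> = reg_radius V f'' a"
  have \<rho>: "0 < \<rho>" unfolding \<rho>_def by (rule reg_radius_pos[OF cont a])
  have ad: "a + d \<in> V" using V a d by (rule subspace_add)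
  show ?thesis
  proof (cases "norm d < \<rho>")
    case True
    define W where "W = V \<inter> cball a (norm d)"
    have W: "convex W" unfolding W_def using V by (intro convex_Int subspace_imp_convex convex_cball)
    have aW: "a \<in> W" and adW: "a + d \<in> W" using a ad by (auto simp: W_def dist_norm)
    have f'_lip: "norm (f' x - f' a) \<le> 1 / \<rho> * norm (x - a)" if x: "x \<in> W" for x
    proof (rule differentiable_bound[OF W _ _ x aW])
      fix y assume y: "y \<in> W"
      show "(f' has_derivative blinfun_apply (f'' y)) (at y within W)"
        by (rule has_derivative_subset[OF f'']) (use y in \<open>auto simp: W_def\<close>)
      have "norm (f'' y) \<le> 1 / \<rho>"
        unfolding \<rho>_def using y True by (intro norm_le_reg_radius[OF cont a]) (auto simp: W_def \<rho>_def)
      then show "onorm (blinfun_apply (f'' y)) \<le> 1 / \<rho>" by (simp add: norm_blinfun.rep_eq)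
    qed
    have "norm ((f (a + d) - f' a (a + d)) - (f a - f' a a)) \<le> (1 / \<rho> * norm d) * norm (a + d - a)"
    proof (rule differentiable_bound[OF W _ _ adW aW])
      fix x assume x: "x \<in> W"
      have "((\<lambda>x. f x - f' a x) has_derivative (\<lambda>h. f' x h - f' a h)) (at x within V)"
        using x by (intro has_derivative_diff f' bounded_linear_imp_has_derivative[OF blinfun.bounded_linear_right]) (auto simp: W_def)
      then have "((\<lambda>x. f x - f' a x) has_derivative (\<lambda>h. f' x h - f' a h)) (at x within W)"
        by (rule has_derivative_subset) (auto simp: W_def)
      then show "((\<lambda>x. f x - f' a x) has_derivative blinfun_apply (f' x - f' a)) (at x within W)"
        by (simp add: blinfun.diff_left[abs_def] minus_blinfun.rep_eq)
      have "norm (f' x - f' a) \<le> 1 / \<rho> * norm (x - a)" by (rule f'_lip[OF x])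
      also have "\<dots> \<le> 1 / \<rho> * norm d"
        using x \<rho> by (intro mult_left_mono) (auto simp: W_def dist_norm norm_minus_commute)
      finally show "onorm (blinfun_apply (f' x - f' a)) \<le> 1 / \<rho> * norm d" by (simp add: norm_blinfun.rep_eq)
    qed
    then have "norm (f (a + d) - f a - f' a d) \<le> 1 / \<rho> * (norm d)\<^sup>2"
      by (simp add: blinfun.add_right algebra_simps power2_eq_square)
    also have "\<dots> \<le> (1 + 2 * l) / \<rho> * (norm d)\<^sup>2"
      using \<rho> l by (intro mult_right_mono divide_right_mono) auto
    finally show ?thesis by (simp add: \<rho>_def)
  next
    case False
    have "norm (f (a + d) - f a) \<le> l * norm d" using lip[OF ad a] by simp
    moreover have "norm (f' a d) \<le> l * norm d"
      by (rule norm_derivative_le_lipschitz[OF V f'[OF a] lip a d])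
    ultimately have "norm (f (a + d) - f a - f' a d) \<le> 2 * l * norm d"
      using norm_triangle_ineq4[of "f (a + d) - f a" "f' a d"] by simp
    also have "\<dots> \<le> (1 + 2 * l) * norm d" by (intro mult_right_mono) auto
    also have "\<dots> = (1 + 2 * l) / \<rho> * (norm d * \<rho>)" using \<rho> by simp
    also have "\<dots> \<le> (1 + 2 * l) / \<rho> * (norm d * norm d)"
      using False \<rho> l by (intro mult_left_mono) auto
    finally show ?thesis by (simp add: \<rho>_def power2_eq_square)
  qed
qed

text \<open>Together with the next lemma: the infimum of a 1-Lipschitz function over \<open>B\<close>, expressed by
  the distances to \<open>B\<close> from a countable dense set, which are measurable for a random set \<open>B\<close>.\<close>

lemma INF_add_set_dist_le:
  fixes \<rho> :: "'h::metric_space \<Rightarrow> real"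
  assumes lip: "\<And>x y. x \<in> H \<Longrightarrow> y \<in> H \<Longrightarrow> \<rho> x \<le> \<rho> y + dist x y" and pos: "\<And>x. x \<in> H \<Longrightarrow> 0 \<le> \<rho> x"
    and D: "D \<subseteq> H" "H \<subseteq> closure D" and u: "u \<in> B" "u \<in> H"
  shows "(INF d\<in>D. ennreal (\<rho> d) + set_dist d B) \<le> ennreal (\<rho> u)"
proof (rule ennreal_le_epsilon)
  fix e :: real assume e: "0 < e"
  then have "0 < e / 2" by simp
  then obtain d where d: "d \<in> D" "dist d u < e / 2"
    using D(2) u(2) unfolding closure_approachable subset_eq by blast
  have "(INF d\<in>D. ennreal (\<rho> d) + set_dist d B) \<le> ennreal (\<rho> d) + set_dist d B"
    using d(1) by (rule INF_lower)
  also have "set_dist d B \<le> ennreal (dist d u)"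
    unfolding set_dist_def using u(1) by (rule INF_lower)
  also have "ennreal (\<rho> d) + ennreal (dist d u) = ennreal (\<rho> d + dist d u)"
    using pos d D(1) by (simp add: ennreal_plus subsetD)
  also have "\<dots> \<le> ennreal (\<rho> u + e)"
    using lip[of d u] d D(1) u(2) by (intro ennreal_leI) auto
  also have "\<dots> = ennreal (\<rho> u) + ennreal e" using pos u(2) e by (simp add: ennreal_plus)
  finally show "(INF d\<in>D. ennreal (\<rho> d) + set_dist d B) \<le> ennreal (\<rho> u) + ennreal e"
    by (simp add: add_mono)
qed

lemma le_INF_add_set_dist:
  fixes \<rho> :: "'h::metric_space \<Rightarrow> real"
  assumes lip: "\<And>x y. x \<in> H \<Longrightarrow> y \<in> H \<Longrightarrow> \<rho> x \<le> \<rho> y + dist x y" and pos: "\<And>x. x \<in> H \<Longrightarrow> 0 \<le> \<rho> x"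
    and D: "D \<subseteq> H" and B: "B \<subseteq> H" "\<And>u. u \<in> B \<Longrightarrow> m \<le> \<rho> u"
  shows "ennreal m \<le> (INF d\<in>D. ennreal (\<rho> d) + set_dist d B)"
proof (rule INF_greatest)
  fix d assume d: "d \<in> D"
  have "ennreal (m - \<rho> d) \<le> set_dist d B"
    unfolding set_dist_def
  proof (rule INF_greatest)
    fix y assume y: "y \<in> B"
    then have "m \<le> \<rho> d + dist d y" using B lip[of y d] d D by (fastforce simp: dist_commute)
    then show "ennreal (m - \<rho> d) \<le> ennreal (dist d y)" by (intro ennreal_leI) simp
  qed
  then have "ennreal (\<rho> d) + ennreal (m - \<rho> d) \<le> ennreal (\<rho> d) + set_dist d B"
    by (rule add_left_mono)
  moreover have "ennreal m \<le> ennreal (\<rho> d) + ennreal (m - \<rho> d)"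
  proof (cases "m \<le> \<rho> d")
    case True
    then have "ennreal m \<le> ennreal (\<rho> d)" by (rule ennreal_leI)
    then show ?thesis using True by (simp add: ennreal_neg)
  next
    case False
    then show ?thesis using pos d D by (simp add: ennreal_plus[symmetric] subsetD del: ennreal_plus)
  qed
  ultimately show "ennreal m \<le> ennreal (\<rho> d) + set_dist d B" by (rule order_trans[rotated])
qed

section \<open>Countable sets of times and of states\<close>

lemma le_on_unit_interval_if_le_on_Rats:
  fixes h :: "real \<Rightarrow> real"
  assumes h: "continuous_on {0..1} h" and le: "\<And>r. r \<in> \<rat> \<Longrightarrow> r \<in> {0..1} \<Longrightarrow> m \<le> h r" and t: "t \<in> {0..1}"
  shows "m \<le> h t"
proof (rule ccontr)
  assume "\<not> m \<le> h t"
  then have "0 < m - h t" by simp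
  then obtain d where d: "0 < d" "\<And>r. r \<in> {0..1} \<Longrightarrow> dist r t < d \<Longrightarrow> dist (h r) (h t) < m - h t"
    using h t unfolding continuous_on_iff by meson
  obtain r where r: "r \<in> \<rat>" "max 0 (t - d) < r" "r < min 1 (t + d)"
    using Rats_dense_in_real[of "max 0 (t - d)" "min 1 (t + d)"] d(1) t by auto
  then have "r \<in> {0..1}" "dist r t < d" by (auto simp: dist_real_def)
  then have "dist (h r) (h t) < m - h t" "m \<le> h r" using d(2) le r(1) by auto
  then show False by (simp add: dist_real_def)
qed

text \<open>Projecting a dense set of classes gives a dense set of histories, as the projection is
  nonexpansive and fixes histories.\<close>

lemma state_space_dense:
  "\<exists>D. countable D \<and> D \<subseteq> state_space \<tau> \<and>
    (state_space \<tau> :: ('x::{real_inner,banach,second_countable_topology} L2 \<times> 'x) set) \<subseteq> closure D"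
proof -
  obtain C :: "'x L2 set" where C: "countable C" "closure C = UNIV" using L2_separable by blast
  obtain E :: "'x set" where E: "countable E" and dense: "\<And>X. open X \<Longrightarrow> X \<noteq> {} \<Longrightarrow> \<exists>d\<in>E. d \<in> X"
    by (erule countable_dense_setE)
  define D where "D = cut_hist \<tau> ` C \<times> E"
  have "p \<in> closure D" if p: "p \<in> state_space \<tau>" for p
    unfolding closure_approachable
  proof (intro allI impI)
    fix e :: real assume e: "0 < e"
    then have e2: "0 < e / 2" by simp
    have "fst p \<in> closure C" using C(2) by simp
    then obtain c where c: "c \<in> C" "dist c (fst p) < e / 2"
      using e2 unfolding closure_approachable by blast
    have "cut_hist \<tau> (fst p) = fst p" using p by (intro cut_hist_id) (auto simp: state_space_def)
    then have "cut_hist \<tau> c - fst p = cut_hist \<tau> (c - fst p)"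
      using linear_simps(2)[OF bounded_linear_cut_hist, of \<tau> c "fst p"] by simp
    then have c': "dist (cut_hist \<tau> c) (fst p) < e / 2"
      using norm_cut_hist_le[of \<tau> "c - fst p"] c(2) by (simp add: dist_norm)
    obtain x where x: "x \<in> E" "x \<in> ball (snd p) (e / 2)"
      using dense[of "ball (snd p) (e / 2)"] e2 by auto
    have "dist (cut_hist \<tau> c, x) p \<le> dist (cut_hist \<tau> c) (fst p) + dist x (snd p)"
      unfolding dist_prod_def by (simp add: sqrt_sum_squares_le_sum)
    also have "\<dots> < e" using c' x by (simp add: dist_commute)
    finally show "\<exists>y\<in>D. dist y p < e" using c x unfolding D_def by blast
  qed
  moreover have "countable D" unfolding D_def using C E by (intro countable_SIGMA countable_image)
  moreover have "D \<subseteq> state_space \<tau>" by (auto simp: D_def state_space_def)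
  ultimately show ?thesis by blast
qed

section \<open>The linearised delay equation\<close>

lemma norm_fst_snd_le: "norm (fst p) + norm (snd p) \<le> 2 * norm p"
  for p :: "'a::real_normed_vector \<times> 'b::real_normed_vector"
  using norm_fst_le[of "fst p" "snd p"] norm_snd_le[of "snd p" "fst p"] by simp

lemma hist_space_add: "\<phi> \<in> hist_space \<tau> \<Longrightarrow> \<psi> \<in> hist_space \<tau> \<Longrightarrow> \<phi> + \<psi> \<in> hist_space \<tau>"
  by (rule subspace_add[OF subspace_hist_space])

lemma hist_space_diff: "\<phi> \<in> hist_space \<tau> \<Longrightarrow> \<psi> \<in> hist_space \<tau> \<Longrightarrow> \<phi> - \<psi> \<in> hist_space \<tau>"
  by (rule subspace_diff[OF subspace_hist_space])

text \<open>The data of the pathwise analysis. The derivatives of \<open>f\<close> are functions on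
  the ambient type, with properties assumed on \<open>hist_space \<tau>\<close> only.\<close>

locale delay_system =
  fixes \<tau> \<mu> l :: real
    and DA :: "'x::{real_inner,banach,second_countable_topology} set"
    and A :: "'x \<Rightarrow> 'x" and S :: "real \<Rightarrow> 'x \<Rightarrow> 'x" and L :: "'x L2 \<Rightarrow>\<^sub>L 'x"
    and f :: "'x L2 \<Rightarrow> 'x" and f' :: "'x L2 \<Rightarrow> 'x L2 \<Rightarrow>\<^sub>L 'x"
    and f'' :: "'x L2 \<Rightarrow> 'x L2 \<Rightarrow>\<^sub>L 'x L2 \<Rightarrow>\<^sub>L 'x"
    and g :: "'m::finite \<Rightarrow> 'x"
  assumes tau_nonneg: "0 \<le> \<tau>" and mu_pos: "0 < \<mu>" and l_nonneg: "0 \<le> l"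
    and g_dom: "\<And>j. g j \<in> DA" and lin_A: "linear_operator DA A" and S: "C0_semigroup S"
    and f_lipschitz: "\<And>\<phi> \<psi>. \<phi> \<in> hist_space \<tau> \<Longrightarrow> \<psi> \<in> hist_space \<tau> \<Longrightarrow> norm (f \<phi> - f \<psi>) \<le> l * norm (\<phi> - \<psi>)"
    and f': "\<And>\<phi>. \<phi> \<in> hist_space \<tau> \<Longrightarrow> (f has_derivative blinfun_apply (f' \<phi>)) (at \<phi> within hist_space \<tau>)"
    and f'': "\<And>\<phi>. \<phi> \<in> hist_space \<tau> \<Longrightarrow> (f' has_derivative blinfun_apply (f'' \<phi>)) (at \<phi> within hist_space \<tau>)"
    and cont_f'': "continuous_on (hist_space \<tau>) f''"
begin

abbreviation noise_seg :: "(real \<Rightarrow> real ^ 'm) \<Rightarrow> real \<Rightarrow> 'x L2"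
  where "noise_seg \<omega> \<equiv> seg \<tau> (noise_path \<mu> g \<omega>)"

definition drift :: "(real \<Rightarrow> real ^ 'm) \<Rightarrow> real \<Rightarrow> 'x L2 \<Rightarrow> 'x \<Rightarrow> 'x"
  where "drift \<omega> s \<psi> x = - \<mu> *\<^sub>R x - L \<psi> - L (noise_seg \<omega> s) + f (\<psi> + noise_seg \<omega> s) + A (noise_path \<mu> g \<omega> s)"

text \<open>\<open>a\<close> is the curve of arguments of \<open>f\<close> along which the drift is
  linearised, a solution segment plus the noise segment. Terms free of the unknown have no
  derivative and drop out.\<close>

definition lin_drift :: "(real \<Rightarrow> 'x L2) \<Rightarrow> real \<Rightarrow> 'x L2 \<Rightarrow> 'x \<Rightarrow> 'x"
  where "lin_drift a s \<psi> x = - \<mu> *\<^sub>R x - L \<psi> + f' (a s) \<psi>"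

abbreviation radius :: "'x L2 \<Rightarrow> real"
  where "radius \<equiv> reg_radius (hist_space \<tau>) f''"

text \<open>Shared by the drift and its linearisation, as \<open>f'\<close> is bounded by
  \<open>l\<close> on histories; one a priori constant then serves both.\<close>

definition drift_lip where "drift_lip = \<mu> + norm L + l"

lemma drift_lip_nonneg: "0 \<le> drift_lip"
  using mu_pos l_nonneg by (simp add: drift_lip_def)

section \<open>Lipschitz bounds for the drift and its linearisation\<close>

lemma noise_seg_in_hist_space: "\<omega> \<in> path_space \<Longrightarrow> 0 \<le> t \<Longrightarrow> noise_seg \<omega> t \<in> hist_space \<tau>"
  by (rule seg_in_hist_space[of _ t]) (auto intro: l2_upto_continuous continuous_noise_path mu_pos)

lemma continuous_on_noise_seg: "\<omega> \<in> path_space \<Longrightarrow> continuous_on {0..T} (noise_seg \<omega>)"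
  by (intro continuous_on_seg l2_upto_continuous continuous_noise_path mu_pos)

lemma continuous_on_f: "continuous_on (hist_space \<tau>) f"
  by (rule has_derivative_continuous_on[OF f'])

lemma norm_f'_le: "\<phi> \<in> hist_space \<tau> \<Longrightarrow> \<psi> \<in> hist_space \<tau> \<Longrightarrow> norm (f' \<phi> \<psi>) \<le> l * norm \<psi>"
  by (rule norm_derivative_le_lipschitz[OF subspace_hist_space f' f_lipschitz])

lemma lipschitz_drift:
  assumes \<omega>: "\<omega> \<in> path_space"
  shows "lipschitz_rhs \<tau> T drift_lip (drift \<omega>)"
  unfolding lipschitz_rhs_def
proof (intro conjI ballI allI impI drift_lip_nonneg)
  fix s :: real and \<phi> \<psi> :: "'x L2" and x y :: 'x
  assume s: "s \<in> {0..T}" and h: "\<phi> \<in> hist_space \<tau>" "\<psi> \<in> hist_space \<tau>"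
  have n: "noise_seg \<omega> s \<in> hist_space \<tau>" using s by (intro noise_seg_in_hist_space \<omega>) simp
  have "drift \<omega> s \<phi> x - drift \<omega> s \<psi> y
      = - (\<mu> *\<^sub>R (x - y)) - L (\<phi> - \<psi>) + (f (\<phi> + noise_seg \<omega> s) - f (\<psi> + noise_seg \<omega> s))"
    by (simp add: drift_def blinfun.diff_right scaleR_diff_right)
  then have "norm (drift \<omega> s \<phi> x - drift \<omega> s \<psi> y)
      \<le> norm (\<mu> *\<^sub>R (x - y)) + norm (L (\<phi> - \<psi>)) + norm (f (\<phi> + noise_seg \<omega> s) - f (\<psi> + noise_seg \<omega> s))"
    using norm_triangle_ineq[of "- (\<mu> *\<^sub>R (x - y)) - L (\<phi> - \<psi>)" "f (\<phi> + noise_seg \<omega> s) - f (\<psi> + noise_seg \<omega> s)"]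
      norm_triangle_ineq4[of "- (\<mu> *\<^sub>R (x - y))" "L (\<phi> - \<psi>)"] by simp
  also have "norm (\<mu> *\<^sub>R (x - y)) = \<mu> * norm (x - y)" using mu_pos by simp
  also have "norm (L (\<phi> - \<psi>)) \<le> norm L * norm (\<phi> - \<psi>)" by (rule norm_blinfun)
  also have "norm (f (\<phi> + noise_seg \<omega> s) - f (\<psi> + noise_seg \<omega> s)) \<le> l * norm (\<phi> - \<psi>)"
    using f_lipschitz[OF hist_space_add[OF h(1) n] hist_space_add[OF h(2) n]] by simp
  also have "\<mu> * norm (x - y) + norm L * norm (\<phi> - \<psi>) + l * norm (\<phi> - \<psi>)
      \<le> drift_lip * (norm (\<phi> - \<psi>) + norm (x - y))"
    using mu_pos l_nonneg by (simp add: drift_lip_def algebra_simps)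
  finally show "norm (drift \<omega> s \<phi> x - drift \<omega> s \<psi> y) \<le> drift_lip * (norm (\<phi> - \<psi>) + norm (x - y))"
    by simp
next
  fix a :: "real \<Rightarrow> 'x L2" and b :: "real \<Rightarrow> 'x"
  assume a: "continuous_on {0..T} a" and b: "continuous_on {0..T} b" and im: "a ` {0..T} \<subseteq> hist_space \<tau>"
  have N: "continuous_on {0..T} (noise_seg \<omega>)" by (rule continuous_on_noise_seg[OF \<omega>])
  have "continuous_on {0..T} (\<lambda>s. f (a s + noise_seg \<omega> s))"
  proof (rule continuous_on_compose2[OF continuous_on_f])
    show "continuous_on {0..T} (\<lambda>s. a s + noise_seg \<omega> s)" by (intro continuous_intros a N)
    show "(\<lambda>s. a s + noise_seg \<omega> s) ` {0..T} \<subseteq> hist_space \<tau>"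
      using im by (auto intro!: hist_space_add noise_seg_in_hist_space[OF \<omega>])
  qed
  moreover have "continuous_on {0..T} (\<lambda>s. A (noise_path \<mu> g \<omega> s))"
    by (rule continuous_on_subset[OF continuous_operator_noise_path[OF \<omega> mu_pos lin_A g_dom]]) simp
  ultimately show "continuous_on {0..T} (\<lambda>s. drift \<omega> s (a s) (b s))"
    unfolding drift_def by (intro continuous_intros a b N)
qed

lemma lin_drift_bound:
  assumes "a s \<in> hist_space \<tau>" "\<psi> \<in> hist_space \<tau>"
  shows "norm (lin_drift a s \<psi> x) \<le> drift_lip * (norm \<psi> + norm x)"
proof -
  have "norm (lin_drift a s \<psi> x) \<le> norm (- \<mu> *\<^sub>R x - L \<psi>) + norm (f' (a s) \<psi>)"
    unfolding lin_drift_def by (rule norm_triangle_ineq)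
  also have "norm (- \<mu> *\<^sub>R x - L \<psi>) \<le> norm (- \<mu> *\<^sub>R x) + norm (L \<psi>)"
    by (rule norm_triangle_ineq4)
  also have "norm (- \<mu> *\<^sub>R x) = \<mu> * norm x" using mu_pos by simp
  also have "norm (L \<psi>) \<le> norm L * norm \<psi>" by (rule norm_blinfun)
  also have "norm (f' (a s) \<psi>) \<le> l * norm \<psi>" by (rule norm_f'_le[OF assms])
  also have "\<mu> * norm x + norm L * norm \<psi> + l * norm \<psi> \<le> drift_lip * (norm \<psi> + norm x)"
    using mu_pos l_nonneg by (simp add: drift_lip_def algebra_simps)
  finally show ?thesis by simp
qed

lemma lin_drift_add: "lin_drift a s (\<phi> + \<psi>) (x + y) = lin_drift a s \<phi> x + lin_drift a s \<psi> y"
  by (simp add: lin_drift_def blinfun.add_right scaleR_add_right)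

lemma lin_drift_scaleR: "lin_drift a s (c *\<^sub>R \<phi>) (c *\<^sub>R x) = c *\<^sub>R lin_drift a s \<phi> x"
  by (simp add: lin_drift_def blinfun.scaleR_right scaleR_diff_right scaleR_add_right)

lemma lin_drift_diff: "lin_drift a s (\<phi> - \<psi>) (x - y) = lin_drift a s \<phi> x - lin_drift a s \<psi> y"
  by (simp add: lin_drift_def blinfun.diff_right scaleR_diff_right)

lemma lipschitz_lin_drift:
  assumes a: "continuous_on {0..T} a" and im: "a ` {0..T} \<subseteq> hist_space \<tau>"
  shows "lipschitz_rhs \<tau> T drift_lip (lin_drift a)"
  unfolding lipschitz_rhs_def
proof (intro conjI ballI allI impI drift_lip_nonneg)
  fix s :: real and \<phi> \<psi> :: "'x L2" and x y :: 'x
  assume s: "s \<in> {0..T}" and h: "\<phi> \<in> hist_space \<tau>" "\<psi> \<in> hist_space \<tau>"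
  show "norm (lin_drift a s \<phi> x - lin_drift a s \<psi> y) \<le> drift_lip * (norm (\<phi> - \<psi>) + norm (x - y))"
    unfolding lin_drift_diff[symmetric] using im s by (intro lin_drift_bound hist_space_diff h) auto
next
  fix b :: "real \<Rightarrow> 'x L2" and c :: "real \<Rightarrow> 'x"
  assume b: "continuous_on {0..T} b" and c: "continuous_on {0..T} c"
  have "continuous_on {0..T} (\<lambda>s. f' (a s))"
    by (rule continuous_on_compose2[OF has_derivative_continuous_on[OF f''] a im])
  then show "continuous_on {0..T} (\<lambda>s. lin_drift a s (b s) (c s))"
    unfolding lin_drift_def by (intro continuous_intros b c)
qed

section \<open>Differences and superposition of solutions\<close>

lemma volterra_diff:
  assumes F: "lipschitz_rhs \<tau> T k1 F" "volterra_solution S \<tau> F T p x"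
    and G: "lipschitz_rhs \<tau> T k2 G" "volterra_solution S \<tau> G T p' y" and t: "t \<in> {0..T}"
  shows "x t - y t = S t (snd p - snd p') + (LBINT s:{0..t}. S (t - s)
    (F s (Seg \<tau> (fst p) x s) (x s) - G s (Seg \<tau> (fst p') y s) (y s)))"
proof -
  have "S t (snd p - snd p') = S t (snd p) - S t (snd p')"
    using t by (intro linear_simps(2) semigroup_linear[OF S]) auto
  then show ?thesis
    using convolution_diff[OF S tau_nonneg
        continuous_on_rhs[OF S tau_nonneg F(1) volterra_solution_continuous[OF F(2)], of "fst p"]
        continuous_on_rhs[OF S tau_nonneg G(1) volterra_solution_continuous[OF G(2)], of "fst p'"] t]
      volterra_solution_eq[OF F(2) t] volterra_solution_eq[OF G(2) t] by simp
qed

lemma lin_solution_add: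
  assumes a: "continuous_on {0..T} a" "a ` {0..T} \<subseteq> hist_space \<tau>"
    and x: "volterra_solution S \<tau> (lin_drift a) T p x" and y: "volterra_solution S \<tau> (lin_drift a) T p' y"
  shows "volterra_solution S \<tau> (lin_drift a) T (p + p') (\<lambda>t. x t + y t)"
  unfolding volterra_solution_def
proof (intro conjI ballI)
  note G = lipschitz_lin_drift[OF a]
  note cx = volterra_solution_continuous[OF x] and cy = volterra_solution_continuous[OF y]
  show "continuous_on {0..T} (\<lambda>t. x t + y t)" by (intro continuous_intros cx cy)
  fix t assume t: "t \<in> {0..T}"
  let ?q = "\<lambda>p x s. lin_drift a s (Seg \<tau> (fst p) x s) (x s)"
  have i: "set_integrable lborel {0..t} (\<lambda>s. S (t - s) (?q p x s))"
      "set_integrable lborel {0..t} (\<lambda>s. S (t - s) (?q p' y s))"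
    using t by (auto intro!: set_integrable_convolution[OF S] continuous_on_rhs[OF S tau_nonneg G] cx cy)
  have "(LBINT s:{0..t}. S (t - s) (?q (p + p') (\<lambda>t. x t + y t) s))
      = (LBINT s:{0..t}. S (t - s) (?q p x s) + S (t - s) (?q p' y s))"
  proof (rule set_lebesgue_integral_cong, simp, intro allI impI)
    fix s assume s: "s \<in> {0..t}"
    then have sT: "s \<in> {0..T}" using t by simp
    show "S (t - s) (?q (p + p') (\<lambda>t. x t + y t) s) = S (t - s) (?q p x s) + S (t - s) (?q p' y s)"
      using s by (simp add: Seg_add[OF tau_nonneg cx cy sT] lin_drift_add linear_simps(1)[OF semigroup_linear[OF S]])
  qed
  also have "\<dots> = (LBINT s:{0..t}. S (t - s) (?q p x s)) + (LBINT s:{0..t}. S (t - s) (?q p' y s))"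
    by (rule set_integral_add(2)[OF i])
  finally show "x t + y t = S t (snd (p + p')) + (LBINT s:{0..t}. S (t - s) (?q (p + p') (\<lambda>t. x t + y t) s))"
    using volterra_solution_eq[OF x t] volterra_solution_eq[OF y t] t
    by (simp add: linear_simps(1)[OF semigroup_linear[OF S]])
qed

lemma lin_solution_scaleR:
  assumes a: "continuous_on {0..T} a" "a ` {0..T} \<subseteq> hist_space \<tau>"
    and x: "volterra_solution S \<tau> (lin_drift a) T p x"
  shows "volterra_solution S \<tau> (lin_drift a) T (c *\<^sub>R p) (\<lambda>t. c *\<^sub>R x t)"
  unfolding volterra_solution_def
proof (intro conjI ballI)
  note cx = volterra_solution_continuous[OF x]
  show "continuous_on {0..T} (\<lambda>t. c *\<^sub>R x t)" by (intro continuous_intros cx)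
  fix t assume t: "t \<in> {0..T}"
  let ?q = "\<lambda>p x s. lin_drift a s (Seg \<tau> (fst p) x s) (x s)"
  have "(LBINT s:{0..t}. S (t - s) (?q (c *\<^sub>R p) (\<lambda>t. c *\<^sub>R x t) s))
      = (LBINT s:{0..t}. c *\<^sub>R S (t - s) (?q p x s))"
  proof (rule set_lebesgue_integral_cong, simp, intro allI impI)
    fix s assume s: "s \<in> {0..t}"
    then have sT: "s \<in> {0..T}" using t by simp
    show "S (t - s) (?q (c *\<^sub>R p) (\<lambda>t. c *\<^sub>R x t) s) = c *\<^sub>R S (t - s) (?q p x s)"
      using s by (simp add: Seg_scaleR[OF tau_nonneg cx sT] lin_drift_scaleR linear_simps(5)[OF semigroup_linear[OF S]])
  qed
  also have "\<dots> = c *\<^sub>R (LBINT s:{0..t}. S (t - s) (?q p x s))"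
    by (rule set_integral_scaleR_right)
  finally show "c *\<^sub>R x t = S t (snd (c *\<^sub>R p)) + (LBINT s:{0..t}. S (t - s) (?q (c *\<^sub>R p) (\<lambda>t. c *\<^sub>R x t) s))"
    using volterra_solution_eq[OF x t] t
    by (simp add: linear_simps(5)[OF semigroup_linear[OF S]] scaleR_add_right)
qed

text \<open>Besides the semigroup and the delay it depends only on \<open>drift_lip\<close> and the
  time horizon 1, so it is the same for all noise paths and initial states.\<close>

definition apriori_C where "apriori_C = (SOME apriori_C. apriori_const S \<tau> 1 drift_lip apriori_C)"

lemma apriori_C: "apriori_const S \<tau> 1 drift_lip apriori_C"
  unfolding apriori_C_def by (rule someI_ex) (rule apriori_bound[OF S tau_nonneg _ drift_lip_nonneg], simp)

lemma apriori_C_ge_1: "1 \<le> apriori_C"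
  using apriori_C by (simp add: apriori_const_def)

text \<open>The 1 comes from the difference of the initial histories, the rest from the difference
  of the forward paths over a window of length \<open>\<tau>\<close>.\<close>

definition hist_lip where "hist_lip = 1 + sqrt \<tau> * (2 * apriori_C)"

text \<open>Projecting the direction makes the solution defined and linear on the whole ambient
  type; on \<open>state_space \<tau>\<close> the projection changes nothing.\<close>

definition derivative :: "(real \<Rightarrow> 'x L2) \<Rightarrow> 'x L2 \<times> 'x \<Rightarrow> real \<Rightarrow> 'x"
  where "derivative a p = (SOME x. volterra_solution S \<tau> (lin_drift a) 1 (cut_hist \<tau> (fst p), snd p) x)"

context
  fixes a :: "real \<Rightarrow> 'x L2"
  assumes a: "continuous_on {0..1} a" "a ` {0..1} \<subseteq> hist_space \<tau>"
begin

lemma derivative_solution: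
  "volterra_solution S \<tau> (lin_drift a) 1 (cut_hist \<tau> (fst p), snd p) (derivative a p)"
proof -
  have "\<exists>x. volterra_solution S \<tau> (lin_drift a) 1 (cut_hist \<tau> (fst p), snd p) x"
    by (rule volterra_solution_exists[OF S tau_nonneg lipschitz_lin_drift[OF a]]) simp_all
  from someI_ex[OF this] show ?thesis unfolding derivative_def .
qed

lemma continuous_on_derivative: "continuous_on {0..1} (derivative a p)"
  by (rule volterra_solution_continuous[OF derivative_solution])

text \<open>Linearity follows from uniqueness: the sum of two solutions solves the equation for the
  summed data, so the arbitrary choice in \<open>derivative\<close> is immaterial on
  \<open>[0,1]\<close>.\<close>

lemma derivative_add: "t \<in> {0..1} \<Longrightarrow> derivative a (p + p') t = derivative a p t + derivative a p' t"
proof (rule volterra_solution_unique[OF S tau_nonneg lipschitz_lin_drift[OF a]])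
  show "volterra_solution S \<tau> (lin_drift a) 1 (cut_hist \<tau> (fst (p + p')), snd (p + p')) (derivative a (p + p'))"
    by (rule derivative_solution)
  show "volterra_solution S \<tau> (lin_drift a) 1 (cut_hist \<tau> (fst (p + p')), snd (p + p')) (\<lambda>t. derivative a p t + derivative a p' t)"
    using lin_solution_add[OF a derivative_solution[of p] derivative_solution[of p']]
    by (simp add: cut_hist_add)
qed auto

lemma derivative_scaleR: "t \<in> {0..1} \<Longrightarrow> derivative a (c *\<^sub>R p) t = c *\<^sub>R derivative a p t"
proof (rule volterra_solution_unique[OF S tau_nonneg lipschitz_lin_drift[OF a]])
  show "volterra_solution S \<tau> (lin_drift a) 1 (cut_hist \<tau> (fst (c *\<^sub>R p)), snd (c *\<^sub>R p)) (derivative a (c *\<^sub>R p))"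
    by (rule derivative_solution)
  show "volterra_solution S \<tau> (lin_drift a) 1 (cut_hist \<tau> (fst (c *\<^sub>R p)), snd (c *\<^sub>R p)) (\<lambda>t. c *\<^sub>R derivative a p t)"
    using lin_solution_scaleR[OF a derivative_solution[of p], of c]
    by (simp add: cut_hist_scaleR)
qed auto

lemma norm_derivative_le:
  assumes t: "t \<in> {0..1}"
  shows "norm (derivative a p t) \<le> 2 * apriori_C * norm p"
proof -
  let ?y = "Seg \<tau> (cut_hist \<tau> (fst p)) (derivative a p)"
  let ?q = "\<lambda>s. lin_drift a s (?y s) (derivative a p s)"
  have "norm (derivative a p t) \<le> apriori_C * (norm (cut_hist \<tau> (fst p)) + norm (snd p) + 0)"
  proof (rule apriori_constD[OF apriori_C continuous_on_derivative _ _ _ _ _ t])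
    show "continuous_on {0..1} ?q"
      by (rule continuous_on_rhs[OF S tau_nonneg lipschitz_lin_drift[OF a] continuous_on_derivative])
  next
    fix t :: real assume "t \<in> {0..1}"
    from volterra_solution_eq[OF derivative_solution this, of p]
    show "derivative a p t = S t (snd p) + (LBINT s:{0..t}. S (t - s)
      (?q s))" by simp
  next
    fix s :: real assume s: "s \<in> {0..1}"
    have "norm (?q s)
        \<le> drift_lip * (norm (?y s) + norm (derivative a p s))"
      using a(2) s by (intro lin_drift_bound Seg_in_hist_space[OF tau_nonneg continuous_on_derivative]) auto
    then show "norm (?q s)
        \<le> drift_lip * (norm (?y s) + norm (derivative a p s)) + 0" by simp
  qed auto
  also have "\<dots> \<le> apriori_C * (2 * norm p)"
    using norm_cut_hist_le[of \<tau> "fst p"] norm_fst_snd_le[of p] apriori_C_ge_1 by (intro mult_left_mono) auto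
  finally show ?thesis by (simp add: mult_ac)
qed

definition D_op :: "'x L2 \<times> 'x \<Rightarrow> 'x L2 \<times> 'x"
  where "D_op p = (Seg \<tau> (cut_hist \<tau> (fst p)) (derivative a p) 1, derivative a p 1)"

lemma bounded_linear_D_op: "bounded_linear D_op"
proof (rule bounded_linear_intro[where K = "1 + sqrt \<tau> * (2 * apriori_C) + 2 * apriori_C"])
  fix p p' :: "'x L2 \<times> 'x" and c :: real
  have "Seg \<tau> (cut_hist \<tau> (fst (p + p'))) (derivative a (p + p')) 1
      = Seg \<tau> (cut_hist \<tau> (fst p) + cut_hist \<tau> (fst p')) (\<lambda>t. derivative a p t + derivative a p' t) 1"
    unfolding fst_add cut_hist_add
    by (rule Seg_cong[OF tau_nonneg continuous_on_derivative]) (auto simp: derivative_add)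
  then show "D_op (p + p') = D_op p + D_op p'"
    by (simp add: D_op_def derivative_add Seg_add[OF tau_nonneg continuous_on_derivative continuous_on_derivative])
  have "Seg \<tau> (cut_hist \<tau> (fst (c *\<^sub>R p))) (derivative a (c *\<^sub>R p)) 1
      = Seg \<tau> (c *\<^sub>R cut_hist \<tau> (fst p)) (\<lambda>t. c *\<^sub>R derivative a p t) 1"
    unfolding fst_scaleR cut_hist_scaleR
    by (rule Seg_cong[OF tau_nonneg continuous_on_derivative]) (auto simp: derivative_scaleR)
  then show "D_op (c *\<^sub>R p) = c *\<^sub>R D_op p"
    by (simp add: D_op_def derivative_scaleR Seg_scaleR[OF tau_nonneg continuous_on_derivative])
  have "norm (D_op p) \<le> norm (Seg \<tau> (cut_hist \<tau> (fst p)) (derivative a p) 1) + norm (derivative a p 1)"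
    unfolding D_op_def by (rule norm_Pair_le)
  also have "norm (Seg \<tau> (cut_hist \<tau> (fst p)) (derivative a p) 1)
      \<le> norm (cut_hist \<tau> (fst p)) + sqrt \<tau> * (2 * apriori_C * norm p)"
    by (intro norm_Seg_le[OF tau_nonneg continuous_on_derivative] norm_derivative_le) auto
  also have "norm (cut_hist \<tau> (fst p)) \<le> norm p"
    using norm_cut_hist_le[of \<tau> "fst p"] norm_fst_le[of "fst p" "snd p"] by simp
  also have "norm (derivative a p 1) \<le> 2 * apriori_C * norm p" by (rule norm_derivative_le) simp
  finally show "norm (D_op p) \<le> norm p * (1 + sqrt \<tau> * (2 * apriori_C) + 2 * apriori_C)"
    by (simp add: algebra_simps)
qed

lemma D_op_in_state_space: "D_op p \<in> state_space \<tau>"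
  unfolding D_op_def state_space_def
  using Seg_in_hist_space[OF tau_nonneg continuous_on_derivative, of 1] by simp

end

end

section \<open>Differentiability of the solution operator\<close>

lemma subspace_state_space: "subspace (state_space \<tau> :: ('x::{real_inner,banach,second_countable_topology} L2 \<times> 'x) set)"
  unfolding state_space_def by (intro subspace_Times subspace_hist_space subspace_UNIV)

context delay_system
begin

section \<open>Mild solutions and the Volterra equation\<close>

lemma mild_solution_drift:
  "mild_solution \<tau> \<mu> A S L f g \<omega> p v \<longleftrightarrow>
    l2_fun (\<lambda>\<xi>. if \<xi> \<in> {-\<tau>..0} then v \<xi> else 0) \<and>
    seg \<tau> v 0 = fst p \<and> v 0 = snd p \<and> continuous_on {0..} v \<and>
    (\<forall>t\<ge>0. v t = S t (snd p) + (LBINT s:{0..t}. S (t - s) (drift \<omega> s (seg \<tau> v s) (v s))))"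
  unfolding mild_solution_def drift_def ..

lemma seg_mild_solution:
  assumes v: "mild_solution \<tau> \<mu> A S L f g \<omega> p v" and t: "0 \<le> t"
  shows "seg \<tau> v t = Seg \<tau> (fst p) v t"
proof -
  have "continuous_on {0..t} v"
    using v by (auto simp: mild_solution_drift intro: continuous_on_subset)
  then have "seg \<tau> v t = Seg \<tau> (seg \<tau> v 0) v t"
    using v t tau_nonneg by (intro seg_eq_Seg) (auto simp only: mild_solution_drift atLeastAtMost_iff)
  then show ?thesis using v by (simp add: mild_solution_drift)
qed

lemma volterra_solution_mild:
  assumes v: "mild_solution \<tau> \<mu> A S L f g \<omega> p v"
  shows "volterra_solution S \<tau> (drift \<omega>) T p v"
  unfolding volterra_solution_def
proof (intro conjI ballI)
  show "continuous_on {0..T} v"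
    using v by (auto simp: mild_solution_drift intro: continuous_on_subset)
  fix t assume t: "t \<in> {0..T}"
  then have "v t = S t (snd p) + (LBINT s:{0..t}. S (t - s) (drift \<omega> s (seg \<tau> v s) (v s)))"
    using v by (simp add: mild_solution_drift)
  also have "(LBINT s:{0..t}. S (t - s) (drift \<omega> s (seg \<tau> v s) (v s)))
      = (LBINT s:{0..t}. S (t - s) (drift \<omega> s (Seg \<tau> (fst p) v s) (v s)))"
    by (rule set_lebesgue_integral_cong) (auto simp: seg_mild_solution[OF v])
  finally show "v t = S t (snd p) + (LBINT s:{0..t}. S (t - s) (drift \<omega> s (Seg \<tau> (fst p) v s) (v s)))" .
qed

text \<open>Guarantees that the choice in \<open>Phi\<close> picks an actual solution.\<close>

lemma mild_solution_exists:
  assumes \<omega>: "\<omega> \<in> path_space" and p: "p \<in> state_space \<tau>"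
  shows "\<exists>v. mild_solution \<tau> \<mu> A S L f g \<omega> p v"
proof -
  have hp: "fst p \<in> hist_space \<tau>" using p by (auto simp: state_space_def)
  obtain x where x: "\<And>T. 0 \<le> T \<Longrightarrow> volterra_solution S \<tau> (drift \<omega>) T p x"
    using volterra_solution_global[OF S tau_nonneg lipschitz_drift[OF \<omega>] hp] by blast
  have cx: "continuous_on {0..T} x" if "0 \<le> T" for T by (rule volterra_solution_continuous[OF x[OF that]])
  define v where "v = glue (fst p) x"
  have vx: "v t = x t" if "0 \<le> t" for t using that by (simp add: v_def glue_def)
  have segv: "seg \<tau> v = Seg \<tau> (fst p) x" by (simp add: v_def Seg_def)
  have "mild_solution \<tau> \<mu> A S L f g \<omega> p v"
    unfolding mild_solution_drift
  proof (intro conjI allI impI)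
    have "l2_upto \<tau> 0 v" unfolding v_def by (intro l2_upto_glue cx tau_nonneg) auto
    then show "l2_fun (\<lambda>\<xi>. if \<xi> \<in> {-\<tau>..0} then v \<xi> else 0)" by (simp only: l2_upto_def)
    show "seg \<tau> v 0 = fst p" unfolding segv by (rule Seg_0[OF hp tau_nonneg])
    have "(LBINT s:{0..0}. S (0 - s) (drift \<omega> s (Seg \<tau> (fst p) x s) (x s))) = 0"
      unfolding set_lebesgue_integral_def
      by (rule integral_eq_zero_AE) (use AE_lborel_singleton[of "0::real"] in \<open>eventually_elim, simp\<close>)
    then show "v 0 = snd p"
      using volterra_solution_eq[OF x[of 0], of 0] by (simp add: vx semigroup_0[OF S])
    \<comment> \<open>Continuity on each \<open>[0,T]\<close> suffices, since a convergent sequence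
      of times is bounded.\<close>
    show "continuous_on {0..} v"
    proof (rule continuous_on_sequentiallyI)
      fix u :: "nat \<Rightarrow> real" and t assume u: "\<forall>n. u n \<in> {0..}" and t: "t \<in> {0..}" and lim: "u \<longlonglongrightarrow> t"
      obtain R where R: "\<And>n. u n \<le> R" using lim convergent_bounded_above by blast
      have uR: "u n \<in> {0..max R t}" for n using R[of n] u by (auto simp: le_max_iff_disj)
      have "(\<lambda>n. x (u n)) \<longlonglongrightarrow> x t"
        using cx[of "max R t"] t uR lim unfolding continuous_on_sequentially by (auto simp: o_def)
      then show "(\<lambda>n. v (u n)) \<longlonglongrightarrow> v t" using u t by (simp add: vx)
    qed
    fix t :: real assume t: "0 \<le> t"
    have "v t = S t (snd p) + (LBINT s:{0..t}. S (t - s) (drift \<omega> s (Seg \<tau> (fst p) x s) (x s)))"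
      using volterra_solution_eq[OF x[OF t], of t] t by (simp add: vx)
    also have "(LBINT s:{0..t}. S (t - s) (drift \<omega> s (Seg \<tau> (fst p) x s) (x s)))
        = (LBINT s:{0..t}. S (t - s) (drift \<omega> s (seg \<tau> v s) (v s)))"
      by (rule set_lebesgue_integral_cong) (auto simp: segv vx)
    finally show "v t = S t (snd p) + (LBINT s:{0..t}. S (t - s) (drift \<omega> s (seg \<tau> v s) (v s)))" .
  qed
  then show ?thesis by blast
qed

text \<open>The same choice as in \<open>Phi\<close>, so that \<open>Phi\<close> unfolds to it
  directly.\<close>

definition flow :: "(real \<Rightarrow> real ^ 'm) \<Rightarrow> 'x L2 \<times> 'x \<Rightarrow> real \<Rightarrow> 'x"
  where "flow \<omega> p = (SOME v. mild_solution \<tau> \<mu> A S L f g \<omega> p v)"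

text \<open>The Taylor remainder contributes \<open>(1 + 2 * l) * hist_lip\<^sup>2\<close>, the a
  priori bound \<open>apriori_C\<close>, and the two components of the state
  \<open>sqrt \<tau>\<close> and 1. No part depends on the noise.\<close>

definition remainder_const :: real
  where "remainder_const = (1 + sqrt \<tau>) * apriori_C * (1 + 2 * l) * hist_lip\<^sup>2"

context
  fixes \<omega> :: "real \<Rightarrow> real ^ 'm"
  assumes \<omega>: "\<omega> \<in> path_space"
begin

abbreviation hist_flow :: "'x L2 \<times> 'x \<Rightarrow> real \<Rightarrow> 'x L2"
  where "hist_flow p \<equiv> Seg \<tau> (fst p) (flow \<omega> p)"

lemma mild_solution_flow: "p \<in> state_space \<tau> \<Longrightarrow> mild_solution \<tau> \<mu> A S L f g \<omega> p (flow \<omega> p)"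
  unfolding flow_def by (rule someI_ex[OF mild_solution_exists[OF \<omega>]])

lemma flow_solution: "p \<in> state_space \<tau> \<Longrightarrow> volterra_solution S \<tau> (drift \<omega>) T p (flow \<omega> p)"
  by (rule volterra_solution_mild[OF mild_solution_flow])

abbreviation "Phi' \<equiv> Phi \<tau> \<mu> A S L f g"

lemma Phi_eq: "p \<in> state_space \<tau> \<Longrightarrow> 0 \<le> t \<Longrightarrow> Phi' t \<omega> p = (hist_flow p t, flow \<omega> p t)"
  using seg_mild_solution[OF mild_solution_flow] unfolding Phi_def Let_def flow_def[symmetric] by simp

lemma continuous_on_flow: "p \<in> state_space \<tau> \<Longrightarrow> continuous_on {0..T} (flow \<omega> p)"
  by (rule volterra_solution_continuous[OF flow_solution])

lemma continuous_on_hist_flow: "p \<in> state_space \<tau> \<Longrightarrow> continuous_on {0..T} (hist_flow p)"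
  by (rule continuous_on_Seg[OF tau_nonneg continuous_on_flow])

lemma hist_flow_in: "p \<in> state_space \<tau> \<Longrightarrow> 0 \<le> t \<Longrightarrow> hist_flow p t \<in> hist_space \<tau>"
  by (rule Seg_in_hist_space[OF tau_nonneg continuous_on_flow[of _ t]]) auto

text \<open>The difference is driven by a forcing of linear growth with \<open>Q = 0\<close>; the
  factor 2 compares the sum of the component norms with the product norm.\<close>

lemma norm_flow_diff_le:
  assumes p: "p \<in> state_space \<tau>" and p': "p' \<in> state_space \<tau>" and t: "t \<in> {0..1}"
  shows "norm (flow \<omega> p t - flow \<omega> p' t) \<le> 2 * apriori_C * norm (p - p')"
proof -
  let ?x = "flow \<omega> p" and ?y = "flow \<omega> p'"
  let ?q = "\<lambda>p s. drift \<omega> s (hist_flow p s) (flow \<omega> p s)"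
  note G = lipschitz_drift[OF \<omega>, of 1]
  note cx = continuous_on_flow[OF p, of 1] and cy = continuous_on_flow[OF p', of 1]
  have "norm (?x t - ?y t) \<le> apriori_C * (norm (fst (p - p')) + norm (snd (p - p')) + 0)"
  proof (rule apriori_constD[OF apriori_C _ _ _ _ _ _ t])
    show "continuous_on {0..1} (\<lambda>t. ?x t - ?y t)" by (intro continuous_intros cx cy)
    show "continuous_on {0..1} (\<lambda>s. ?q p s - ?q p' s)"
      by (intro continuous_on_diff continuous_on_rhs[OF S tau_nonneg G] cx cy)
    show "fst (p - p') \<in> hist_space \<tau>"
      using p p' by (auto simp: state_space_def intro: hist_space_diff)
  next
    fix t :: real assume t: "t \<in> {0..1}"
    show "?x t - ?y t = S t (snd (p - p')) + (LBINT s:{0..t}. S (t - s) (?q p s - ?q p' s))"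
      using volterra_diff[OF G flow_solution[OF p] G flow_solution[OF p'] t] by simp
  next
    fix s :: real assume s: "s \<in> {0..1}"
    have "Seg \<tau> (fst (p - p')) (\<lambda>t. ?x t - ?y t) s = hist_flow p s - hist_flow p' s"
      using Seg_diff[OF tau_nonneg cx cy s] by simp
    then show "norm (?q p s - ?q p' s)
        \<le> drift_lip * (norm (Seg \<tau> (fst (p - p')) (\<lambda>t. ?x t - ?y t) s) + norm (?x s - ?y s)) + 0"
      using lipschitz_rhsD[OF G s hist_flow_in[OF p] hist_flow_in[OF p']] s by simp
  qed simp
  also have "\<dots> \<le> apriori_C * (2 * norm (p - p'))"
    using norm_fst_snd_le[of "p - p'"] apriori_C_ge_1 by (intro mult_left_mono) auto
  finally show ?thesis by simp
qed

lemma norm_hist_flow_diff_le: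
  assumes p: "p \<in> state_space \<tau>" and p': "p' \<in> state_space \<tau>" and t: "t \<in> {0..1}"
  shows "norm (hist_flow p t - hist_flow p' t) \<le> hist_lip * norm (p - p')"
proof -
  note cx = continuous_on_flow[OF p, of 1] and cy = continuous_on_flow[OF p', of 1]
  have "hist_flow p t - hist_flow p' t = Seg \<tau> (fst p - fst p') (\<lambda>t. flow \<omega> p t - flow \<omega> p' t) t"
    using Seg_diff[OF tau_nonneg cx cy t] by simp
  also have "norm \<dots> \<le> norm (fst p - fst p') + sqrt \<tau> * (2 * apriori_C * norm (p - p'))"
  proof (rule norm_Seg_le[OF tau_nonneg _ t])
    show "continuous_on {0..1} (\<lambda>t. flow \<omega> p t - flow \<omega> p' t)" by (intro continuous_intros cx cy)
    show "fst p - fst p' \<in> hist_space \<tau>"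
      using p p' by (auto simp: state_space_def intro: hist_space_diff)
    show "norm (flow \<omega> p r - flow \<omega> p' r) \<le> 2 * apriori_C * norm (p - p')" if "r \<in> {0..t}" for r
      using that t by (intro norm_flow_diff_le p p') auto
  qed
  also have "norm (fst p - fst p') \<le> norm (p - p')"
    using norm_fst_le[of "fst (p - p')" "snd (p - p')"] unfolding fst_diff[symmetric] prod.collapse .
  finally show ?thesis by (simp add: hist_lip_def algebra_simps)
qed

text \<open>The operator is the linearised solution map at time 1 along the trajectory of
  \<open>p\<close>, fixed before \<open>h\<close>. A bound on the radius along this trajectory is
  enough, without one along that of \<open>p + h\<close>, since the expansion of \<open>f\<close> is
  centred on the former.\<close>

lemma Phi_differentiable:
  assumes p: "p \<in> state_space \<tau>" and m: "0 < m"
    and m_le: "\<And>s. s \<in> {0..1} \<Longrightarrow> m \<le> radius (hist_flow p s + noise_seg \<omega> s)"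
  shows "\<exists>D :: ('x L2 \<times> 'x) \<Rightarrow>\<^sub>L ('x L2 \<times> 'x). blinfun_apply D ` state_space \<tau> \<subseteq> state_space \<tau> \<and>
    (\<forall>h\<in>state_space \<tau>. norm (Phi' 1 \<omega> (p + h) - Phi' 1 \<omega> p - D h)
      \<le> remainder_const / m * (norm h)\<^sup>2)"
proof -
  define a where "a s = hist_flow p s + noise_seg \<omega> s" for s
  have a: "continuous_on {0..1} a"
    unfolding a_def by (intro continuous_intros continuous_on_hist_flow p continuous_on_noise_seg \<omega>)
  have a_in: "a s \<in> hist_space \<tau>" if "0 \<le> s" for s
    unfolding a_def by (intro hist_space_add hist_flow_in p noise_seg_in_hist_space \<omega> that)
  then have im: "a ` {0..1} \<subseteq> hist_space \<tau>" by auto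
  define D where "D = Blinfun (D_op a)"
  have D: "blinfun_apply D = D_op a"
    unfolding D_def by (rule bounded_linear_Blinfun_apply[OF bounded_linear_D_op[OF a im]])
  have "norm (Phi' 1 \<omega> (p + h) - Phi' 1 \<omega> p - D h)
      \<le> remainder_const / m * (norm h)\<^sup>2" if h: "h \<in> state_space \<tau>" for h
  proof -
    have ph: "p + h \<in> state_space \<tau>" by (rule subspace_add[OF subspace_state_space p h])
    have fh: "fst h \<in> hist_space \<tau>" using h by (auto simp: state_space_def)
    have cut: "cut_hist \<tau> (fst h) = fst h" by (rule cut_hist_id[OF fh])
    let ?x = "flow \<omega> (p + h)" and ?y = "flow \<omega> p" and ?w = "derivative a h"
    have w: "volterra_solution S \<tau> (lin_drift a) 1 h ?w"
      using derivative_solution[OF a im, of h] by (simp add: cut)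
    note G = lipschitz_drift[OF \<omega>, of 1] and Lin = lipschitz_lin_drift[OF a im]
    note cx = continuous_on_flow[OF ph, of 1] and cy = continuous_on_flow[OF p, of 1]
      and cw = volterra_solution_continuous[OF w]
    \<comment> \<open>The linearisation error, a path with zero initial state.\<close>
    define r where "r t = ?x t - ?y t - ?w t" for t
    have cr: "continuous_on {0..1} r" unfolding r_def by (intro continuous_intros cx cy cw)
    define d where "d s = hist_flow (p + h) s - hist_flow p s" for s
    have Seg_r: "Seg \<tau> 0 r s = d s - Seg \<tau> (fst h) ?w s" if s: "s \<in> {0..1}" for s
    proof -
      have "continuous_on {0..1} (\<lambda>t. ?x t - ?y t)" by (intro continuous_intros cx cy)
      from Seg_diff[OF tau_nonneg this cw s, of "fst h" "fst h"] Seg_diff[OF tau_nonneg cx cy s, of "fst (p + h)" "fst p"]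
      show ?thesis by (simp add: d_def r_def[abs_def])
    qed
    let ?qF = "\<lambda>p s. drift \<omega> s (hist_flow p s) (flow \<omega> p s)"
    let ?qL = "\<lambda>s. lin_drift a s (Seg \<tau> (fst h) ?w s) (?w s)"
    define q where "q s = ?qF (p + h) s - ?qF p s - ?qL s" for s
    \<comment> \<open>Bound on the Taylor remainder along the trajectory, as
      \<open>norm (d s)\<close> is at most \<open>hist_lip * norm h\<close>.\<close>
    define E where "E = (1 + 2 * l) / m * (hist_lip * norm h)\<^sup>2"
    have E0: "0 \<le> E" unfolding E_def using m l_nonneg by simp
    have cqF: "continuous_on {0..1} (?qF (p + h))" "continuous_on {0..1} (?qF p)"
      and cqL: "continuous_on {0..1} ?qL"
      by (intro continuous_on_rhs[OF S tau_nonneg G] continuous_on_rhs[OF S tau_nonneg Lin] cx cy cw)+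
    have r_bound: "norm (r t) \<le> apriori_C * E" if t: "t \<in> {0..1}" for t
    proof -
      have "norm (r t) \<le> apriori_C * (norm (0 :: 'x L2) + norm (0 :: 'x) + E)"
      proof (rule apriori_constD[OF apriori_C cr _ _ E0 _ _ t])
        show "continuous_on {0..1} q"
          unfolding q_def by (intro continuous_on_diff cqF cqL)
        show "(0 :: 'x L2) \<in> hist_space \<tau>" by (rule subspace_0[OF subspace_hist_space])
      next
        fix t :: real assume t: "t \<in> {0..1}"
        have "?x t - ?y t = S t (snd h) + (LBINT s:{0..t}. S (t - s) (?qF (p + h) s - ?qF p s))"
          using volterra_diff[OF G flow_solution[OF ph] G flow_solution[OF p] t] by simp
        moreover have "(LBINT s:{0..t}. S (t - s) (?qF (p + h) s - ?qF p s)) - (LBINT s:{0..t}. S (t - s) (?qL s))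
            = (LBINT s:{0..t}. S (t - s) (q s))"
          unfolding q_def
          by (rule convolution_diff[OF S tau_nonneg continuous_on_diff[OF cqF] cqL t])
        moreover have "S t 0 = 0" using t by (intro linear_simps(3) semigroup_linear[OF S]) simp
        ultimately show "r t = S t 0 + (LBINT s:{0..t}. S (t - s) (q s))"
          using volterra_solution_eq[OF w t] by (simp add: r_def)
      next
        fix s :: real assume s: "s \<in> {0..1}"
        have s0: "0 \<le> s" using s by simp
        have d_in: "d s \<in> hist_space \<tau>" unfolding d_def by (intro hist_space_diff hist_flow_in p ph s0)
        have Sr_in: "Seg \<tau> 0 r s \<in> hist_space \<tau>" by (rule Seg_in_hist_space[OF tau_nonneg cr s])
        \<comment> \<open>The parts with \<open>\<mu>\<close> and \<open>L\<close> are linear and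
          leave only their values on the error. For \<open>f\<close>, the linearisation acts on
          \<open>d s - Seg \<tau> 0 r s\<close>, which leaves the Taylor remainder for the increment
          \<open>d s\<close> plus \<open>f' (a s)\<close> applied to
          \<open>Seg \<tau> 0 r s\<close>.\<close>
        have "q s = (f (a s + d s) - f (a s) - f' (a s) (d s)) + lin_drift a s (Seg \<tau> 0 r s) (r s)"
        proof -
          have 1: "hist_flow (p + h) s + noise_seg \<omega> s = a s + d s" by (simp add: a_def d_def)
          have 2: "L (hist_flow (p + h) s) = L (hist_flow p s) + L (d s)"
            by (simp add: d_def blinfun.diff_right)
          have 3: "?x s = ?y s + (r s + ?w s)" by (simp add: r_def)
          have 4: "Seg \<tau> (fst h) ?w s = d s - Seg \<tau> 0 r s" using Seg_r[OF s] by simp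
          show ?thesis
            unfolding q_def drift_def lin_drift_def 1 2 3 4 a_def[of s, symmetric]
            by (simp add: blinfun.diff_right scaleR_add_right algebra_simps)
        qed
        then have "norm (q s) \<le> norm (f (a s + d s) - f (a s) - f' (a s) (d s)) + norm (lin_drift a s (Seg \<tau> 0 r s) (r s))"
          by (simp add: norm_triangle_ineq)
        also have "norm (lin_drift a s (Seg \<tau> 0 r s) (r s)) \<le> drift_lip * (norm (Seg \<tau> 0 r s) + norm (r s))"
          by (rule lin_drift_bound[where a = a, OF a_in[OF s0] Sr_in])
        also have "norm (f (a s + d s) - f (a s) - f' (a s) (d s)) \<le> E"
        proof -
          have "norm (f (a s + d s) - f (a s) - f' (a s) (d s))
              \<le> (1 + 2 * l) / radius (a s) * (norm (d s))\<^sup>2"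
            by (rule taylor_remainder_le[OF subspace_hist_space f' f'' cont_f'' f_lipschitz l_nonneg a_in[OF s0] d_in])
          also have "\<dots> \<le> (1 + 2 * l) / m * (hist_lip * norm h)\<^sup>2"
          proof (intro mult_mono divide_left_mono power_mono)
            show "m \<le> radius (a s)" unfolding a_def by (rule m_le[OF s])
            then show "0 < radius (a s) * m" using m by simp
            show "norm (d s) \<le> hist_lip * norm h"
              unfolding d_def using norm_hist_flow_diff_le[OF ph p s] by simp
          qed (use l_nonneg m in auto)
          finally show ?thesis by (simp only: E_def)
        qed
        finally show "norm (q s) \<le> drift_lip * (norm (Seg \<tau> 0 r s) + norm (r s)) + E" by simp
      qed
      then show ?thesis by simp
    qed
    have "Phi' 1 \<omega> (p + h) - Phi' 1 \<omega> p - D h = (Seg \<tau> 0 r 1, r 1)"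
      using Seg_r[of 1] by (simp add: Phi_eq[OF ph] Phi_eq[OF p] D D_op_def[OF a im] cut r_def d_def)
    also have "norm \<dots> \<le> norm (Seg \<tau> 0 r 1) + norm (r 1)" by (rule norm_Pair_le)
    also have "norm (Seg \<tau> 0 r 1) \<le> norm (0 :: 'x L2) + sqrt \<tau> * (apriori_C * E)"
      by (intro norm_Seg_le[OF tau_nonneg cr] subspace_0[OF subspace_hist_space] r_bound) auto
    also have "norm (r 1) \<le> apriori_C * E" by (rule r_bound) simp
    also have "norm (0 :: 'x L2) + sqrt \<tau> * (apriori_C * E) + apriori_C * E = remainder_const / m * (norm h)\<^sup>2"
      by (simp add: remainder_const_def E_def power_mult_distrib algebra_simps add_divide_distrib)
    finally show ?thesis by simp
  qed
  moreover have "blinfun_apply D ` state_space \<tau> \<subseteq> state_space \<tau>"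
    unfolding D using D_op_in_state_space[OF a im] by blast
  ultimately show ?thesis by blast
qed

end

end

section \<open>The derivative on the attractor\<close>

theorem theorem4p1:
  fixes \<tau> \<mu> Lf :: real
    and DA :: "'x::{real_inner,banach,second_countable_topology} set"
    and A :: "'x \<Rightarrow> 'x"
    and S :: "real \<Rightarrow> 'x \<Rightarrow> 'x"
    and L :: "'x L2 \<Rightarrow>\<^sub>L 'x"
    and f :: "'x L2 \<Rightarrow> 'x"
    and g :: "'m::finite \<Rightarrow> 'x"
    and P :: "(real \<Rightarrow> real ^ 'm) measure"
    and \<A> :: "(real \<Rightarrow> real ^ 'm) \<Rightarrow> ('x L2 \<times> 'x) set"
  assumes "\<tau> > 0" and "\<mu> > 0"
    and "wiener_measure P"
    and "\<And>j. g j \<in> DA"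
    \<comment> \<open>(A1)\<close>
    and "closure DA = UNIV" and "linear_operator DA A"
    and "C0_semigroup S" and "compact_semigroup S" and "generates DA A S"
    and "norm L \<le> \<mu>"
    and "varrho \<tau> \<mu> DA A < 0"
    \<comment> \<open>(A2)\<close>
    and "f 0 = 0"
    and "\<And>\<phi> \<psi>. \<phi> \<in> hist_space \<tau> \<Longrightarrow> \<psi> \<in> hist_space \<tau> \<Longrightarrow> norm (f \<phi> - f \<psi>) \<le> Lf * norm (\<phi> - \<psi>)"
    and "varrho \<tau> \<mu> DA A < ereal (- \<mu> / 2)"
    and "varrho \<tau> \<mu> DA A + ereal Lf < 0"
    and "C2_on (hist_space \<tau>) f"
    and "\<A> \<in> tempered_sets P wshift (state_space \<tau>)"
    and "pullback_random_attractor P wshift (state_space \<tau>)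
           (tempered_sets P wshift (state_space \<tau>)) (Psi \<tau> \<mu> A S L f g) \<A>"
  shows "\<exists>(K :: (real \<Rightarrow> real ^ 'm) \<Rightarrow> real) (\<alpha> :: real).
    K \<in> borel_measurable P \<and> (\<forall>\<omega>\<in>space P. 1 \<le> K \<omega>) \<and> 0 < \<alpha> \<and>
    (AE \<omega> in P. \<forall>u\<in>\<A> \<omega>. \<exists>DPsi :: ('x L2 \<times> 'x) \<Rightarrow>\<^sub>L ('x L2 \<times> 'x).
       blinfun_apply DPsi ` state_space \<tau> \<subseteq> state_space \<tau> \<and>
       (\<forall>h. u + h \<in> \<A> \<omega> \<longrightarrow>
         norm (Psi \<tau> \<mu> A S L f g 1 \<omega> (u + h) - Psi \<tau> \<mu> A S L f g 1 \<omega> u - DPsi h)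
           \<le> K \<omega> * norm h powr (1 + \<alpha>)))"
proof -
  obtain f' :: "'x L2 \<Rightarrow> 'x L2 \<Rightarrow>\<^sub>L 'x" and f'' :: "'x L2 \<Rightarrow> 'x L2 \<Rightarrow>\<^sub>L 'x L2 \<Rightarrow>\<^sub>L 'x"
    where f': "\<forall>x\<in>hist_space \<tau>. (f has_derivative blinfun_apply (f' x)) (at x within hist_space \<tau>)"
      and f'': "\<forall>x\<in>hist_space \<tau>. (f' has_derivative blinfun_apply (f'' x)) (at x within hist_space \<tau>)"
      and cont: "continuous_on (hist_space \<tau>) f''"
    using \<open>C2_on (hist_space \<tau>) f\<close> unfolding C2_on_def by blast
  \<comment> \<open>The absolute value supplies the nonnegative constant that
    \<open>delay_system\<close> asks for.\<close>
  have lip: "norm (f \<phi> - f \<psi>) \<le> \<bar>Lf\<bar> * norm (\<phi> - \<psi>)"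
    if "\<phi> \<in> hist_space \<tau>" "\<psi> \<in> hist_space \<tau>" for \<phi> \<psi>
    using assms(13)[OF that] by (rule order_trans) (simp add: mult_right_mono)
  interpret delay_system \<tau> \<mu> "\<bar>Lf\<bar>" DA A S L f f' f'' g
    by unfold_locales (use assms(1,2,4,6,7) lip f' f'' cont in auto)
  have sets_P: "sets P = sets path_algebra" and space_P: "space P = path_space"
    using assms(3) by (auto simp: wiener_measure_def)
  have rs: "random_set P (state_space \<tau>) \<A>"
    and comp: "\<And>\<omega>. \<omega> \<in> space P \<Longrightarrow> compact (\<A> \<omega>)"
    and inv: "AE \<omega> in P. \<forall>t\<ge>0. Psi \<tau> \<mu> A S L f g t \<omega> ` \<A> \<omega> = \<A> (wshift t \<omega>)"
    using assms(18) by (auto simp: pullback_random_attractor_def)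
  have in_H: "\<A> \<omega> \<subseteq> state_space \<tau>" if "\<omega> \<in> path_space" for \<omega>
    using rs that by (auto simp: random_set_def space_P)
  obtain D :: "('x L2 \<times> 'x) set" where D: "countable D" "D \<subseteq> state_space \<tau>" "state_space \<tau> \<subseteq> closure D"
    using state_space_dense by blast
  \<comment> \<open>The radius sees the history component alone; on the state space it is still
    1-Lipschitz, since the first projection is nonexpansive.\<close>
  define \<rho> :: "'x L2 \<times> 'x \<Rightarrow> real" where "\<rho> x = radius (fst x)" for x
  have \<rho>_pos: "0 < \<rho> x" and \<rho>_le: "\<rho> x \<le> 1" if "x \<in> state_space \<tau>" for x
    using that reg_radius_pos[OF cont] reg_radius_le_1[OF cont] by (auto simp: \<rho>_def state_space_def)
  have \<rho>_lip: "\<rho> x \<le> \<rho> y + dist x y" if "x \<in> state_space \<tau>" "y \<in> state_space \<tau>" for x y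
  proof -
    have "\<rho> x \<le> \<rho> y + dist (fst x) (fst y)"
      unfolding \<rho>_def using that by (intro reg_radius_lipschitz[OF cont]) (auto simp: state_space_def)
    then show ?thesis using dist_fst_le[of x y] by simp
  qed
  define I where "I = \<rat> \<inter> {0..1::real}"
  \<comment> \<open>The inner infimum equals that of \<open>\<rho>\<close> over the fibre at
    \<open>wshift t \<omega>\<close>, written with distances to the fibre. Both index sets are
    countable, so measurability of the random set and of the shift is enough.\<close>
  define M where "M \<omega> = (INF t\<in>I. INF d\<in>D. ennreal (\<rho> d) + set_dist d (\<A> (wshift t \<omega>)))" for \<omega>
  \<comment> \<open>Where \<open>M \<omega>\<close> is 0 or infinite, \<open>enn2real\<close> gives
    0 and so does the division by 0, hence \<open>K\<close> is 1 there. Thus \<open>K\<close> is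
    real and at least 1 on all of \<open>space P\<close>, exceptional paths included.\<close>
  define K where "K \<omega> = max 1 (remainder_const / enn2real (M \<omega>))" for \<omega>
  have meas_shift: "wshift t \<in> measurable P P" for t
    using measurable_wshift[of t] by (subst measurable_cong_sets[OF sets_P sets_P])
  have "(\<lambda>\<omega>. set_dist d (\<A> (wshift t \<omega>))) \<in> borel_measurable P" if "d \<in> D" for d t
  proof -
    have "(\<lambda>\<omega>. set_dist d (\<A> \<omega>)) \<in> borel_measurable P"
      using rs D(2) that unfolding random_set_def by blast
    from measurable_compose[OF meas_shift this] show ?thesis .
  qed
  moreover have "countable I" unfolding I_def by (intro countable_Int1 countable_rat)
  ultimately have "M \<in> borel_measurable P"
    unfolding M_def using D(1) by (intro borel_measurable_INF borel_measurable_add borel_measurable_const) auto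
  then have K_meas: "K \<in> borel_measurable P"
    unfolding K_def by (intro borel_measurable_max borel_measurable_divide borel_measurable_const borel_measurable_enn2real)
  have K_ge: "1 \<le> K \<omega>" "remainder_const / enn2real (M \<omega>) \<le> K \<omega>" for \<omega> by (auto simp: K_def)
  let ?diff = "\<lambda>\<omega> u. \<exists>DPsi :: ('x L2 \<times> 'x) \<Rightarrow>\<^sub>L ('x L2 \<times> 'x).
       blinfun_apply DPsi ` state_space \<tau> \<subseteq> state_space \<tau> \<and>
       (\<forall>h. u + h \<in> \<A> \<omega> \<longrightarrow>
         norm (Psi \<tau> \<mu> A S L f g 1 \<omega> (u + h) - Psi \<tau> \<mu> A S L f g 1 \<omega> u - DPsi h)
           \<le> K \<omega> * norm h powr (1 + 1))"
  have "AE \<omega> in P. \<forall>u\<in>\<A> \<omega>. ?diff \<omega> u"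
    using inv AE_space
  proof eventually_elim
    case (elim \<omega>)
    then have \<omega>: "\<omega> \<in> path_space"
      and inv: "\<And>t. 0 \<le> t \<Longrightarrow> Psi \<tau> \<mu> A S L f g t \<omega> ` \<A> \<omega> = \<A> (wshift t \<omega>)"
      by (auto simp: space_P)
    let ?\<Psi> = "Psi \<tau> \<mu> A S L f g"
    define Z where "Z = noise_state \<tau> \<mu> g \<omega>"
    have Z: "Z \<in> state_space \<tau>"
      using noise_seg_in_hist_space[OF \<omega>, of 0] by (simp add: Z_def noise_state_def state_space_def)
    have p_in: "v - Z \<in> state_space \<tau>" if "v \<in> \<A> \<omega>" for v
      using in_H[OF \<omega>] that Z by (blast intro: subspace_diff[OF subspace_state_space])
    \<comment> \<open>The argument of \<open>f\<close> at time \<open>t\<close> along the solution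
      that starts at \<open>v\<close> in the coordinates of \<open>Psi\<close>.\<close>
    define G where "G t v = hist_flow \<omega> (v - Z) t + noise_seg \<omega> t" for t v
    have fst_Psi: "fst (?\<Psi> t \<omega> v) = G t v" if "v \<in> \<A> \<omega>" "0 \<le> t" for t v
      unfolding Psi_def Z_def[symmetric]
      using that by (simp add: Phi_eq[OF \<omega> p_in] G_def noise_state_def seg_noise_path_wshift)
    have G_in: "G t v \<in> hist_space \<tau>" if "v \<in> \<A> \<omega>" "0 \<le> t" for t v
      unfolding G_def using that by (intro hist_space_add hist_flow_in[OF \<omega> p_in] noise_seg_in_hist_space[OF \<omega>])
    have cont_G: "continuous_on {0..1} (\<lambda>t. G t v)" if "v \<in> \<A> \<omega>" for v
      unfolding G_def using that
      by (intro continuous_intros continuous_on_hist_flow[OF \<omega> p_in] continuous_on_noise_seg[OF \<omega>])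
    \<comment> \<open>\<open>G\<close> is Lipschitz in \<open>v\<close> with a constant uniform in
      \<open>t\<close>, and continuous in \<open>t\<close> for fixed \<open>v\<close>; together this
      gives joint continuity.\<close>
    have cont_G2: "continuous_on ({0..1} \<times> \<A> \<omega>) (\<lambda>x. G (fst x) (snd x))"
    proof (rule continuous_on_sequentiallyI)
      fix u :: "nat \<Rightarrow> real \<times> ('x L2 \<times> 'x)" and b
      assume u: "\<forall>n. u n \<in> {0..1} \<times> \<A> \<omega>" and b: "b \<in> {0..1} \<times> \<A> \<omega>" and lim: "u \<longlonglongrightarrow> b"
      let ?e = "\<lambda>n. hist_lip * norm (snd (u n) - snd b) + norm (G (fst (u n)) (snd b) - G (fst b) (snd b))"
      have le: "norm (G (fst (u n)) (snd (u n)) - G (fst b) (snd b))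
          \<le> ?e n" for n
      proof -
        have un: "fst (u n) \<in> {0..1}" "snd (u n) \<in> \<A> \<omega>" and bA: "snd b \<in> \<A> \<omega>"
          using u b by (auto simp: mem_Times_iff)
        have "norm (G (fst (u n)) (snd (u n)) - G (fst (u n)) (snd b)) \<le> hist_lip * norm (snd (u n) - snd b)"
          using norm_hist_flow_diff_le[OF \<omega> p_in[OF un(2)] p_in[OF bA] un(1)] by (simp add: G_def)
        then show ?thesis
          using norm_triangle_ineq[of "G (fst (u n)) (snd (u n)) - G (fst (u n)) (snd b)"
              "G (fst (u n)) (snd b) - G (fst b) (snd b)"] by simp
      qed
      have "(\<lambda>n. G (fst (u n)) (snd b)) \<longlonglongrightarrow> G (fst b) (snd b)"
        using cont_G[of "snd b"] u b tendsto_fst[OF lim] unfolding continuous_on_sequentially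
        by (auto simp: o_def mem_Times_iff)
      then have e: "?e \<longlonglongrightarrow> hist_lip * norm (snd b - snd b) + norm (G (fst b) (snd b) - G (fst b) (snd b))"
        by (intro tendsto_intros tendsto_snd[OF lim])
      then have e: "?e \<longlonglongrightarrow> 0"
        by simp
      then have "(\<lambda>n. G (fst (u n)) (snd (u n)) - G (fst b) (snd b)) \<longlonglongrightarrow> 0"
        by (rule Lim_null_comparison[OF always_eventually[OF allI[OF le]]])
      then show "(\<lambda>n. G (fst (u n)) (snd (u n))) \<longlonglongrightarrow> G (fst b) (snd b)" by (rule LIM_zero_cancel)
    qed
    show ?case
    proof
      fix u assume u: "u \<in> \<A> \<omega>"
      have "compact ({0..1::real} \<times> \<A> \<omega>)" using comp elim(2) by (intro compact_Times) auto
      moreover have "{0..1::real} \<times> \<A> \<omega> \<noteq> {}" using u by auto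
      moreover have "continuous_on ({0..1} \<times> \<A> \<omega>) (\<lambda>x. radius (G (fst x) (snd x)))"
        by (rule continuous_on_compose2[OF continuous_on_reg_radius[OF cont] cont_G2]) (use G_in in auto)
      ultimately obtain b where b: "b \<in> {0..1} \<times> \<A> \<omega>"
        and min: "\<And>x. x \<in> {0..1} \<times> \<A> \<omega> \<Longrightarrow>
          radius (G (fst b) (snd b)) \<le> radius (G (fst x) (snd x))"
        using continuous_attains_inf[of "{0..1} \<times> \<A> \<omega>" "\<lambda>x. radius (G (fst x) (snd x))"] by blast
      \<comment> \<open>The minimum runs over the whole fibre and not only over the trajectory of
        \<open>u\<close>, so that it can be compared with infima over fibres.\<close>
      define m0 where "m0 = radius (G (fst b) (snd b))"
      have m0: "0 < m0"
        unfolding m0_def using b by (intro reg_radius_pos[OF cont] G_in) (auto simp: mem_Times_iff)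
      have shift_H: "\<A> (wshift t \<omega>) \<subseteq> state_space \<tau>" for t by (rule in_H[OF wshift_in_path_space[OF \<omega>]])
      have "ennreal m0 \<le> M \<omega>"
        unfolding M_def
      proof (rule INF_greatest)
        fix t assume "t \<in> I"
        then have t: "t \<in> {0..1}" by (simp add: I_def)
        show "ennreal m0 \<le> (INF d\<in>D. ennreal (\<rho> d) + set_dist d (\<A> (wshift t \<omega>)))"
        proof (rule le_INF_add_set_dist[OF \<rho>_lip _ D(2) shift_H])
          fix w assume "w \<in> \<A> (wshift t \<omega>)"
          \<comment> \<open>One half of invariance: each point of the later fibre is reached from a
            point of \<open>\<A> \<omega>\<close>.\<close>
          then have "w \<in> ?\<Psi> t \<omega> ` \<A> \<omega>" using inv[of t] t by simp
          then obtain v where v: "v \<in> \<A> \<omega>" "w = ?\<Psi> t \<omega> v" by blast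
          then show "m0 \<le> \<rho> w"
            using min[of "(t, v)"] t fst_Psi[of v t] by (simp add: m0_def \<rho>_def)
        qed (use \<rho>_pos in \<open>auto intro: less_imp_le\<close>)
      qed
      \<comment> \<open>The other half of invariance: the trajectory of \<open>u\<close> stays in
        the later fibres.\<close>
      moreover have M_le: "M \<omega> \<le> ennreal (\<rho> (?\<Psi> t \<omega> u))" if t: "t \<in> I" for t
      proof -
        have "0 \<le> t" using t by (simp add: I_def)
        then have uA: "?\<Psi> t \<omega> u \<in> \<A> (wshift t \<omega>)" using inv u by blast
        have "M \<omega> \<le> (INF d\<in>D. ennreal (\<rho> d) + set_dist d (\<A> (wshift t \<omega>)))"
          unfolding M_def using t by (rule INF_lower)
        also have "\<dots> \<le> ennreal (\<rho> (?\<Psi> t \<omega> u))"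
          using uA shift_H[of t] by (intro INF_add_set_dist_le[OF \<rho>_lip _ D(2,3)]) (auto intro: less_imp_le \<rho>_pos)
        finally show ?thesis .
      qed
      define m where "m = enn2real (M \<omega>)"
      \<comment> \<open>Time 0 belongs to \<open>I\<close>, so \<open>M \<omega>\<close> lies below
        a real number and \<open>enn2real\<close> loses nothing.\<close>
      have "M \<omega> < \<infinity>"
        using M_le[of 0] by (auto simp: I_def intro: le_less_trans)
      then have M: "M \<omega> = ennreal m" by (simp add: m_def)
      have m: "0 < m"
        using \<open>ennreal m0 \<le> M \<omega>\<close> m0 unfolding M by (simp add: m_def ennreal_le_iff)
      have m_le: "m \<le> radius (hist_flow \<omega> (u - Z) t + noise_seg \<omega> t)" if t: "t \<in> {0..1}" for t
      proof -
        \<comment> \<open>Continuity in time extends the bound from rational times to all of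
          \<open>[0,1]\<close>, as \<open>Phi_differentiable\<close> requires.\<close>
        have "m \<le> radius (G t u)"
        proof (rule le_on_unit_interval_if_le_on_Rats[OF _ _ t])
          show "continuous_on {0..1} (\<lambda>t. radius (G t u))"
            by (rule continuous_on_compose2[OF continuous_on_reg_radius[OF cont] cont_G[OF u]]) (use G_in[OF u] in auto)
          fix r :: real assume r: "r \<in> \<rat>" "r \<in> {0..1}"
          then have "ennreal m \<le> ennreal (\<rho> (?\<Psi> r \<omega> u))" using M_le[of r] by (simp add: M I_def)
          moreover have "0 < \<rho> (?\<Psi> r \<omega> u)"
            using r u G_in[OF u] by (simp add: \<rho>_def fst_Psi reg_radius_pos[OF cont])
          ultimately show "m \<le> radius (G r u)"
            using r u by (simp add: ennreal_le_iff \<rho>_def fst_Psi)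
        qed
        then show ?thesis by (simp add: G_def)
      qed
      obtain DP :: "('x L2 \<times> 'x) \<Rightarrow>\<^sub>L ('x L2 \<times> 'x)" where DP: "blinfun_apply DP ` state_space \<tau> \<subseteq> state_space \<tau>"
        and rem: "\<And>h. h \<in> state_space \<tau> \<Longrightarrow>
          norm (Phi' 1 \<omega> (u - Z + h) - Phi' 1 \<omega> (u - Z) - DP h) \<le> remainder_const / m * (norm h)\<^sup>2"
        using Phi_differentiable[OF \<omega> p_in[OF u] m m_le] by blast
      have "norm (?\<Psi> 1 \<omega> (u + h) - ?\<Psi> 1 \<omega> u - DP h) \<le> K \<omega> * norm h powr (1 + 1)" if h: "u + h \<in> \<A> \<omega>" for h
      proof -
        have "(u + h) - u \<in> state_space \<tau>"
          using in_H[OF \<omega>] u h by (blast intro: subspace_diff[OF subspace_state_space])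
        then have hH: "h \<in> state_space \<tau>" by simp
        \<comment> \<open>The final noise state cancels in the difference and the initial one only
          moves the base point, so the derivative of \<open>Phi\<close> at \<open>u - Z\<close>
          serves for \<open>Psi\<close> at \<open>u\<close>.\<close>
        have "?\<Psi> 1 \<omega> (u + h) - ?\<Psi> 1 \<omega> u = Phi' 1 \<omega> (u - Z + h) - Phi' 1 \<omega> (u - Z)"
          by (simp add: Psi_def Z_def algebra_simps)
        then have "norm (?\<Psi> 1 \<omega> (u + h) - ?\<Psi> 1 \<omega> u - DP h) \<le> remainder_const / m * (norm h)\<^sup>2"
          using rem[OF hH] by simp
        also have "\<dots> \<le> K \<omega> * (norm h)\<^sup>2"
          using K_ge(2)[of \<omega>] by (intro mult_right_mono) (simp_all add: m_def)
        also have "(norm h)\<^sup>2 = norm h powr (1 + 1)" by (simp add: powr_numeral)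
        finally show ?thesis .
      qed
      then show "?diff \<omega> u"
        using DP by blast
    qed
  qed
  then show ?thesis
    using K_meas K_ge(1) by (intro exI[of _ K] exI[of _ "1::real"]) simp
qed

end
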